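(* Let $k\ge 2$ and $n\ge 3$ be integers, and let $f_t\in \mathrm{Imm}^{k}(\Gamma,\mathbf{R}^{n})$, $t\in[0,1]$, be a $\mathcal{C}^2$-homotopy of curves with nonvanishing curvature. Suppose that $f_0$ and $f_1$ have constant curvature. Then, for any $\varepsilon>0$, there exists a $\mathcal{C}^2$-homotopy $\tilde f_t\in\mathrm{Imm}^k(\Gamma,\mathbf{R}^n)$, $t\in[0,1]$, of curves with constant curvature such that $\tilde f_0=f_0$, $\tilde f_1=f_1$, and $|\tilde f_t- f_t|_1\leq\varepsilon$ for all $t\in[0,1]$.
   Context: $\Gamma$ is either an interval $[a,b]\subset\mathbf{R}$ or the topological circle $\mathbf{R}/((b-a)\mathbf{Z})$. $\mathcal{C}^k(\Gamma,\mathbf{R}^n)$ is the space of $\mathcal{C}^k$ maps $f\colon\Gamma\to\mathbf{R}^n$ with the topology induced by the standard $\mathcal{C}^k$-norm $|\cdot|_k$ (sum of the sup norms of the derivatives of order $0,\dots,k$). $\mathrm{Imm}^k(\Gamma,\mathbf{R}^n)\subset\mathcal{C}^k(\Gamma,\mathbf{R}^n)$ is the set of locally injective maps, with nonvanishing derivative when $k\ge1$; its elements are called curves. For $\ell\le k$, a $\mathcal{C}^\ell$-homotopy $f_t\in\mathrm{Imm}^k(\Gamma,\mathbf{R}^n)$ is a family of elements of $\mathrm{Imm}^k(\Gamma,\mathbf{R}^n)$, $t\in[0,1]$, such that $t\mapsto f_t$ is continuous with respect to the $\mathcal{C}^\ell$-norm. The tantrix of a curve $f$ is $T:=f'/|f'|$,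 and the curvature of $f\in\mathrm{Imm}^2(\Gamma,\mathbf{R}^n)$ is $\kappa:=|T'|/|f'|$. A homotopy of curves with constant (resp. nonvanishing) curvature is one such that, for each $t$, the curvature of the curve at time $t$ is a constant function on $\Gamma$ (the constant may depend on $t$) (resp. is nowhere zero on $\Gamma$). *)

theory Defs
  imports "HOL-Analysis.Analysis"
begin

text \<open>
  The domain of a curve is the interval \<open>[a, b]\<close> or the circle \<open>\<real> / (b - a)\<int>\<close>. A map on the interval
  is a function on \<^typ>\<open>real\<close> whose values outside \<open>[a, b]\<close> are irrelevant; a map on the circle is
  represented by its \<open>(b - a)\<close>-periodic lift to the whole line.
\<close>

datatype curve_domain = Interval real real | Circle real real

fun points :: "curve_domain \<Rightarrow> real set" where
  "points (Interval a b) = {a..b}"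
| "points (Circle a b) = UNIV"

fun map_on :: "curve_domain \<Rightarrow> (real \<Rightarrow> 'v) \<Rightarrow> bool" where
  "map_on (Interval a b) f \<longleftrightarrow> True"
| "map_on (Circle a b) f \<longleftrightarrow> (\<forall>x. f (x + (b - a)) = f x)"

text \<open>Derivatives at the endpoints of an interval are one-sided.\<close>

definition vderiv :: "curve_domain \<Rightarrow> (real \<Rightarrow> 'v::real_normed_vector) \<Rightarrow> real \<Rightarrow> 'v" where
  "vderiv \<Gamma> f x = vector_derivative f (at x within points \<Gamma>)"

definition nth_vderiv :: "curve_domain \<Rightarrow> nat \<Rightarrow> (real \<Rightarrow> 'v::real_normed_vector) \<Rightarrow> real \<Rightarrow> 'v" where
  "nth_vderiv \<Gamma> j f = (vderiv \<Gamma> ^^ j) f"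

definition Ck :: "curve_domain \<Rightarrow> nat \<Rightarrow> (real \<Rightarrow> 'v::real_normed_vector) set" where
  "Ck \<Gamma> k = {f. map_on \<Gamma> f
     \<and> (\<forall>j<k. \<forall>x\<in>points \<Gamma>. nth_vderiv \<Gamma> j f differentiable (at x within points \<Gamma>))
     \<and> continuous_on (points \<Gamma>) (nth_vderiv \<Gamma> k f)}"

definition Ck_norm :: "curve_domain \<Rightarrow> nat \<Rightarrow> (real \<Rightarrow> 'v::real_normed_vector) \<Rightarrow> real" where
  "Ck_norm \<Gamma> k f = (\<Sum>j\<le>k. SUP x\<in>points \<Gamma>. norm (nth_vderiv \<Gamma> j f x))"

definition locally_injective :: "curve_domain \<Rightarrow> (real \<Rightarrow> 'v) \<Rightarrow> bool" where
  "locally_injective \<Gamma> f \<longleftrightarrow>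
     (\<forall>x\<in>points \<Gamma>. \<exists>U. open U \<and> x \<in> U \<and> inj_on f (U \<inter> points \<Gamma>))"

definition Imm :: "curve_domain \<Rightarrow> nat \<Rightarrow> (real \<Rightarrow> 'v::real_normed_vector) set" where
  "Imm \<Gamma> k = {f \<in> Ck \<Gamma> k. locally_injective \<Gamma> f
     \<and> (1 \<le> k \<longrightarrow> (\<forall>x\<in>points \<Gamma>. vderiv \<Gamma> f x \<noteq> 0))}"

definition curve_homotopy ::
  "curve_domain \<Rightarrow> nat \<Rightarrow> nat \<Rightarrow> (real \<Rightarrow> real \<Rightarrow> 'v::real_normed_vector) \<Rightarrow> bool" where
  "curve_homotopy \<Gamma> k l f \<longleftrightarrow> l \<le> k \<and> (\<forall>t\<in>{0..1}. f t \<in> Imm \<Gamma> k)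
     \<and> (\<forall>t\<in>{0..1}. ((\<lambda>s. Ck_norm \<Gamma> l (\<lambda>x. f s x - f t x)) \<longlongrightarrow> 0) (at t within {0..1}))"

definition tantrix :: "curve_domain \<Rightarrow> (real \<Rightarrow> 'v::real_normed_vector) \<Rightarrow> real \<Rightarrow> 'v" where
  "tantrix \<Gamma> f x = vderiv \<Gamma> f x /\<^sub>R norm (vderiv \<Gamma> f x)"

definition curvature :: "curve_domain \<Rightarrow> (real \<Rightarrow> 'v::real_normed_vector) \<Rightarrow> real \<Rightarrow> real" where
  "curvature \<Gamma> f x = norm (vderiv \<Gamma> (tantrix \<Gamma> f) x) / norm (vderiv \<Gamma> f x)"

definition constant_curvature :: "curve_domain \<Rightarrow> (real \<Rightarrow> 'v::real_normed_vector) \<Rightarrow> bool" where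
  "constant_curvature \<Gamma> f \<longleftrightarrow> (\<exists>c. \<forall>x\<in>points \<Gamma>. curvature \<Gamma> f x = c)"

definition nonvanishing_curvature :: "curve_domain \<Rightarrow> (real \<Rightarrow> 'v::real_normed_vector) \<Rightarrow> bool" where
  "nonvanishing_curvature \<Gamma> f \<longleftrightarrow> (\<forall>x\<in>points \<Gamma>. curvature \<Gamma> f x \<noteq> 0)"

end

theory Submission
  imports Defs
begin

text \<open>
  Let \<open>\<Theta>\<close> be an immersed curve in the unit sphere and \<open>v > 0\<close> a speed. Running through \<open>\<Theta>\<close> with
  a parameter \<open>\<phi>\<close> for which \<open>\<bar>(\<Theta> \<circ> \<phi>)'\<bar> = c v\<close>, with a constant \<open>c\<close>, makes \<open>g' = v (\<Theta> \<circ> \<phi>)\<close> the velocity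
  of a curve of constant curvature \<open>c\<close>. On a circle \<open>g\<close> closes up exactly if the centroid
  \<open>\<integral> \<bar>\<Theta>'\<bar> \<Theta>\<close> vanishes, and \<open>g\<close> is \<open>C\<^sup>1\<close>-close to \<open>f\<close> (for \<open>v = \<bar>f'\<bar>\<close>) if \<open>\<Theta>\<close> is \<open>C\<^sup>0\<close>-close to the tantrix
  \<open>T\<close> of \<open>f\<close> and its length grows nearly proportionally to the length of \<open>f\<close>. As \<open>\<bar>T'\<bar> = \<kappa> \<bar>f'\<bar>\<close> with a
  curvature \<open>\<kappa>\<close> that need not be constant, the tantrix has to be lengthened by the factor \<open>c / \<kappa>\<close>
  for some constant \<open>c > max \<kappa>\<close>: it is corrugated by small oscillations of high frequency. All of this
  is done continuously in \<open>t\<close>, and with \<open>c \<rightarrow> \<kappa>\<close> and all errors tending to \<open>0\<close> as \<open>t \<rightarrow> 0, 1\<close>, where \<open>f\<close>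
  must not be changed.

  Corrugation. Let \<open>N\<close> be the unit vector along \<open>T'\<close> and \<open>\<pi>\<close> the projection onto the complement of
  \<open>T\<close> and \<open>N\<close>, and let \<open>r\<close>, \<open>P\<close> be small with \<open>r' = \<rho>\<close> and \<open>P' = \<rho> \<rho>\<^sup>T - I / (n - 2)\<close>. Move \<open>T\<close> to the direction of
  \<open>T + \<bar>f'\<bar> \<surd>(c\<^sup>2 - \<kappa>\<^sup>2) \<pi> r - \<bar>f'\<bar> (c - \<kappa>) / 2 tr(\<pi> P) N\<close>. Up to terms that are small with \<open>r\<close> and \<open>P\<close> the
  velocity becomes \<open>\<bar>f'\<bar> (\<surd>(c\<^sup>2 - \<kappa>\<^sup>2) \<pi> \<rho> + (\<kappa> - h) N)\<close> with \<open>h = (c - \<kappa>) (\<bar>\<pi> \<rho>\<bar>\<^sup>2 - 1) / 2\<close>, because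
  \<open>tr(\<pi> P') = \<bar>\<pi> \<rho>\<bar>\<^sup>2 - 1\<close>. The identity \<open>(c\<^sup>2 - \<kappa>\<^sup>2) \<bar>\<pi> \<rho>\<bar>\<^sup>2 + (\<kappa> - h)\<^sup>2 = (c + h)\<^sup>2\<close> (a Pythagorean hodograph,
  \<open>norm_leading_velocity\<close>) turns the speed into \<open>\<bar>f'\<bar> (c + h)\<close>: there is no square root left, and the
  oscillating part \<open>h\<close> is itself the derivative of a small function. Hence length and centroid density
  of the corrugated tantrix are \<open>c \<bar>f'\<bar>\<close> and \<open>c f'\<close>, up to derivatives of small functions and small
  errors (\<open>corrugation_estimates\<close>). The oscillation \<open>\<rho>\<close> takes place in the whole space and is isotropic on average,
  with the average of \<open>\<rho> \<rho>\<^sup>T\<close> equal to \<open>I / (n - 2)\<close>; its projection has mean square \<open>1\<close> in every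
  \<open>(n - 2)\<close>-dimensional subspace, so no frame of the normal bundle has to be chosen. This is where
  \<open>n \<ge> 3\<close> enters. The frequency tends to infinity as \<open>t \<rightarrow> 0, 1\<close> (\<open>oscillations\<close>, \<open>corrugation\<close>).

  Closing. Replacing \<open>f'\<close> by \<open>f' + w\<close> with a constant tilt \<open>w\<close> of size at most \<open>r\<^sub>0 t (1 - t)\<close> changes the
  centroid by \<open>c (b - a) w\<close> up to an error that is small and has a small Lipschitz constant in \<open>w\<close>. So the tilt
  which makes the centroid vanish is the fixed point of a contraction and depends continuously on \<open>t\<close>
  (\<open>spherical_family\<close>).

  Regularity. The construction uses one derivative of \<open>f''\<close> and has to return curves of class \<open>C\<^sup>k\<close>. So
  \<open>f'\<close> is first smoothed by moving averages whose width vanishes as \<open>t \<rightarrow> 0, 1\<close> (\<open>smoothing\<close>). At the end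
  times the curves are the original ones, and the construction tends to them in \<open>C\<^sup>2\<close>.
\<close>

section \<open>Maps of class \<open>C\<^sup>k\<close> on arbitrary sets\<close>

named_theorems cdiff_intros

text \<open>  The derivative is quantified existentially at each order, so that one notion covers open sets, where
  maps depending on several parameters live, and closed intervals with one-sided derivatives.\<close>

primrec cdiff :: "nat \<Rightarrow> 'a::real_normed_vector set \<Rightarrow> ('a \<Rightarrow> 'b::real_normed_vector) \<Rightarrow> bool" where
  "cdiff 0 S f \<longleftrightarrow> continuous_on S f"
| "cdiff (Suc k) S f \<longleftrightarrow>
     (\<exists>D. (\<forall>x\<in>S. (f has_derivative D x) (at x within S)) \<and> (\<forall>v. cdiff k S (\<lambda>x. D x v)))"

lemma cdiffI:
  assumes "\<And>x. x \<in> S \<Longrightarrow> (f has_derivative D x) (at x within S)"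
    and "\<And>v. cdiff k S (\<lambda>x. D x v)"
  shows "cdiff (Suc k) S f"
  using assms by auto

lemma cdiff_SucE:
  assumes "cdiff (Suc k) S f"
  obtains D where "\<And>x. x \<in> S \<Longrightarrow> (f has_derivative D x) (at x within S)"
    "\<And>v. cdiff k S (\<lambda>x. D x v)"
  using assms by auto

lemma cdiff_continuous_on: "cdiff k S f \<Longrightarrow> continuous_on S f"
  by (cases k) (auto simp: continuous_on_eq_continuous_within intro: has_derivative_continuous)

lemma cdiff_SucD: "cdiff (Suc k) S f \<Longrightarrow> cdiff k S f"
proof (induction k arbitrary: f)
  case 0
  then show ?case by (metis cdiff_continuous_on cdiff.simps(1))
next
  case (Suc k)
  then show ?case by (metis cdiff.simps(2))
qed

lemma cdiff_mono: "cdiff k S f \<Longrightarrow> j \<le> k \<Longrightarrow> cdiff j S f"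
  by (induction k) (auto simp: le_Suc_eq dest: cdiff_SucD simp del: cdiff.simps)

lemma cdiff_subset: "cdiff k S f \<Longrightarrow> T \<subseteq> S \<Longrightarrow> cdiff k T f"
proof (induction k arbitrary: f)
  case 0
  then show ?case by (auto intro: continuous_on_subset)
next
  case (Suc k)
  obtain D where D: "\<And>x. x\<in>S \<Longrightarrow> (f has_derivative D x) (at x within S)"
    "\<And>v. cdiff k S (\<lambda>x. D x v)" by (rule cdiff_SucE[OF Suc.prems(1)], rule that) blast+
  show ?case
    by (rule cdiffI[where D=D])
      (use D Suc.prems(2) Suc.IH in \<open>auto intro: has_derivative_subset\<close>)
qed

lemma cdiff_cong:
  assumes "\<And>x. x \<in> S \<Longrightarrow> f x = g x" shows "cdiff k S f \<longleftrightarrow> cdiff k S g"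
proof -
  have *: "cdiff k S g" if "cdiff k S f" "\<And>x. x \<in> S \<Longrightarrow> f x = g x" for k and f g :: "'a \<Rightarrow> 'b"
  proof (cases k)
    case 0
    then show ?thesis using that by (auto cong: continuous_on_cong)
  next
    case (Suc j)
    from that(1) obtain D where D: "\<And>x. x\<in>S \<Longrightarrow> (f has_derivative D x) (at x within S)"
      "\<And>v. cdiff j S (\<lambda>x. D x v)" by (auto simp: Suc)
    show ?thesis unfolding Suc
      by (rule cdiffI[where D=D]) (use D that(2) has_derivative_transform[where f=f and g=g] in auto)
  qed
  show ?thesis
    by (rule iffI; erule *) (simp_all add: assms)
qed

lemma cdiff_const [simp, cdiff_intros]: "cdiff k S (\<lambda>x. c)"
proof (induction k arbitrary: c)
  case (Suc k)
  then show ?case by (intro cdiffI[where D="\<lambda>_ _. 0"]) auto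
qed (auto intro: continuous_intros)

lemma cdiff_bounded_linear:
  assumes "bounded_linear f" shows "cdiff k S f"
proof (cases k)
  case 0
  then show ?thesis using assms by (simp add: linear_continuous_on)
next
  case (Suc j)
  show ?thesis unfolding Suc
    by (rule cdiffI[where D="\<lambda>_. f"]) (auto intro: bounded_linear_imp_has_derivative assms)
qed

lemma cdiff_bounded_linear_comp:
  assumes "bounded_linear h" "cdiff k S f" shows "cdiff k S (\<lambda>x. h (f x))"
  using assms(2)
proof (induction k arbitrary: f)
  case 0
  then show ?case using assms(1) by (auto intro: bounded_linear.continuous_on)
next
  case (Suc k)
  obtain D where D: "\<And>x. x\<in>S \<Longrightarrow> (f has_derivative D x) (at x within S)"
    "\<And>v. cdiff k S (\<lambda>x. D x v)" by (rule cdiff_SucE[OF Suc.prems(1)], rule that) blast+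
  show ?case
    by (rule cdiffI[where D="\<lambda>x v. h (D x v)"])
      (use D Suc.IH in \<open>auto intro: bounded_linear.has_derivative[OF assms(1)]\<close>)
qed

lemma cdiff_ident [simp, cdiff_intros]: "cdiff k S (\<lambda>x. x)"
  by (rule cdiff_bounded_linear) (rule bounded_linear_ident)

lemma cdiff_fst [cdiff_intros]: "cdiff k S f \<Longrightarrow> cdiff k S (\<lambda>x. fst (f x))"
  by (rule cdiff_bounded_linear_comp[OF bounded_linear_fst])
lemma cdiff_snd [cdiff_intros]: "cdiff k S f \<Longrightarrow> cdiff k S (\<lambda>x. snd (f x))"
  by (rule cdiff_bounded_linear_comp[OF bounded_linear_snd])

lemma cdiff_add [cdiff_intros]: "cdiff k S f \<Longrightarrow> cdiff k S g \<Longrightarrow> cdiff k S (\<lambda>x. f x + g x)"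
proof (induction k arbitrary: f g)
  case 0
  then show ?case by (auto intro: continuous_intros)
next
  case (Suc k)
  obtain D where D: "\<And>x. x \<in> S \<Longrightarrow> (f has_derivative D x) (at x within S)"
    "\<And>v. cdiff k S (\<lambda>x. D x v)" by (rule cdiff_SucE[OF Suc.prems(1)], rule that) blast+
  obtain E where E: "\<And>x. x \<in> S \<Longrightarrow> (g has_derivative E x) (at x within S)"
    "\<And>v. cdiff k S (\<lambda>x. E x v)" by (rule cdiff_SucE[OF Suc.prems(2)], rule that) blast+
  show ?case
    by (rule cdiffI[where D="\<lambda>x v. D x v + E x v"]) (use D E Suc.IH in \<open>auto intro: has_derivative_add\<close>)
qed

lemma cdiff_minus [cdiff_intros]: "cdiff k S f \<Longrightarrow> cdiff k S (\<lambda>x. - f x)"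
  by (rule cdiff_bounded_linear_comp[OF bounded_linear_minus[OF bounded_linear_ident]])

lemma cdiff_diff [cdiff_intros]: "cdiff k S f \<Longrightarrow> cdiff k S g \<Longrightarrow> cdiff k S (\<lambda>x. f x - g x)"
  using cdiff_add[of k S f "\<lambda>x. - g x"] cdiff_minus[of k S g] by simp

lemma cdiff_sum: "(\<And>i. i \<in> I \<Longrightarrow> cdiff k S (f i)) \<Longrightarrow> cdiff k S (\<lambda>x. \<Sum>i\<in>I. f i x)"
  by (induction I rule: infinite_finite_induct) (simp_all add: cdiff_add)

lemma cdiff_Pair [cdiff_intros]:
  assumes "cdiff k S f" "cdiff k S g" shows "cdiff k S (\<lambda>x. (f x, g x))"
proof -
  have "bounded_linear (\<lambda>y::'b. (y, 0::'c))" "bounded_linear (\<lambda>y::'c. (0::'b, y))"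
    by (intro bounded_linear_Pair bounded_linear_ident bounded_linear_zero)+
  from cdiff_add[OF cdiff_bounded_linear_comp[OF this(1) assms(1)] cdiff_bounded_linear_comp[OF this(2) assms(2)]]
  show ?thesis by simp
qed

lemma cdiff_bilinear:
  assumes h: "bounded_bilinear h"
  shows "cdiff k S f \<Longrightarrow> cdiff k S g \<Longrightarrow> cdiff k S (\<lambda>x. h (f x) (g x))"
proof (induction k arbitrary: f g)
  case 0
  then show ?case using bounded_bilinear.continuous_on[OF h] by auto
next
  case (Suc k)
  obtain D where D: "\<And>x. x \<in> S \<Longrightarrow> (f has_derivative D x) (at x within S)"
    "\<And>v. cdiff k S (\<lambda>x. D x v)" by (rule cdiff_SucE[OF Suc.prems(1)], rule that) blast+
  obtain E where E: "\<And>x. x \<in> S \<Longrightarrow> (g has_derivative E x) (at x within S)"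
    "\<And>v. cdiff k S (\<lambda>x. E x v)" by (rule cdiff_SucE[OF Suc.prems(2)], rule that) blast+
  have fg: "cdiff k S f" "cdiff k S g" using Suc.prems cdiff_SucD by blast+
  show ?case
  proof (rule cdiffI[where D="\<lambda>x v. h (f x) (E x v) + h (D x v) (g x)"])
    show "((\<lambda>x. h (f x) (g x)) has_derivative (\<lambda>v. h (f x) (E x v) + h (D x v) (g x))) (at x within S)"
      if "x \<in> S" for x
      by (rule bounded_bilinear.FDERIV[OF h D(1)[OF that] E(1)[OF that]])
    show "cdiff k S (\<lambda>x. h (f x) (E x v) + h (D x v) (g x))" for v
      by (intro cdiff_add Suc.IH fg D(2) E(2))
  qed
qed

lemmas cdiff_mult [cdiff_intros] = cdiff_bilinear[OF bounded_bilinear_mult]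
lemmas cdiff_scaleR [cdiff_intros] = cdiff_bilinear[OF bounded_bilinear_scaleR]
lemmas cdiff_inner [cdiff_intros] = cdiff_bilinear[OF bounded_bilinear_inner]

lemma cdiff_real_Suc:
  fixes f :: "real \<Rightarrow> 'b::real_normed_vector"
  assumes "\<And>x. x \<in> S \<Longrightarrow> (f has_vector_derivative f' x) (at x within S)" "cdiff k S f'"
  shows "cdiff (Suc k) S f"
proof (rule cdiffI[where D="\<lambda>x v. v *\<^sub>R f' x"])
  show "(f has_derivative (\<lambda>v. v *\<^sub>R f' x)) (at x within S)" if "x \<in> S" for x
    using assms(1)[OF that] by (simp add: has_vector_derivative_def)
  show "cdiff k S (\<lambda>x. v *\<^sub>R f' x)" for v
    by (rule cdiff_bounded_linear_comp[OF bounded_linear_scaleR_right assms(2)])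
qed

lemma cdiff_real_SucD:
  fixes f :: "real \<Rightarrow> 'b::real_normed_vector"
  assumes "cdiff (Suc k) S f"
  obtains f' where "\<And>x. x \<in> S \<Longrightarrow> (f has_vector_derivative f' x) (at x within S)" "cdiff k S f'"
proof -
  obtain D where D: "\<And>x. x\<in>S \<Longrightarrow> (f has_derivative D x) (at x within S)"
    "\<And>v. cdiff k S (\<lambda>x. D x v)" by (rule cdiff_SucE[OF assms], rule that) blast+
  have "D x = (\<lambda>v. v *\<^sub>R D x 1)" if "x \<in> S" for x
  proof
    fix v
    show "D x v = v *\<^sub>R D x 1"
      using linear_cmul[OF has_derivative_linear[OF D(1)[OF that]], of v 1] by (simp only: real_scaleR_def mult_1_right)
  qed
  then show ?thesis using D by (intro that[of "\<lambda>x. D x 1"]) (auto simp: has_vector_derivative_def)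
qed

text \<open>  The derivative of the outer map is applied to a direction that moves with the point; expanding this
  direction in a basis reduces the claim to finitely many fixed directions, for which the induction
  hypothesis is available. This is why the middle space is Euclidean.\<close>

lemma cdiff_compose:
  fixes f :: "'b::euclidean_space \<Rightarrow> 'c::real_normed_vector"
  assumes "cdiff k T f" "cdiff k S g" "g ` S \<subseteq> T"
  shows "cdiff k S (\<lambda>x. f (g x))"
  using assms
proof (induction k arbitrary: f)
  case 0
  then show ?case by (auto intro: continuous_on_compose2)
next
  case (Suc k)
  obtain D where D: "\<And>x. x \<in> T \<Longrightarrow> (f has_derivative D x) (at x within T)"
    "\<And>v. cdiff k T (\<lambda>x. D x v)" by (rule cdiff_SucE[OF Suc.prems(1)], rule that) blast+
  obtain E where E: "\<And>x. x \<in> S \<Longrightarrow> (g has_derivative E x) (at x within S)"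
    "\<And>v. cdiff k S (\<lambda>x. E x v)" by (rule cdiff_SucE[OF Suc.prems(2)], rule that) blast+
  have g: "cdiff k S g" using Suc.prems cdiff_SucD by blast
  have lin: "D (g x) (E x v) = (\<Sum>b\<in>Basis. (E x v \<bullet> b) *\<^sub>R D (g x) b)" if "x \<in> S" for x v
  proof -
    have l: "linear (D (g x))"
      using D(1)[of "g x"] Suc.prems(3) that by (auto intro: has_derivative_linear)
    have "D (g x) (E x v) = D (g x) (\<Sum>b\<in>Basis. (E x v \<bullet> b) *\<^sub>R b)" by (simp add: euclidean_representation)
    then show ?thesis by (simp add: linear_sum[OF l] linear_cmul[OF l])
  qed
  show ?case
  proof (rule cdiffI[where D="\<lambda>x v. D (g x) (E x v)"])
    fix x assume "x \<in> S"
    then show "((\<lambda>x. f (g x)) has_derivative (\<lambda>v. D (g x) (E x v))) (at x within S)"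
      using has_derivative_in_compose2[of T f D g S x "E x"] D(1) E(1) Suc.prems(3) by auto
  next
    fix v
    have "cdiff k S (\<lambda>x. \<Sum>b\<in>Basis. (E x v \<bullet> b) *\<^sub>R D (g x) b)"
      by (intro cdiff_sum cdiff_scaleR cdiff_inner E(2) cdiff_const Suc.IH g D(2) Suc.prems(3))
    then show "cdiff k S (\<lambda>x. D (g x) (E x v))"
      by (subst cdiff_cong[where g="\<lambda>x. \<Sum>b\<in>Basis. (E x v \<bullet> b) *\<^sub>R D (g x) b"]) (auto simp: lin)
  qed
qed

lemma cdiff_real_inverse: "cdiff k (- {0::real}) inverse"
proof (induction k)
  case 0
  then show ?case by (auto intro: continuous_intros)
next
  case (Suc k)
  show ?case
  proof (rule cdiff_real_Suc)
    show "(inverse has_vector_derivative - (inverse x * inverse x)) (at x within - {0})" if "x \<in> - {0}" for x::real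
      using that by (auto intro!: derivative_eq_intros has_vector_derivative_at_within
        simp: has_real_derivative_iff_has_vector_derivative[symmetric] power2_eq_square)
    show "cdiff k (- {0}) (\<lambda>x::real. - (inverse x * inverse x))" by (intro cdiff_intros Suc)
  qed
qed

lemma cdiff_inverse:
  fixes f :: "'a::real_normed_vector \<Rightarrow> real"
  assumes "cdiff k S f" "\<And>x. x \<in> S \<Longrightarrow> f x \<noteq> 0" shows "cdiff k S (\<lambda>x. inverse (f x))"
  by (rule cdiff_compose[OF cdiff_real_inverse assms(1)]) (use assms(2) in auto)

lemma cdiff_divide:
  fixes f :: "'a::real_normed_vector \<Rightarrow> real"
  assumes "cdiff k S f" "cdiff k S g" "\<And>x. x \<in> S \<Longrightarrow> g x \<noteq> 0" shows "cdiff k S (\<lambda>x. f x / g x)"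
  unfolding divide_inverse by (intro cdiff_mult cdiff_inverse assms)

lemma cdiff_real_sqrt: "cdiff k {0::real<..} sqrt"
proof (induction k)
  case 0
  then show ?case by (auto intro: continuous_intros)
next
  case (Suc k)
  show ?case
  proof (rule cdiff_real_Suc)
    show "(sqrt has_vector_derivative (inverse (sqrt x) / 2)) (at x within {0<..})" if "x \<in> {0<..}" for x::real
      using that by (auto intro!: derivative_eq_intros has_vector_derivative_at_within
        simp: has_real_derivative_iff_has_vector_derivative[symmetric])
    show "cdiff k {0<..} (\<lambda>x::real. inverse (sqrt x) / 2)"
      by (intro cdiff_divide cdiff_inverse Suc cdiff_const) auto
  qed
qed

lemma cdiff_sqrt:
  fixes f :: "'a::real_normed_vector \<Rightarrow> real"
  assumes "cdiff k S f" "\<And>x. x \<in> S \<Longrightarrow> 0 < f x" shows "cdiff k S (\<lambda>x. sqrt (f x))"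
  by (rule cdiff_compose[OF cdiff_real_sqrt assms(1)]) (use assms(2) in auto)

lemma cdiff_norm:
  fixes f :: "'a::real_normed_vector \<Rightarrow> 'b::real_inner"
  assumes "cdiff k S f" "\<And>x. x \<in> S \<Longrightarrow> f x \<noteq> 0" shows "cdiff k S (\<lambda>x. norm (f x))"
  unfolding norm_eq_sqrt_inner by (intro cdiff_sqrt cdiff_inner assms) (use assms(2) in auto)

lemma cdiff_real_sin_cos: "cdiff k (UNIV::real set) sin \<and> cdiff k (UNIV::real set) cos"
proof (induction k)
  case 0
  then show ?case by (auto intro: continuous_intros)
next
  case (Suc k)
  have "cdiff (Suc k) (UNIV::real set) sin"
    by (rule cdiff_real_Suc[OF _ conjunct2[OF Suc]])
      (simp add: has_real_derivative_iff_has_vector_derivative[symmetric])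
  moreover have "cdiff (Suc k) (UNIV::real set) cos"
    by (rule cdiff_real_Suc[OF _ cdiff_minus[OF conjunct1[OF Suc]]])
      (simp add: has_real_derivative_iff_has_vector_derivative[symmetric])
  ultimately show ?case by blast
qed

lemma cdiff_sin: "cdiff k S f \<Longrightarrow> cdiff k S (\<lambda>x. sin (f x :: real))"
  by (rule cdiff_compose[OF conjunct1[OF cdiff_real_sin_cos]]) simp_all

lemma cdiff_cos: "cdiff k S f \<Longrightarrow> cdiff k S (\<lambda>x. cos (f x :: real))"
  by (rule cdiff_compose[OF conjunct2[OF cdiff_real_sin_cos]]) simp_all

text \<open>  On open sets the derivative is unique, so it can be named.\<close>

lemma cdiff_frechet:
  assumes "cdiff (Suc k) S f" "open S"
  shows "x \<in> S \<Longrightarrow> (f has_derivative frechet_derivative f (at x)) (at x)"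
    and "cdiff k S (\<lambda>x. frechet_derivative f (at x) v)"
proof -
  obtain D where D: "\<And>x. x\<in>S \<Longrightarrow> (f has_derivative D x) (at x within S)"
    "\<And>v. cdiff k S (\<lambda>x. D x v)" by (rule cdiff_SucE[OF assms(1)], rule that) blast+
  have D': "(f has_derivative D x) (at x)" if "x \<in> S" for x
    using D(1)[OF that] unfolding at_within_open[OF that assms(2)] .
  have eq: "frechet_derivative f (at x) = D x" if "x \<in> S" for x
    by (rule frechet_derivative_at[OF D'[OF that], symmetric])
  show "(f has_derivative frechet_derivative f (at x)) (at x)" if "x \<in> S"
    unfolding eq[OF that] by (rule D'[OF that])
  show "cdiff k S (\<lambda>x. frechet_derivative f (at x) v)"
    by (rule iffD2[OF cdiff_cong D(2)]) (simp add: eq)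
qed

lemma cdiff_vec_nth [cdiff_intros]:
  fixes f :: "'a::real_normed_vector \<Rightarrow> 'b::real_normed_vector ^ 'n"
  shows "cdiff k S f \<Longrightarrow> cdiff k S (\<lambda>x. f x $ i)"
  by (rule cdiff_bounded_linear_comp[OF bounded_linear_vec_nth])

lemma cdiff_vec_lambda:
  fixes f :: "'a::real_normed_vector \<Rightarrow> 'n::finite \<Rightarrow> 'b::euclidean_space"
  assumes "\<And>i. cdiff k S (\<lambda>x. f x i)" shows "cdiff k S (\<lambda>x. \<chi> i. f x i)"
proof -
  have lin: "bounded_linear (\<lambda>y::'b. axis i y :: 'b ^ 'n)" for i
    by (auto simp: linear_conv_bounded_linear[symmetric] linear_iff axis_def vec_eq_iff)
  have "cdiff k S (\<lambda>x. \<Sum>i\<in>UNIV. axis i (f x i) :: 'b ^ 'n)"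
    by (intro cdiff_sum cdiff_bounded_linear_comp[OF lin] assms)
  moreover have "(\<Sum>i\<in>UNIV. axis i (f x i)) = (\<chi> i. f x i)" for x
    by (simp add: vec_eq_iff axis_def)
  ultimately show ?thesis by simp
qed

section \<open>The two domains of curves\<close>

locale curve_dom =
  fixes \<Gamma> :: curve_domain and a b :: real
  assumes ab: "a < b" and dom: "\<Gamma> = Interval a b \<or> \<Gamma> = Circle a b"
begin

text \<open>  Moves a point of the domain into the compact interval \<open>[a, b]\<close>, by a period if the domain is a circle.
  Through it, statements about all points follow from statements on \<open>[a, b]\<close>.\<close>

definition reduce :: "real \<Rightarrow> real" where
  "reduce x = (if \<Gamma> = Interval a b then x else x - (b - a) * of_int \<lfloor>(x - a) / (b - a)\<rfloor>)"

lemma Icc_subset: "{a..b} \<subseteq> points \<Gamma>"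
  using dom by auto

lemma convex_points: "convex (points \<Gamma>)"
  using dom by auto

lemma periodic_int:
  assumes "\<And>x. f (x + (b - a)) = f x"
  shows "f (x + (b - a) * of_int n) = f x"
proof -
  have *: "f (x + (b - a) * real m) = f x" for m x
  proof (induction m)
    case (Suc m)
    have "x + (b - a) * real (Suc m) = (x + (b - a) * real m) + (b - a)" by (simp add: algebra_simps)
    then show ?case using assms Suc by (simp only:)
  qed simp
  show ?thesis
  proof (cases "n \<ge> 0")
    case True
    then show ?thesis using *[of x "nat n"] by simp
  next
    case False
    then show ?thesis using *[of "x + (b - a) * of_int n" "nat (- n)"] by (simp add: algebra_simps)
  qed
qed

lemma reduce_in: assumes "x \<in> points \<Gamma>" shows "reduce x \<in> {a..b}"
proof (cases "\<Gamma> = Interval a b")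
  case False
  let ?y = "(x - a) / (b - a)"
  have "of_int \<lfloor>?y\<rfloor> \<le> ?y" "?y \<le> of_int \<lfloor>?y\<rfloor> + 1" by linarith+
  then have "(b - a) * of_int \<lfloor>?y\<rfloor> \<le> (b - a) * ?y" "(b - a) * ?y \<le> (b - a) * (of_int \<lfloor>?y\<rfloor> + 1)"
    using ab by (intro mult_left_mono; simp)+
  moreover have "(b - a) * ?y = x - a" using ab by simp
  ultimately have "(b - a) * of_int \<lfloor>?y\<rfloor> \<le> x - a" "x - a \<le> (b - a) * (of_int \<lfloor>?y\<rfloor> + 1)" by simp_all
  with False show ?thesis by (auto simp: reduce_def algebra_simps)
next
  case True
  then have "reduce x = x" unfolding reduce_def by (rule if_P)
  then show ?thesis using assms True by simp
qed

lemma reduce_eq: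
  assumes "map_on \<Gamma> f" shows "f (reduce x) = f x"
proof (cases "\<Gamma> = Interval a b")
  case False
  then have "\<And>x. f (x + (b - a)) = f x" using assms dom by auto
  from periodic_int[of f, OF this, of x "- \<lfloor>(x - a) / (b - a)\<rfloor>"] False show ?thesis
    by (simp add: reduce_def)
next
  case True
  then have "reduce x = x" unfolding reduce_def by (rule if_P)
  then show ?thesis by simp
qed

lemma ball_points:
  assumes "map_on \<Gamma> f" "\<And>x. x \<in> {a..b} \<Longrightarrow> P (f x)" "x \<in> points \<Gamma>" shows "P (f x)"
  using assms(2)[OF reduce_in[OF assms(3)]] reduce_eq[OF assms(1)] by simp

lemma map_on_comp: "map_on \<Gamma> f \<Longrightarrow> map_on \<Gamma> (\<lambda>x. h (f x))"
  using dom by auto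
lemma map_on_comp2: "map_on \<Gamma> f \<Longrightarrow> map_on \<Gamma> g \<Longrightarrow> map_on \<Gamma> (\<lambda>x. h (f x) (g x))"
  using dom by auto

lemma at_within_points: "x \<in> points \<Gamma> \<Longrightarrow> at x within points \<Gamma> \<noteq> bot"
  using dom ab by (auto simp: trivial_limit_within)

lemma vderiv_eq:
  "x \<in> points \<Gamma> \<Longrightarrow> (f has_vector_derivative d) (at x within points \<Gamma>) \<Longrightarrow> vderiv \<Gamma> f x = d"
  unfolding vderiv_def by (rule vector_derivative_within[OF at_within_points])

lemma vderiv_works:
  "x \<in> points \<Gamma> \<Longrightarrow> f differentiable (at x within points \<Gamma>) \<Longrightarrow>
   (f has_vector_derivative vderiv \<Gamma> f x) (at x within points \<Gamma>)"
  unfolding vderiv_def by (simp add: vector_derivative_works)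

lemma map_on_vderiv:
  fixes f :: "real \<Rightarrow> 'v::real_normed_vector"
  assumes "map_on \<Gamma> f" shows "map_on \<Gamma> (vderiv \<Gamma> f)"
proof (cases "\<Gamma> = Interval a b")
  case False
  then have G: "\<Gamma> = Circle a b" using dom by auto
  then have per: "\<And>x. f (x + (b - a)) = f x" using assms by auto
  have iff: "(f has_vector_derivative D) (at (x + (b - a))) \<longleftrightarrow> (f has_vector_derivative D) (at x)" for x D
  proof -
    have *: "((\<lambda>y. f (y + h)) has_vector_derivative D) (at x)"
      if "(f has_vector_derivative D) (at (x + h))" for h x
    proof -
      have "((\<lambda>y. y + h) has_vector_derivative 1) (at x)" by (auto intro!: derivative_eq_intros)
      from vector_diff_chain_at[OF this that] show ?thesis by (simp add: o_def)
    qed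
    have per': "f (x - (b - a)) = f x" for x using per[of "x - (b - a)"] by simp
    show ?thesis
    proof
      assume "(f has_vector_derivative D) (at (x + (b - a)))"
      from *[OF this] show "(f has_vector_derivative D) (at x)" by (simp only: per)
    next
      assume "(f has_vector_derivative D) (at x)"
      then have "((\<lambda>y. f (y + - (b - a))) has_vector_derivative D) (at (x + (b - a)))" by (intro *) simp
      then show "(f has_vector_derivative D) (at (x + (b - a)))"
        using per' by (simp only: diff_conv_add_uminus[symmetric])
    qed
  qed
  show ?thesis by (simp only: G map_on.simps vderiv_def vector_derivative_def points.simps iff) simp
qed (use dom in auto)

lemma map_on_nth_vderiv:
  fixes f :: "real \<Rightarrow> 'v::real_normed_vector"
  assumes "map_on \<Gamma> f" shows "map_on \<Gamma> (nth_vderiv \<Gamma> j f)"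
  unfolding nth_vderiv_def by (induction j) (use assms map_on_vderiv in auto)

lemma nth_vderiv_0 [simp]: "nth_vderiv \<Gamma> 0 f = f"
  by (simp add: nth_vderiv_def)

lemma nth_vderiv_Suc: "nth_vderiv \<Gamma> (Suc j) f = nth_vderiv \<Gamma> j (vderiv \<Gamma> f)"
  unfolding nth_vderiv_def by (simp add: funpow_swap1)

lemma nth_vderiv_cong:
  "(\<And>x. x \<in> points \<Gamma> \<Longrightarrow> f x = g x) \<Longrightarrow> x \<in> points \<Gamma> \<Longrightarrow> nth_vderiv \<Gamma> j f x = nth_vderiv \<Gamma> j g x"
proof (induction j arbitrary: f g x)
  case (Suc j)
  have "vderiv \<Gamma> f x = vderiv \<Gamma> g x" if "x \<in> points \<Gamma>" for x
  proof -
    have "(f has_vector_derivative D) (at x within points \<Gamma>) \<longleftrightarrow>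
        (g has_vector_derivative D) (at x within points \<Gamma>)" for D
      using has_vector_derivative_transform[OF that, of f g] has_vector_derivative_transform[OF that, of g f]
        Suc.prems(1) by metis
    then show ?thesis by (simp add: vderiv_def vector_derivative_def)
  qed
  then show ?case unfolding nth_vderiv_Suc using Suc.IH Suc.prems(2) by blast
qed auto

lemma cdiff_vderiv:
  assumes "cdiff (Suc k) (points \<Gamma>) f"
  shows "x \<in> points \<Gamma> \<Longrightarrow> (f has_vector_derivative vderiv \<Gamma> f x) (at x within points \<Gamma>)"
    and "cdiff k (points \<Gamma>) (vderiv \<Gamma> f)"
proof -
  obtain f' where f': "\<And>x. x \<in> points \<Gamma> \<Longrightarrow> (f has_vector_derivative f' x) (at x within points \<Gamma>)"
    "cdiff k (points \<Gamma>) f'" using cdiff_real_SucD[OF assms] by blast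
  have eq: "vderiv \<Gamma> f x = f' x" if "x \<in> points \<Gamma>" for x
    using vderiv_eq[OF that f'(1)[OF that]] .
  show "(f has_vector_derivative vderiv \<Gamma> f x) (at x within points \<Gamma>)" if "x \<in> points \<Gamma>"
    unfolding eq[OF that] by (rule f'(1)[OF that])
  show "cdiff k (points \<Gamma>) (vderiv \<Gamma> f)"
    by (rule iffD2[OF cdiff_cong f'(2)]) (rule eq)
qed

lemma Ck_iff_cdiff: "f \<in> Ck \<Gamma> k \<longleftrightarrow> map_on \<Gamma> f \<and> cdiff k (points \<Gamma>) f"
proof -
  have "(\<forall>j<k. \<forall>x\<in>points \<Gamma>. nth_vderiv \<Gamma> j f differentiable (at x within points \<Gamma>))
     \<and> continuous_on (points \<Gamma>) (nth_vderiv \<Gamma> k f) \<longleftrightarrow> cdiff k (points \<Gamma>) f"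
  proof (induction k arbitrary: f)
    case (Suc k)
    have "cdiff (Suc k) (points \<Gamma>) f \<longleftrightarrow>
      (\<forall>x\<in>points \<Gamma>. f differentiable (at x within points \<Gamma>)) \<and> cdiff k (points \<Gamma>) (vderiv \<Gamma> f)"
    proof
      assume "cdiff (Suc k) (points \<Gamma>) f"
      from cdiff_vderiv[OF this] show "(\<forall>x\<in>points \<Gamma>. f differentiable (at x within points \<Gamma>)) \<and>
        cdiff k (points \<Gamma>) (vderiv \<Gamma> f)" by (auto intro: differentiableI_vector)
    next
      assume "(\<forall>x\<in>points \<Gamma>. f differentiable (at x within points \<Gamma>)) \<and> cdiff k (points \<Gamma>) (vderiv \<Gamma> f)"
      then show "cdiff (Suc k) (points \<Gamma>) f"
        by (intro cdiff_real_Suc[where f'="vderiv \<Gamma> f"]) (auto intro: vderiv_works)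
    qed
    then show ?case unfolding Suc.IH[symmetric] by (simp add: nth_vderiv_Suc[symmetric] All_less_Suc2)
  qed simp
  then show ?thesis by (simp add: Ck_def)
qed

lemma vderiv_diff:
  assumes "cdiff 1 (points \<Gamma>) f" "cdiff 1 (points \<Gamma>) g" "x \<in> points \<Gamma>"
  shows "vderiv \<Gamma> (\<lambda>x. f x - g x) x = vderiv \<Gamma> f x - vderiv \<Gamma> g x"
  using assms cdiff_vderiv(1)[of 0] by (intro vderiv_eq has_vector_derivative_diff) auto

lemma nth_vderiv_diff:
  "cdiff j (points \<Gamma>) f \<Longrightarrow> cdiff j (points \<Gamma>) g \<Longrightarrow> x \<in> points \<Gamma> \<Longrightarrow>
    nth_vderiv \<Gamma> j (\<lambda>x. f x - g x) x = nth_vderiv \<Gamma> j f x - nth_vderiv \<Gamma> j g x"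
proof (induction j arbitrary: f g x)
  case (Suc j)
  have "nth_vderiv \<Gamma> j (vderiv \<Gamma> (\<lambda>x. f x - g x)) x = nth_vderiv \<Gamma> j (\<lambda>x. vderiv \<Gamma> f x - vderiv \<Gamma> g x) x"
    by (rule nth_vderiv_cong) (use Suc.prems in \<open>auto intro!: vderiv_diff dest: cdiff_mono[of _ _ _ 1] simp del: cdiff.simps\<close>)
  also have "\<dots> = nth_vderiv \<Gamma> j (vderiv \<Gamma> f) x - nth_vderiv \<Gamma> j (vderiv \<Gamma> g) x"
    by (rule Suc.IH) (use Suc.prems cdiff_vderiv(2) in blast)+
  finally show ?case by (simp only: nth_vderiv_Suc)
qed auto

lemma bounded_on_points:
  fixes f :: "real \<Rightarrow> 'v::real_normed_vector"
  assumes "map_on \<Gamma> f" "continuous_on (points \<Gamma>) f"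
  shows "bdd_above ((\<lambda>x. norm (f x)) ` points \<Gamma>)"
proof -
  have "compact ((\<lambda>x. norm (f x)) ` {a..b})"
    by (intro compact_continuous_image continuous_intros continuous_on_subset[OF assms(2) Icc_subset] compact_Icc)
  then have "bdd_above ((\<lambda>x. norm (f x)) ` {a..b})" by (intro bounded_imp_bdd_above compact_imp_bounded)
  then obtain B where "\<forall>x \<in> {a..b}. norm (f x) \<le> B" unfolding bdd_above_def by blast
  then have "\<And>x. x \<in> points \<Gamma> \<Longrightarrow> norm (f x) \<le> B"
    using ball_points[OF assms(1), of "\<lambda>v. norm v \<le> B"] by blast
  then show ?thesis unfolding bdd_above_def by blast
qed

lemma Ck_norm_ge:
  assumes "map_on \<Gamma> f" "cdiff k (points \<Gamma>) f" "j \<le> k" "x \<in> points \<Gamma>"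
  shows "norm (nth_vderiv \<Gamma> j f x) \<le> Ck_norm \<Gamma> k f"
proof -
  have bdd: "bdd_above ((\<lambda>x. norm (nth_vderiv \<Gamma> j f x)) ` points \<Gamma>)" if "j \<le> k" for j
  proof (rule bounded_on_points[OF map_on_nth_vderiv[OF assms(1)]])
    have "f \<in> Ck \<Gamma> j" using assms that by (simp add: Ck_iff_cdiff cdiff_mono)
    then show "continuous_on (points \<Gamma>) (nth_vderiv \<Gamma> j f)" by (simp add: Ck_def)
  qed
  have "norm (nth_vderiv \<Gamma> j f x) \<le> (SUP x\<in>points \<Gamma>. norm (nth_vderiv \<Gamma> j f x))"
    by (rule cSUP_upper[OF assms(4) bdd[OF assms(3)]])
  also have "\<dots> \<le> Ck_norm \<Gamma> k f"
    unfolding Ck_norm_def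
  proof (rule member_le_sum)
    fix i assume "i \<in> {..k} - {j}"
    then show "0 \<le> (SUP x\<in>points \<Gamma>. norm (nth_vderiv \<Gamma> i f x))"
      using cSUP_upper2[OF bdd[of i] assms(4), of 0] by auto
  qed (use assms(3) in auto)
  finally show ?thesis .
qed

lemma Ck_norm_le:
  assumes "\<And>j x. j \<le> k \<Longrightarrow> x \<in> points \<Gamma> \<Longrightarrow> norm (nth_vderiv \<Gamma> j f x) \<le> e"
  shows "Ck_norm \<Gamma> k f \<le> (real k + 1) * e"
proof -
  have "points \<Gamma> \<noteq> {}" using Icc_subset ab by auto
  then have "Ck_norm \<Gamma> k f \<le> (\<Sum>j\<le>k. e)"
    unfolding Ck_norm_def by (intro sum_mono cSUP_least) (use assms in auto)
  then show ?thesis by (simp add: algebra_simps)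
qed

text \<open>  Together with \<open>homotopy_from_jointly_continuous\<close>: homotopies for the \<open>C\<^sup>l\<close>-norm are the families all of whose
  derivatives up to order \<open>l\<close> are jointly continuous in time and space, the form in which they are used below.\<close>

lemma homotopy_jointly_continuous:
  fixes f :: "real \<Rightarrow> real \<Rightarrow> 'v::real_normed_vector"
  assumes "curve_homotopy \<Gamma> k l f" "j \<le> l"
  shows "continuous_on ({0..1} \<times> points \<Gamma>) (\<lambda>(t, x). nth_vderiv \<Gamma> j (f t) x)"
proof -
  have f: "map_on \<Gamma> (f t)" "cdiff l (points \<Gamma>) (f t)" if "t \<in> {0..1}" for t :: real
    using assms that by (auto simp: curve_homotopy_def Imm_def Ck_iff_cdiff intro: cdiff_mono)
  show ?thesis
    unfolding continuous_on_iff
  proof (intro ballI allI impI)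
    fix z :: "real \<times> real" and e :: real assume z: "z \<in> {0..1} \<times> points \<Gamma>" and e: "0 < e"
    obtain t x :: real where tx: "z = (t, x)" by (cases z)
    have t: "0 \<le> t" "t \<le> 1" and x: "x \<in> points \<Gamma>" using z tx by auto
    have "((\<lambda>s. Ck_norm \<Gamma> l (\<lambda>x. f s x - f t x)) \<longlongrightarrow> 0) (at t within {0..1})"
      using assms t by (auto simp: curve_homotopy_def)
    from tendstoD[OF this, of "e/2"] e obtain d where d: "d > 0"
      "\<And>s. s \<in> {0..1} \<Longrightarrow> s \<noteq> t \<Longrightarrow> dist s t < d \<Longrightarrow> \<bar>Ck_norm \<Gamma> l (\<lambda>x. f s x - f t x)\<bar> < e/2"
      by (auto simp: eventually_at)
    have near: "dist (nth_vderiv \<Gamma> j (f s) y) (nth_vderiv \<Gamma> j (f t) y) < e/2"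
      if "s \<in> {0..1}" "dist s t < d" "y \<in> points \<Gamma>" for s y
    proof (cases "s = t")
      case False
      have "norm (nth_vderiv \<Gamma> j (\<lambda>x. f s x - f t x) y) \<le> Ck_norm \<Gamma> l (\<lambda>x. f s x - f t x)"
        by (rule Ck_norm_ge) (use f that t assms(2) in \<open>auto intro: cdiff_diff map_on_comp2\<close>)
      also have "\<dots> < e/2" using d(2)[OF that(1) False that(2)] by simp
      also have "nth_vderiv \<Gamma> j (\<lambda>x. f s x - f t x) y = nth_vderiv \<Gamma> j (f s) y - nth_vderiv \<Gamma> j (f t) y"
        by (rule nth_vderiv_diff) (use f that t assms(2) in \<open>auto intro: cdiff_mono\<close>)
      finally show ?thesis by (simp add: dist_norm)
    qed (use e in auto)
    have "f t \<in> Ck \<Gamma> j" using f[of t] t assms(2) by (auto simp: Ck_iff_cdiff intro: cdiff_mono)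
    then have "continuous_on (points \<Gamma>) (nth_vderiv \<Gamma> j (f t))" by (simp add: Ck_def)
    then obtain d' where d': "d' > 0"
      "\<And>y. y \<in> points \<Gamma> \<Longrightarrow> dist y x < d' \<Longrightarrow> dist (nth_vderiv \<Gamma> j (f t) y) (nth_vderiv \<Gamma> j (f t) x) < e/2"
      using x e unfolding continuous_on_iff by (meson half_gt_zero)
    have "\<exists>d>0. \<forall>s y. 0 \<le> s \<and> s \<le> 1 \<and> y \<in> points \<Gamma> \<longrightarrow> dist (s, y) (t, x) < d \<longrightarrow>
            dist (nth_vderiv \<Gamma> j (f s) y) (nth_vderiv \<Gamma> j (f t) x) < e"
    proof (intro exI[of _ "min d d'"] conjI allI impI)
      fix s y assume s: "0 \<le> s \<and> s \<le> 1 \<and> y \<in> points \<Gamma>" and ds: "dist (s, y) (t, x) < min d d'"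
      have "dist s t < d" "dist y x < d'" using ds dist_fst_le[of "(s,y)" "(t,x)"] dist_snd_le[of "(s,y)" "(t,x)"] by auto
      then have "dist (nth_vderiv \<Gamma> j (f s) y) (nth_vderiv \<Gamma> j (f t) y) < e/2"
        "dist (nth_vderiv \<Gamma> j (f t) y) (nth_vderiv \<Gamma> j (f t) x) < e/2"
        using near[of s y] d'(2)[of y] s by simp_all
      then show "dist (nth_vderiv \<Gamma> j (f s) y) (nth_vderiv \<Gamma> j (f t) x) < e"
        using dist_triangle[of "nth_vderiv \<Gamma> j (f s) y" "nth_vderiv \<Gamma> j (f t) x" "nth_vderiv \<Gamma> j (f t) y"] by linarith
    qed (use d(1) d'(1) in auto)
    then show "\<exists>d>0. \<forall>z'\<in>{0..1} \<times> points \<Gamma>. dist z' z < d \<longrightarrow>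
        dist (case z' of (t, x) \<Rightarrow> nth_vderiv \<Gamma> j (f t) x) (case z of (t, x) \<Rightarrow> nth_vderiv \<Gamma> j (f t) x) < e"
      unfolding tx by auto
  qed
qed

lemma uniform_in_space:
  assumes "continuous_on ({0..1} \<times> {a..b}) (\<lambda>(t, x). F t x)" "t \<in> {0..1::real}" "e > 0"
    and "\<And>t. t \<in> {0..1} \<Longrightarrow> map_on \<Gamma> (F t)"
  shows "eventually (\<lambda>s. \<forall>x\<in>points \<Gamma>. dist (F s x) (F t x) \<le> e) (at t within {0..1})"
proof -
  obtain X where X: "t \<in> X" "open X" "\<forall>s\<in>X \<inter> {0..1}. \<forall>x\<in>{a..b}. dist (F s x) (F t x) \<le> e"
    using continuous_on_prod_compactE[OF assms(1) compact_Icc assms(2,3)] by auto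
  have "eventually (\<lambda>s. s \<in> X \<and> s \<in> {0..1}) (at t within {0..1})"
    using X(1,2) by (auto simp: eventually_at_topological)
  then show ?thesis
  proof eventually_elim
    case (elim s)
    then have *: "map_on \<Gamma> (\<lambda>x. dist (F s x) (F t x))" using assms(2,4) by (auto intro: map_on_comp2)
    show ?case using ball_points[OF *, of "\<lambda>d. d \<le> e"] X(3) elim by auto
  qed
qed

lemma homotopy_from_jointly_continuous:
  assumes g: "\<And>t. t \<in> {0..1} \<Longrightarrow> g t \<in> Imm \<Gamma> k" and "l \<le> k"
    and cont: "\<And>j. j \<le> l \<Longrightarrow> continuous_on ({0..1} \<times> {a..b}) (\<lambda>(t, x). nth_vderiv \<Gamma> j (g t) x)"
  shows "curve_homotopy \<Gamma> k l g"
  unfolding curve_homotopy_def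
proof (intro conjI ballI assms)
  fix t :: real assume t: "t \<in> {0..1}"
  have gt: "map_on \<Gamma> (g t)" "cdiff l (points \<Gamma>) (g t)" if "t \<in> {0..1}" for t :: real
    using g[OF that] assms(2) by (auto simp: Imm_def Ck_iff_cdiff intro: cdiff_mono)
  show "((\<lambda>s. Ck_norm \<Gamma> l (\<lambda>x. g s x - g t x)) \<longlongrightarrow> 0) (at t within {0..1})"
  proof (rule tendstoI)
    fix e :: real assume e: "e > 0"
    define e' where "e' = e / (2 * (real l + 1))"
    have "e' > 0" using e by (simp add: e'_def)
    moreover have "(real l + 1) * e' = e / 2" by (simp add: e'_def field_simps)
    ultimately have e': "e' > 0" "(real l + 1) * e' < e" using e by simp_all
    have "eventually (\<lambda>s. \<forall>j\<in>{..l}. \<forall>x\<in>points \<Gamma>. dist (nth_vderiv \<Gamma> j (g s) x) (nth_vderiv \<Gamma> j (g t) x) \<le> e')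
        (at t within {0..1})"
      by (intro eventually_ball_finite finite_atMost ballI uniform_in_space[OF cont t e'(1)] map_on_nth_vderiv)
        (use gt in auto)
    moreover have "eventually (\<lambda>s. s \<in> {0..1}) (at t within {0..1})" by (simp add: eventually_at_filter)
    ultimately show "eventually (\<lambda>s. dist (Ck_norm \<Gamma> l (\<lambda>x. g s x - g t x)) 0 < e) (at t within {0..1})"
    proof eventually_elim
      case (elim s)
      have "norm (nth_vderiv \<Gamma> j (\<lambda>x. g s x - g t x) x) \<le> e'" if "j \<le> l" "x \<in> points \<Gamma>" for j x
        using nth_vderiv_diff[of j "g s" "g t" x] gt[of s] gt[of t] t elim that
        by (auto simp: dist_norm cdiff_mono)
      then have "Ck_norm \<Gamma> l (\<lambda>x. g s x - g t x) \<le> (real l + 1) * e'" by (rule Ck_norm_le)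
      moreover have "0 \<le> Ck_norm \<Gamma> l (\<lambda>x. g s x - g t x)"
      proof -
        have "a \<in> points \<Gamma>" using Icc_subset ab by auto
        then have "norm (nth_vderiv \<Gamma> 0 (\<lambda>x. g s x - g t x) a) \<le> Ck_norm \<Gamma> l (\<lambda>x. g s x - g t x)"
          by (intro Ck_norm_ge) (use gt t elim in \<open>auto intro: cdiff_diff map_on_comp2\<close>)
        then show ?thesis using norm_ge_zero order_trans by blast
      qed
      ultimately show ?case using e'(2) by simp
    qed
  qed
qed

text \<open>  Near \<open>x\<close> the component of the curve along its velocity at \<open>x\<close> is strictly increasing.\<close>

lemma immersion_locally_injective:
  fixes f :: "real \<Rightarrow> 'v::real_inner"
  assumes "cdiff 1 (points \<Gamma>) f" "\<And>x. x \<in> points \<Gamma> \<Longrightarrow> vderiv \<Gamma> f x \<noteq> 0"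
  shows "locally_injective \<Gamma> f"
  unfolding locally_injective_def
proof
  fix x assume x: "x \<in> points \<Gamma>"
  let ?v = "vderiv \<Gamma> f x"
  have cont: "continuous_on (points \<Gamma>) (\<lambda>y. vderiv \<Gamma> f y \<bullet> ?v)"
    using cdiff_vderiv(2)[of 0 f] assms(1) by (auto intro!: continuous_intros)
  have "?v \<bullet> ?v > 0" using assms(2)[OF x] by simp
  then obtain d where d: "d > 0" "\<And>y. y \<in> points \<Gamma> \<Longrightarrow> dist y x < d \<Longrightarrow> vderiv \<Gamma> f y \<bullet> ?v > 0"
  proof -
    have "\<exists>d>0. \<forall>y\<in>points \<Gamma>. dist y x < d \<longrightarrow> dist (vderiv \<Gamma> f y \<bullet> ?v) (?v \<bullet> ?v) < ?v \<bullet> ?v"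
      using cont x \<open>?v \<bullet> ?v > 0\<close> unfolding continuous_on_iff by blast
    then obtain d where d: "d > 0"
      "\<And>y. y \<in> points \<Gamma> \<Longrightarrow> dist y x < d \<Longrightarrow> \<bar>vderiv \<Gamma> f y \<bullet> ?v - ?v \<bullet> ?v\<bar> < ?v \<bullet> ?v"
      by (auto simp: dist_real_def)
    have "vderiv \<Gamma> f y \<bullet> ?v > 0" if "y \<in> points \<Gamma>" "dist y x < d" for y
      using d(2)[OF that] by linarith
    with d(1) show thesis by (rule that)
  qed
  have mono: "f y \<bullet> ?v < f z \<bullet> ?v" if "y \<in> ball x d \<inter> points \<Gamma>" "z \<in> ball x d \<inter> points \<Gamma>" "y < z" for y z
  proof -
    note yz = that(3)
    have conv: "convex (ball x d \<inter> points \<Gamma>)" by (intro convex_Int convex_ball convex_points)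
    have sub: "{y..z} \<subseteq> ball x d \<inter> points \<Gamma>"
    proof
      fix w assume "w \<in> {y..z}"
      then show "w \<in> ball x d \<inter> points \<Gamma>"
        using mem_is_interval_1_I[OF conv[folded is_interval_convex_1] that(1,2)] by simp
    qed
    have der: "((\<lambda>y. f y \<bullet> ?v) has_real_derivative vderiv \<Gamma> f w \<bullet> ?v) (at w within {y..z})" if "w \<in> {y..z}" for w
    proof -
      have "(f has_vector_derivative vderiv \<Gamma> f w) (at w within points \<Gamma>)"
        using cdiff_vderiv(1)[of 0 f w] assms(1) subsetD[OF sub that] by (simp del: cdiff.simps)
      then have "(f has_vector_derivative vderiv \<Gamma> f w) (at w within {y..z})"
        using has_vector_derivative_within_subset sub by blast
      then show ?thesis unfolding has_real_derivative_iff_has_vector_derivative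
        using bounded_linear.has_vector_derivative[OF bounded_linear_inner_left] by blast
    qed
    have cont': "continuous_on {y..z} (\<lambda>y. f y \<bullet> ?v)"
      using der by (meson DERIV_continuous continuous_on_eq_continuous_within)
    have at_w: "((\<lambda>y. f y \<bullet> ?v) has_derivative (\<lambda>h. h * (vderiv \<Gamma> f w \<bullet> ?v))) (at w)" if "y < w" "w < z" for w
      using der[of w] that at_within_Icc_at[of y w z] by (simp add: has_field_derivative_def mult.commute[of _ "vderiv \<Gamma> f w \<bullet> ?v"])
    obtain w where w: "y < w" "w < z" "f z \<bullet> ?v - f y \<bullet> ?v = (z - y) * (vderiv \<Gamma> f w \<bullet> ?v)"
      by (rule mvt[OF yz cont' at_w]) auto
    have "vderiv \<Gamma> f w \<bullet> ?v > 0" 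
    proof -
      have "w \<in> {y..z}" using w(1,2) by simp
      then have "w \<in> ball x d \<inter> points \<Gamma>" using sub by blast
      then show ?thesis using d(2)[of w] by (simp add: dist_commute)
    qed
    then show ?thesis using w that(3) mult_pos_pos[of "z - y" "vderiv \<Gamma> f w \<bullet> ?v"] by linarith
  qed
  show "\<exists>U. open U \<and> x \<in> U \<and> inj_on f (U \<inter> points \<Gamma>)"
  proof (intro exI[of _ "ball x d"] conjI inj_onI)
    fix y z assume "y \<in> ball x d \<inter> points \<Gamma>" "z \<in> ball x d \<inter> points \<Gamma>" "f y = f z"
    then show "y = z" using mono[of y z] mono[of z y] by (metis less_irrefl linorder_neqE_linordered_idom)
  qed (use d(1) in auto)
qed

end

section \<open>Smoothing by moving averages\<close>

lemma continuous_on_slice: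
  assumes "continuous_on (T \<times> S) (\<lambda>(t, x). F t x)" "t \<in> T" shows "continuous_on S (F t)"
proof -
  have "continuous_on S (\<lambda>x. case (t, x) of (t, x) \<Rightarrow> F t x)"
    by (rule continuous_on_compose2[OF assms(1)]) (use assms(2) in \<open>auto intro: continuous_on_Pair continuous_on_const continuous_on_id\<close>)
  then show ?thesis by simp
qed

text \<open>  At least one of the two integrals is zero, so this is the signed integral from \<open>c\<close> to \<open>x\<close>.\<close>

definition antiderivative :: "real \<Rightarrow> (real \<Rightarrow> 'v::banach) \<Rightarrow> real \<Rightarrow> 'v" where
  "antiderivative c f x = integral {c..x} f - integral {x..c} f"

lemma antiderivative_eq_integral: "c \<le> x \<Longrightarrow> antiderivative c f x = integral {c..x} f"
  by (cases "c = x") (auto simp: antiderivative_def)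

lemma antiderivative_self [simp]: "antiderivative c f c = 0"
  by (simp add: antiderivative_def)

lemma antiderivative_shift:
  assumes f: "continuous_on UNIV f" and "m \<le> c" "m \<le> x"
  shows "antiderivative c f x = integral {m..x} f - integral {m..c} f"
proof -
  have int: "f integrable_on {p..q}" for p q
    by (intro integrable_continuous_real continuous_on_subset[OF f]) auto
  show ?thesis
  proof (cases "c \<le> x")
    case True
    then show ?thesis using Henstock_Kurzweil_Integration.integral_combine[OF assms(2) True int]
      by (simp add: antiderivative_eq_integral algebra_simps)
  next
    case False
    then show ?thesis using Henstock_Kurzweil_Integration.integral_combine[of m x c f, OF assms(3) _ int]
      by (simp add: antiderivative_def algebra_simps)
  qed
qed

lemma has_vector_derivative_antiderivative:
  assumes f: "continuous_on UNIV f"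
  shows "(antiderivative c f has_vector_derivative f x) (at x)"
proof -
  define m where "m = min c x - 1"
  have "((\<lambda>y. integral {m..y} f) has_vector_derivative f x) (at x within {m..x + 1})"
    by (rule integral_has_vector_derivative) (auto simp: m_def intro: continuous_on_subset[OF f])
  moreover have "at x within {m..x + 1} = at x" by (rule at_within_Icc_at) (auto simp: m_def)
  ultimately have "((\<lambda>y. integral {m..y} f - integral {m..c} f) has_vector_derivative f x) (at x)"
    by (auto intro!: derivative_eq_intros)
  then show ?thesis
    by (rule has_vector_derivative_transform_within_open[where S="{m<..}"])
      (auto simp: m_def antiderivative_shift[OF f, of "min c x - 1"])
qed

text \<open>  Rescaling to a fixed interval of integration turns joint continuity of antiderivatives into continuity of
  a parameter integral.\<close>

lemma antiderivative_eq_average: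
  assumes f: "continuous_on UNIV f"
  shows "antiderivative c f x = (x - c) *\<^sub>R integral {0..1} (\<lambda>y. f (c + y * (x - c)))"
proof -
  have "((\<lambda>y. (x - c) *\<^sub>R f (c + y * (x - c))) has_integral
      antiderivative c f (c + 1 * (x - c)) - antiderivative c f (c + 0 * (x - c))) {0..1}"
  proof (rule fundamental_theorem_of_calculus)
    fix y :: real
    have "((\<lambda>y. c + y * (x - c)) has_vector_derivative (x - c)) (at y)"
      by (auto intro!: derivative_eq_intros simp: has_real_derivative_iff_has_vector_derivative[symmetric])
    from vector_diff_chain_at[OF this has_vector_derivative_antiderivative[OF f, of c]]
    show "((\<lambda>y. antiderivative c f (c + y * (x - c))) has_vector_derivative
        (x - c) *\<^sub>R f (c + y * (x - c))) (at y within {0..1})"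
      by (auto simp: o_def intro: has_vector_derivative_at_within)
  qed simp
  from integral_unique[OF this] show ?thesis by simp
qed

lemma continuous_on_average:
  fixes F :: "'t::euclidean_space \<Rightarrow> real \<Rightarrow> 'v::euclidean_space"
  assumes "continuous_on (T \<times> UNIV) (\<lambda>(t, x). F t x)" "continuous_on U p" "p ` U \<subseteq> T"
    "continuous_on (U \<times> {0..1}) (\<lambda>(z, y). q z y)"
  shows "continuous_on U (\<lambda>z. integral {0..1::real} (\<lambda>y. F (p z) (q z y)))"
proof -
  have "continuous_on (U \<times> {0..1}) (\<lambda>w. (p (fst w), q (fst w) (snd w)))"
    using assms(4) by (intro continuous_on_Pair continuous_on_compose2[OF assms(2)] continuous_on_fst
      continuous_on_id) (auto simp: case_prod_unfold)
  then have "continuous_on (U \<times> {0..1}) (\<lambda>(z, y). F (p z) (q z y))"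
    using continuous_on_compose2[OF assms(1), of "U \<times> {0..1}" "\<lambda>w. (p (fst w), q (fst w) (snd w))"] assms(3)
    by (force simp: case_prod_unfold)
  then show ?thesis
    using integral_continuous_on_param[of U 0 "1::real" "\<lambda>z y. F (p z) (q z y)"] by simp
qed

lemma continuous_on_antiderivative:
  fixes F :: "'t::euclidean_space \<Rightarrow> real \<Rightarrow> 'v::euclidean_space"
  assumes "continuous_on (T \<times> UNIV) (\<lambda>(t, x). F t x)"
  shows "continuous_on (T \<times> UNIV) (\<lambda>(t, x). antiderivative c (F t) x)"
proof -
  have F: "continuous_on UNIV (F t)" if "t \<in> T" for t
    by (rule continuous_on_slice[OF assms that])
  have "continuous_on (T \<times> UNIV) (\<lambda>z. (snd z - c) *\<^sub>R integral {0..1} (\<lambda>y. F (fst z) (c + y * (snd z - c))))"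
    by (intro continuous_intros continuous_on_average[OF assms]) (auto simp: case_prod_unfold intro!: continuous_intros)
  then show ?thesis
    by (rule iffD1[OF continuous_on_cong, rotated 2]) (auto simp: antiderivative_eq_average[OF F])
qed

text \<open>  The mean of \<open>f\<close> over \<open>[x, x + d]\<close>, written over a fixed interval so that it is continuous in \<open>d\<close> up to
  \<open>d = 0\<close>, where it is \<open>f\<close> itself.\<close>

definition steklov :: "real \<Rightarrow> (real \<Rightarrow> 'v::euclidean_space) \<Rightarrow> real \<Rightarrow> 'v" where
  "steklov d f x = integral {0..1} (\<lambda>y. f (x + d * y))"

lemma steklov_0 [simp]: "steklov 0 f = f"
  by (simp add: steklov_def fun_eq_iff)

lemma continuous_on_steklov_joint:
  fixes F :: "'t::euclidean_space \<Rightarrow> real \<Rightarrow> 'v::euclidean_space"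
  assumes "continuous_on (T \<times> UNIV) (\<lambda>(t, x). F t x)" "continuous_on T d"
  shows "continuous_on (T \<times> UNIV) (\<lambda>(t, x). steklov (d t) (F t) x)"
  unfolding steklov_def case_prod_unfold
  by (intro continuous_on_average[OF assms(1)])
    (auto simp: case_prod_unfold intro!: continuous_intros continuous_on_compose2[OF assms(2)])

lemma continuous_on_steklov:
  fixes f :: "real \<Rightarrow> 'v::euclidean_space"
  assumes "continuous_on UNIV f" shows "continuous_on UNIV (steklov d f)"
proof -
  have "continuous_on (UNIV \<times> UNIV) (\<lambda>(t::real, x). f x)"
    using continuous_on_compose2[OF assms continuous_on_snd[OF continuous_on_id]] by (auto simp: case_prod_unfold)
  from continuous_on_steklov_joint[OF this, of "\<lambda>_. d"]
  have "continuous_on (UNIV \<times> UNIV) (\<lambda>(t::real, x). steklov d f x)" by simp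
  from continuous_on_slice[OF this, of 0] show ?thesis by simp
qed

lemma has_vector_derivative_steklov:
  fixes f :: "real \<Rightarrow> 'v::euclidean_space"
  assumes "\<And>x. (f has_vector_derivative f' x) (at x)" "continuous_on UNIV f'"
  shows "(steklov d f has_vector_derivative steklov d f' x) (at x)"
proof -
  have f: "continuous_on UNIV f"
    using assms(1) by (auto simp: continuous_on_eq_continuous_at intro: has_vector_derivative_continuous)
  have "((\<lambda>x. integral (cbox 0 1) (\<lambda>y. f (x + d * y))) has_vector_derivative
      integral (cbox 0 1) (\<lambda>y. f' (x + d * y))) (at x within UNIV)"
  proof (rule leibniz_rule_vector_derivative)
    fix x y :: real
    have "((\<lambda>x. x + d * y) has_vector_derivative 1) (at x)" by (auto intro!: derivative_eq_intros)
    from vector_diff_chain_at[OF this assms(1)]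
    show "((\<lambda>x. f (x + d * y)) has_vector_derivative f' (x + d * y)) (at x within UNIV)" by (simp add: o_def)
    show "(\<lambda>y. f (x + d * y)) integrable_on cbox 0 1"
      by (intro integrable_continuous continuous_on_compose2[OF f]) (auto intro!: continuous_intros)
  next
    show "continuous_on (UNIV \<times> cbox 0 1) (\<lambda>(x, y). f' (x + d * y))"
      unfolding case_prod_unfold by (intro continuous_on_compose2[OF assms(2)]) (auto intro!: continuous_intros)
  qed auto
  then show ?thesis by (simp add: steklov_def[abs_def])
qed

text \<open>  For \<open>d \<noteq> 0\<close> the mean is a difference quotient of an antiderivative, so every mean gains one derivative.\<close>

lemma steklov_smoothing:
  fixes f :: "real \<Rightarrow> 'v::euclidean_space"
  assumes f: "continuous_on UNIV f" and d: "d \<noteq> 0"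
  shows "(steklov d f has_vector_derivative (f (x + d) - f x) /\<^sub>R d) (at x)"
proof -
  let ?A = "antiderivative 0 f"
  have A: "(?A has_vector_derivative f x) (at x)" for x by (rule has_vector_derivative_antiderivative[OF f])
  have eq: "steklov d f x = (?A (x + d) - ?A x) /\<^sub>R d" for x
  proof -
    have "((\<lambda>y. d *\<^sub>R f (x + d * y)) has_integral ?A (x + d * 1) - ?A (x + d * 0)) {0..1}"
    proof (rule fundamental_theorem_of_calculus)
      fix y :: real
      have "((\<lambda>y. x + d * y) has_vector_derivative d) (at y)"
        by (auto intro!: derivative_eq_intros simp: has_real_derivative_iff_has_vector_derivative[symmetric])
      from vector_diff_chain_at[OF this A]
      show "((\<lambda>y. ?A (x + d * y)) has_vector_derivative d *\<^sub>R f (x + d * y)) (at y within {0..1})"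
        by (auto simp: o_def intro: has_vector_derivative_at_within)
    qed simp
    from integral_unique[OF this] have "d *\<^sub>R steklov d f x = ?A (x + d) - ?A x" by (simp add: steklov_def)
    then have "inverse d *\<^sub>R d *\<^sub>R steklov d f x = (?A (x + d) - ?A x) /\<^sub>R d" by simp
    then show ?thesis using d by simp
  qed
  have "((\<lambda>x. x + d) has_vector_derivative 1) (at x)" by (auto intro!: derivative_eq_intros)
  from vector_diff_chain_at[OF this A] have "((\<lambda>x. ?A (x + d)) has_vector_derivative f (x + d)) (at x)"
    by (simp add: o_def)
  from has_vector_derivative_diff[OF this A]
  have "((\<lambda>x. inverse d *\<^sub>R (?A (x + d) - ?A x)) has_vector_derivative inverse d *\<^sub>R (f (x + d) - f x)) (at x)"
    by (rule bounded_linear.has_vector_derivative[OF bounded_linear_scaleR_right])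
  then show ?thesis by (simp add: eq[abs_def])
qed

lemma cdiff_steklov:
  fixes f :: "real \<Rightarrow> 'v::euclidean_space"
  assumes "cdiff k UNIV f" "d \<noteq> 0" shows "cdiff (Suc k) UNIV (steklov d f)"
proof (rule cdiff_real_Suc)
  show "(steklov d f has_vector_derivative (f (x + d) - f x) /\<^sub>R d) (at x within UNIV)" for x
    using steklov_smoothing[OF cdiff_continuous_on[OF assms(1)] assms(2)] by simp
  have "cdiff k UNIV (\<lambda>x. f (x + d))"
    by (rule cdiff_compose[OF assms(1)]) (auto intro: cdiff_intros)
  then show "cdiff k UNIV (\<lambda>x. (f (x + d) - f x) /\<^sub>R d)"
    by (intro cdiff_bounded_linear_comp[OF bounded_linear_scaleR_right] cdiff_diff assms(1))
qed

lemma steklov_near: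
  fixes f :: "real \<Rightarrow> 'v::euclidean_space"
  assumes f: "continuous_on UNIV f" and d: "0 \<le> d" and "\<And>y. x \<le> y \<Longrightarrow> y \<le> x + d \<Longrightarrow> norm (f y - c) \<le> e"
  shows "norm (steklov d f x - c) \<le> e"
proof -
  have int: "(\<lambda>y. f (x + d * y)) integrable_on {0..1}"
    by (intro integrable_continuous_real continuous_on_compose2[OF f]) (auto intro!: continuous_intros)
  have "steklov d f x - c = integral {0..1} (\<lambda>y. f (x + d * y) - c)"
    by (subst integral_diff) (use int in \<open>auto simp: steklov_def\<close>)
  also have "norm \<dots> \<le> e * (1 - 0)"
  proof (rule integral_bound)
    show "continuous_on {0..1} (\<lambda>y. f (x + d * y) - c)"
      by (intro continuous_intros continuous_on_compose2[OF f]) auto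
    fix y :: real assume y: "y \<in> {0..1}"
    then have "d * y \<le> d * 1" using d by (intro mult_left_mono) auto
    then show "norm (f (x + d * y) - c) \<le> e" using y d by (intro assms(3)) auto
  qed simp
  finally show ?thesis by simp
qed

abbreviation iterated_steklov :: "nat \<Rightarrow> real \<Rightarrow> (real \<Rightarrow> 'v::euclidean_space) \<Rightarrow> real \<Rightarrow> 'v" where
  "iterated_steklov K d f \<equiv> (steklov d ^^ K) f"

lemma continuous_on_iterated_steklov:
  "continuous_on UNIV f \<Longrightarrow> continuous_on UNIV (iterated_steklov K d f)"
  by (induction K) (auto intro: continuous_on_steklov)

lemma iterated_steklov_near:
  assumes f: "continuous_on UNIV f" and d: "0 \<le> d"
  shows "(\<And>y. x \<le> y \<Longrightarrow> y \<le> x + real K * d \<Longrightarrow> norm (f y - c) \<le> e) \<Longrightarrow>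
    norm (iterated_steklov K d f x - c) \<le> e"
proof (induction K arbitrary: x)
  case (Suc K)
  show ?case
    unfolding funpow.simps o_def
  proof (rule steklov_near[OF continuous_on_iterated_steklov[OF f] d], rule Suc.IH)
    fix y z assume "x \<le> y" "y \<le> x + d" "y \<le> z" "z \<le> y + real K * d"
    then show "norm (f z - c) \<le> e" by (intro Suc.prems) (auto simp: algebra_simps)
  qed
qed simp

lemma has_vector_derivative_iterated_steklov:
  assumes "\<And>x. (f has_vector_derivative f' x) (at x)" "continuous_on UNIV f'"
  shows "(iterated_steklov K d f has_vector_derivative iterated_steklov K d f' x) (at x)"
  by (induction K arbitrary: x)
    (auto intro: has_vector_derivative_steklov continuous_on_iterated_steklov assms)

lemma cdiff_iterated_steklov:
  "continuous_on UNIV f \<Longrightarrow> d \<noteq> 0 \<Longrightarrow> cdiff K UNIV (iterated_steklov K d f)"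
proof (induction K)
  case (Suc K)
  then show ?case using cdiff_steklov[of K "iterated_steklov K d f" d] by simp
qed simp

lemma continuous_on_iterated_steklov_joint:
  fixes F :: "real \<Rightarrow> real \<Rightarrow> 'v::euclidean_space"
  assumes "continuous_on (T \<times> UNIV) (\<lambda>(t, x). F t x)" "continuous_on T d"
  shows "continuous_on (T \<times> UNIV) (\<lambda>(t, x). iterated_steklov K (d t) (F t) x)"
  by (induction K) (use assms continuous_on_steklov_joint[OF _ assms(2), of "\<lambda>t. iterated_steklov _ (d t) (F t)"] in auto)

lemma iterated_steklov_0 [simp]: "iterated_steklov K 0 f = f"
  by (induction K) auto

context curve_dom
begin

lemma map_on_iterated_steklov:
  assumes "\<Gamma> = Circle a b" "map_on \<Gamma> f" shows "map_on \<Gamma> (iterated_steklov K d f)"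
proof -
  have step: "steklov d g (x + (b - a)) = steklov d g x" if "\<And>x. g (x + (b - a)) = g x" for g :: "real \<Rightarrow> 'a" and x
  proof -
    have "g (x + (b - a) + d * y) = g (x + d * y)" for y using that[of "x + d * y"] by (simp add: algebra_simps)
    then show ?thesis by (simp add: steklov_def)
  qed
  have "iterated_steklov K d f (x + (b - a)) = iterated_steklov K d f x" for x
  proof (induction K arbitrary: x)
    case (Suc K)
    show ?case unfolding funpow.simps o_def by (rule step) (rule Suc)
  qed (use assms in auto)
  then show ?thesis by (simp add: assms(1))
qed

text \<open>  Moving averages on an interval look beyond its end. The derivative is continued constantly to the line
  and integrated.\<close>

lemma extension_to_line:
  fixes F0 F1 :: "real \<Rightarrow> real \<Rightarrow> 'v::euclidean_space"
  assumes der: "\<And>t x. t \<in> {0..1} \<Longrightarrow> x \<in> points \<Gamma> \<Longrightarrow> (F0 t has_vector_derivative F1 t x) (at x within points \<Gamma>)"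
    and c0: "continuous_on ({0..1} \<times> points \<Gamma>) (\<lambda>(t, x). F0 t x)"
    and c1: "continuous_on ({0..1} \<times> points \<Gamma>) (\<lambda>(t, x). F1 t x)"
    and per: "\<And>t. t \<in> {0..1} \<Longrightarrow> map_on \<Gamma> (F0 t)" "\<And>t. t \<in> {0..1} \<Longrightarrow> map_on \<Gamma> (F1 t)"
  obtains G0 G1 where
    "\<And>t x. t \<in> {0..1} \<Longrightarrow> (G0 t has_vector_derivative G1 t x) (at x)"
    "continuous_on ({0..1} \<times> UNIV) (\<lambda>(t, x). G0 t x)"
    "continuous_on ({0..1} \<times> UNIV) (\<lambda>(t, x). G1 t x)"
    "\<And>t. t \<in> {0..1} \<Longrightarrow> map_on \<Gamma> (G0 t)" "\<And>t. t \<in> {0..1} \<Longrightarrow> map_on \<Gamma> (G1 t)"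
    "\<And>t x. t \<in> {0..1} \<Longrightarrow> x \<in> points \<Gamma> \<Longrightarrow> G0 t x = F0 t x \<and> G1 t x = F1 t x"
proof (cases "\<Gamma> = Circle a b")
  case True
  then have "points \<Gamma> = UNIV" by simp
  then show ?thesis using that[of F0 F1] assms by auto
next
  case False
  then have G: "\<Gamma> = Interval a b" using dom by simp
  then have S: "points \<Gamma> = {a..b}" by simp
  define G1 where "G1 t x = F1 t (max a (min b x))" for t x
  define G0 where "G0 t x = F0 t a + antiderivative a (G1 t) x" for t x
  have cG1: "continuous_on ({0..1} \<times> UNIV) (\<lambda>(t, x). G1 t x)"
    unfolding G1_def case_prod_unfold
    by (intro continuous_on_compose2[OF c1[unfolded case_prod_unfold], of _ "\<lambda>z. (fst z, max a (min b (snd z)))", simplified])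
      (auto simp: S intro!: continuous_intros simp: ab less_imp_le)
  have cG1': "continuous_on UNIV (G1 t)" if "t \<in> {0..1}" for t
    by (rule continuous_on_slice[OF cG1 that])
  have "continuous_on ({0..1} \<times> UNIV) (\<lambda>z. F0 (fst z) a)"
    by (intro continuous_on_compose2[OF c0[unfolded case_prod_unfold], of _ "\<lambda>z. (fst z, a)", simplified])
      (auto simp: S intro!: continuous_intros simp: ab less_imp_le)
  then have cG0: "continuous_on ({0..1} \<times> UNIV) (\<lambda>(t, x). G0 t x)"
    using continuous_on_antiderivative[OF cG1, of a] unfolding G0_def case_prod_unfold by (intro continuous_on_add)
  have eq: "G0 t x = F0 t x \<and> G1 t x = F1 t x" if t: "t \<in> {0..1}" and x: "x \<in> points \<Gamma>" for t x
  proof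
    have "(F1 t has_integral F0 t x - F0 t a) {a..x}"
      using x by (intro fundamental_theorem_of_calculus has_vector_derivative_within_subset[OF der[OF t]]) (auto simp: S)
    then have "(G1 t has_integral F0 t x - F0 t a) {a..x}"
      by (rule has_integral_eq[rotated]) (use x in \<open>auto simp: G1_def S\<close>)
    then show "G0 t x = F0 t x" using x by (simp add: G0_def S antiderivative_eq_integral integral_unique)
    show "G1 t x = F1 t x" using x by (simp add: G1_def S)
  qed
  show ?thesis
  proof (rule that[of G0 G1])
    show "(G0 t has_vector_derivative G1 t x) (at x)" if "t \<in> {0..1}" for t x
      unfolding G0_def using has_vector_derivative_antiderivative[OF cG1'[OF that], of a x]
      by (auto intro!: derivative_eq_intros)
  qed (use cG0 cG1 eq G in auto)
qed

text \<open>  The width of the averages is a multiple of \<open>t (1 - t)\<close>: positive at inner times, where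
  \<open>Suc K\<close> averages provide the derivatives, and zero at the end times. On a circle
  \<open>F0 t\<close> is the derivative of the periodic map \<open>H t\<close>, and averaging \<open>H t\<close> as well shows that the mean of
  the smoothed velocity is still zero.\<close>

lemma smoothing:
  fixes F0 F1 :: "real \<Rightarrow> real \<Rightarrow> 'v::euclidean_space"
  assumes der: "\<And>t x. t \<in> {0..1} \<Longrightarrow> x \<in> points \<Gamma> \<Longrightarrow> (F0 t has_vector_derivative F1 t x) (at x within points \<Gamma>)"
    and c0: "continuous_on ({0..1} \<times> points \<Gamma>) (\<lambda>(t, x). F0 t x)"
    and c1: "continuous_on ({0..1} \<times> points \<Gamma>) (\<lambda>(t, x). F1 t x)"
    and per: "\<And>t. t \<in> {0..1} \<Longrightarrow> map_on \<Gamma> (F0 t)" "\<And>t. t \<in> {0..1} \<Longrightarrow> map_on \<Gamma> (F1 t)"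
    and prim: "\<And>t. t \<in> {0..1} \<Longrightarrow> map_on \<Gamma> (H t)"
      "\<And>t x. t \<in> {0..1} \<Longrightarrow> x \<in> points \<Gamma> \<Longrightarrow> (H t has_vector_derivative F0 t x) (at x within points \<Gamma>)"
    and e: "e > 0"
  obtains u u1 u2 :: "real \<Rightarrow> real \<Rightarrow> 'v" where
    "\<And>t x. t \<in> {0..1} \<Longrightarrow> (u t has_vector_derivative u1 t x) (at x)"
    "\<And>t x. t \<in> {0<..<1} \<Longrightarrow> (u1 t has_vector_derivative u2 t x) (at x)"
    "\<And>t. t \<in> {0<..<1} \<Longrightarrow> cdiff K UNIV (u1 t)"
    "continuous_on ({0..1} \<times> UNIV) (\<lambda>(t, x). u t x)"
    "continuous_on ({0..1} \<times> UNIV) (\<lambda>(t, x). u1 t x)"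
    "continuous_on ({0<..<1} \<times> UNIV) (\<lambda>(t, x). u2 t x)"
    "\<And>t. t \<in> {0..1} \<Longrightarrow> map_on \<Gamma> (u t)" "\<And>t. t \<in> {0..1} \<Longrightarrow> map_on \<Gamma> (u1 t)"
    "\<And>t. t \<in> {0<..<1} \<Longrightarrow> map_on \<Gamma> (u2 t)"
    "\<And>t. t \<in> {0..1} \<Longrightarrow> \<Gamma> = Circle a b \<Longrightarrow> integral {a..b} (u t) = 0"
    "\<And>t x. t \<in> {0, 1} \<Longrightarrow> x \<in> points \<Gamma> \<Longrightarrow> u t x = F0 t x \<and> u1 t x = F1 t x"
    "\<And>t x. t \<in> {0..1} \<Longrightarrow> x \<in> {a..b} \<Longrightarrow> norm (u t x - F0 t x) \<le> e \<and> norm (u1 t x - F1 t x) \<le> e"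
proof -
  obtain G0 G1 where G: "\<And>t x. t \<in> {0..1} \<Longrightarrow> (G0 t has_vector_derivative G1 t x) (at x)"
    "continuous_on ({0..1} \<times> UNIV) (\<lambda>(t, x). G0 t x)"
    "continuous_on ({0..1} \<times> UNIV) (\<lambda>(t, x). G1 t x)"
    and Gper: "\<And>t. t \<in> {0..1} \<Longrightarrow> map_on \<Gamma> (G0 t)" "\<And>t. t \<in> {0..1} \<Longrightarrow> map_on \<Gamma> (G1 t)"
    and GF: "\<And>t x. t \<in> {0..1} \<Longrightarrow> x \<in> points \<Gamma> \<Longrightarrow> G0 t x = F0 t x \<and> G1 t x = F1 t x"
    using extension_to_line[OF der c0 c1 per] by blast
  have slice: "continuous_on UNIV (G t)" if "continuous_on ({0..1} \<times> UNIV) (\<lambda>(t, x). G t x)" "t \<in> {0..1}"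
    for G :: "real \<Rightarrow> real \<Rightarrow> 'v" and t
    by (rule continuous_on_slice[OF that])
  have modulus: "\<exists>r>0. \<forall>t\<in>{0..1}. \<forall>x\<in>{a..b}. \<forall>y. x \<le> y \<and> y \<le> x + r \<longrightarrow> norm (G t y - G t x) \<le> e"
    if "continuous_on ({0..1} \<times> UNIV) (\<lambda>(t, x). G t x)" for G :: "real \<Rightarrow> real \<Rightarrow> 'v"
  proof -
    have "uniformly_continuous_on ({0..1} \<times> {a..b + 1}) (\<lambda>(t, x). G t x)"
      by (intro compact_uniformly_continuous continuous_on_subset[OF that] compact_Times) auto
    then obtain d where d: "d > 0" "\<And>z w. z \<in> {0..1} \<times> {a..b + 1} \<Longrightarrow> w \<in> {0..1} \<times> {a..b + 1} \<Longrightarrow>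
        dist w z < d \<Longrightarrow> dist (case w of (t, x) \<Rightarrow> G t x) (case z of (t, x) \<Rightarrow> G t x) < e"
      using e unfolding uniformly_continuous_on_def by metis
    have "norm (G t y - G t x) \<le> e" if "t \<in> {0..1}" "x \<in> {a..b}" "x \<le> y" "y \<le> x + min 1 (d / 2)" for t x y
    proof -
      have "y \<le> b + 1" "y - x < d" using that d(1) by (auto simp: min_def split: if_splits)
      then have "norm (G t y - G t x) < e" using d(2)[of "(t, x)" "(t, y)"] that by (auto simp: dist_Pair_Pair dist_norm)
      then show ?thesis by simp
    qed
    then show ?thesis using d(1) by (intro exI[of _ "min 1 (d / 2)"]) auto
  qed
  obtain r0 where r0: "r0 > 0" "\<And>t x y. t \<in> {0..1} \<Longrightarrow> x \<in> {a..b} \<Longrightarrow> x \<le> y \<Longrightarrow> y \<le> x + r0 \<Longrightarrow> norm (G0 t y - G0 t x) \<le> e"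
    using modulus[OF G(2)] by blast
  obtain r1 where r1: "r1 > 0" "\<And>t x y. t \<in> {0..1} \<Longrightarrow> x \<in> {a..b} \<Longrightarrow> x \<le> y \<Longrightarrow> y \<le> x + r1 \<Longrightarrow> norm (G1 t y - G1 t x) \<le> e"
    using modulus[OF G(3)] by blast
  define d where "d t = min r0 r1 / real (Suc K) * (t * (1 - t))" for t :: real
  have d0: "d t \<ge> 0" "real (Suc K) * d t \<le> min r0 r1" if "t \<in> {0..1}" for t
  proof -
    show "d t \<ge> 0" using that r0(1) r1(1) by (auto simp: d_def)
    have "t * (1 - t) \<le> 1 * 1" using that by (intro mult_mono) auto
    then have "min r0 r1 * (t * (1 - t)) \<le> min r0 r1 * 1" using r0(1) r1(1) by (intro mult_left_mono) auto
    then show "real (Suc K) * d t \<le> min r0 r1" by (simp add: d_def)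
  qed
  have dpos: "d t \<noteq> 0" if "t \<in> {0<..<1}" for t using that r0(1) r1(1) by (auto simp: d_def)
  have dcont: "continuous_on T d" for T unfolding d_def by (intro continuous_intros)
  define u where "u t = iterated_steklov (Suc K) (d t) (G0 t)" for t
  define u1 where "u1 t = iterated_steklov (Suc K) (d t) (G1 t)" for t
  define u2 where "u2 t x = (iterated_steklov K (d t) (G1 t) (x + d t) - iterated_steklov K (d t) (G1 t) x) /\<^sub>R d t" for t x
  show thesis
  proof (rule that[of u u1 u2])
    fix t x :: real assume t: "t \<in> {0..1}"
    show "(u t has_vector_derivative u1 t x) (at x)"
      unfolding u_def u1_def by (rule has_vector_derivative_iterated_steklov[OF G(1)[OF t] slice[OF G(3) t]])
    show "map_on \<Gamma> (u t)" "map_on \<Gamma> (u1 t)"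
      using map_on_iterated_steklov[OF _ Gper(1)[OF t]] map_on_iterated_steklov[OF _ Gper(2)[OF t]] dom
      unfolding u_def u1_def by (metis map_on.simps(1))+
    show "integral {a..b} (u t) = 0" if C: "\<Gamma> = Circle a b"
    proof -
      have U: "points \<Gamma> = UNIV" using C by simp
      have ab_eq: "a + (b - a) = b" by simp
      have H: "(H t has_vector_derivative G0 t x) (at x)" for x
        using prim(2)[OF t, of x] GF[OF t, of x] U by simp
      have "(u t has_integral iterated_steklov (Suc K) (d t) (H t) b - iterated_steklov (Suc K) (d t) (H t) a) {a..b}"
        unfolding u_def
        by (rule fundamental_theorem_of_calculus[OF less_imp_le[OF ab]], rule has_vector_derivative_at_within)
          (rule has_vector_derivative_iterated_steklov[OF H slice[OF G(2) t]])
      moreover have "map_on \<Gamma> (iterated_steklov (Suc K) (d t) (H t))" by (rule map_on_iterated_steklov[OF C prim(1)[OF t]])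
      then have "iterated_steklov (Suc K) (d t) (H t) (a + (b - a)) = iterated_steklov (Suc K) (d t) (H t) a"
        unfolding C map_on.simps by (rule spec)
      then have "iterated_steklov (Suc K) (d t) (H t) b = iterated_steklov (Suc K) (d t) (H t) a"
        unfolding ab_eq .
      ultimately show ?thesis by (simp only: diff_self integral_unique)
    qed
    show "norm (u t x - F0 t x) \<le> e \<and> norm (u1 t x - F1 t x) \<le> e" if x: "x \<in> {a..b}"
    proof -
      have "norm (u t x - G0 t x) \<le> e" "norm (u1 t x - G1 t x) \<le> e"
        unfolding u_def u1_def using d0[OF t]
        by (auto intro!: iterated_steklov_near[OF slice[OF G(2) t] d0(1)[OF t]]
          iterated_steklov_near[OF slice[OF G(3) t] d0(1)[OF t]] r0(2)[OF t x] r1(2)[OF t x] simp del: funpow.simps)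
      then show ?thesis using GF[OF t, of x] x Icc_subset by auto
    qed
  next
    fix t x :: real assume t: "t \<in> {0<..<1}"
    then have t': "t \<in> {0..1}" by auto
    show "(u1 t has_vector_derivative u2 t x) (at x)"
      unfolding u1_def u2_def funpow.simps o_def
      by (rule steklov_smoothing[OF continuous_on_iterated_steklov[OF slice[OF G(3) t']] dpos[OF t]])
    show "cdiff K UNIV (u1 t)"
      unfolding u1_def using cdiff_iterated_steklov[OF slice[OF G(3) t'] dpos[OF t], of "Suc K"] by (rule cdiff_SucD)
    show "map_on \<Gamma> (u2 t)"
    proof (cases "\<Gamma> = Circle a b")
      case True
      then show ?thesis using map_on_iterated_steklov[OF True Gper(2)[OF t'], of K "d t"]
        by (simp add: u2_def add.assoc[symmetric]) (metis add.assoc add.commute)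
    qed (use dom in auto)
  next
    fix t x :: real assume "t \<in> {0, 1}" "x \<in> points \<Gamma>"
    then show "u t x = F0 t x \<and> u1 t x = F1 t x"
      using GF[of t x] by (auto simp: u_def u1_def d_def simp del: funpow.simps)
  next
    show "continuous_on ({0..1} \<times> UNIV) (\<lambda>(t, x). u t x)" "continuous_on ({0..1} \<times> UNIV) (\<lambda>(t, x). u1 t x)"
      unfolding u_def u1_def by (intro continuous_on_iterated_steklov_joint G(2,3) dcont)+
    have c: "continuous_on ({0<..<1} \<times> UNIV) (\<lambda>z. iterated_steklov K (d (fst z)) (G1 (fst z)) (snd z))"
      using continuous_on_iterated_steklov_joint[OF continuous_on_subset[OF G(3)] dcont, of "{0<..<1}"]
      by (force simp: case_prod_unfold)
    have "continuous_on ({0<..<1} \<times> UNIV) (\<lambda>z. iterated_steklov K (d (fst z)) (G1 (fst z)) (snd z + d (fst z)))"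
      using continuous_on_compose2[OF c, of "{0<..<1} \<times> UNIV" "\<lambda>z. (fst z, snd z + d (fst z))"]
      by (force intro!: continuous_intros continuous_on_compose2[OF dcont])
    then show "continuous_on ({0<..<1} \<times> UNIV) (\<lambda>(t, x). u2 t x)"
      unfolding u2_def case_prod_unfold using c dpos
      by (intro continuous_intros continuous_on_compose2[OF dcont[of UNIV]]) auto
  qed
qed

end

section \<open>Isotropic oscillations of increasing frequency\<close>

lemma bounded_linear_axis: "bounded_linear (\<lambda>y::'b::euclidean_space. axis i y :: 'b ^ 'n::finite)"
  by (auto simp: linear_conv_bounded_linear[symmetric] linear_iff axis_def vec_eq_iff)

lemma vec_lambda_eq_sum_axis: "(\<chi> i. f i) = (\<Sum>i\<in>UNIV. axis i (f i :: 'b::comm_monoid_add))"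
  by (simp add: vec_eq_iff axis_def)

lemma has_vector_derivative_vec_lambda:
  fixes f :: "'n::finite \<Rightarrow> real \<Rightarrow> 'b::euclidean_space"
  assumes "\<And>i. (f i has_vector_derivative f' i) (at x within S)"
  shows "((\<lambda>x. \<chi> i. f i x) has_vector_derivative (\<chi> i. f' i)) (at x within S)"
  unfolding vec_lambda_eq_sum_axis
  by (intro has_vector_derivative_sum bounded_linear.has_vector_derivative[OF bounded_linear_axis] assms)

lemma norm_vec_le_sum: "norm (x :: 'b::real_normed_vector ^ 'n) \<le> (\<Sum>i\<in>UNIV. norm (x $ i))"
  unfolding norm_vec_def by (rule L2_set_le_sum) simp

text \<open>  A partition of unity over the levels \<open>l\<close>, in which \<open>\<sigma> \<ge> 0\<close> involves the two neighbouring levels only. It passes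
  continuously from one frequency level to the next.\<close>

definition hat :: "real \<Rightarrow> nat \<Rightarrow> real" where
  "hat \<sigma> l = max 0 (1 - \<bar>real l - \<sigma>\<bar>)"

lemma hat_nonneg [simp]: "0 \<le> hat \<sigma> l" by (simp add: hat_def)
lemma hat_le_1 [simp]: "hat \<sigma> l \<le> 1" by (simp add: hat_def)

lemma hat_nonzero: "0 \<le> \<sigma> \<Longrightarrow> hat \<sigma> l \<noteq> 0 \<Longrightarrow> l = nat \<lfloor>\<sigma>\<rfloor> \<or> l = Suc (nat \<lfloor>\<sigma>\<rfloor>)"
  unfolding hat_def by (simp add: max_def split: if_splits) linarith

lemma sum_hat_aux: "0 \<le> \<sigma> \<Longrightarrow> (\<Sum>l\<le>K. hat \<sigma> l) = min 1 (max 0 (real K + 1 - \<sigma>))"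
proof (induction K)
  case (Suc K)
  have "min 1 (max 0 z) + max 0 (1 - \<bar>z\<bar>) = min 1 (max 0 (z + 1))" for z :: real by (auto simp: min_def max_def abs_if)
  from this[of "real K + 1 - \<sigma>"] Suc show ?case by (simp add: hat_def add.commute algebra_simps)
qed (auto simp: hat_def)

lemma sum_hat: "0 \<le> \<sigma> \<Longrightarrow> \<sigma> \<le> real K \<Longrightarrow> (\<Sum>l\<le>K. hat \<sigma> l) = 1"
  by (simp add: sum_hat_aux)

lemma sum_sqrt_hat_le: assumes "0 \<le> \<sigma>" shows "(\<Sum>l\<le>K. sqrt (hat \<sigma> l)) \<le> 2"
proof -
  let ?A = "{nat \<lfloor>\<sigma>\<rfloor>, Suc (nat \<lfloor>\<sigma>\<rfloor>)}"
  have "(\<Sum>l\<le>K. sqrt (hat \<sigma> l)) = (\<Sum>l\<in>{..K} \<inter> ?A. sqrt (hat \<sigma> l))"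
    by (rule sum.mono_neutral_right) (use hat_nonzero[OF assms] in force)+
  also have "\<dots> \<le> (\<Sum>l\<in>{..K} \<inter> ?A. 1)" by (intro sum_mono) simp
  also have "\<dots> \<le> 2" using card_mono[of ?A "{..K} \<inter> ?A"] by simp
  finally show ?thesis .
qed

text \<open>  The number of levels in the sums below depends on \<open>\<sigma>\<close> but is constant in effect on bounded ranges of \<open>\<sigma>\<close>
  (\<open>sum_levels_stable\<close>), so continuity is checked on these.\<close>

lemma continuous_on_exhaust_levels:
  fixes F :: "real \<times> 'a::real_normed_vector \<Rightarrow> 'v::real_normed_vector"
  assumes "\<And>K::nat. continuous_on ({0..real K} \<times> S) F"
  shows "continuous_on ({0..} \<times> S) F"
  unfolding continuous_on_eq_continuous_within
proof
  fix z :: "real \<times> 'a" assume z: "z \<in> {0..} \<times> S"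
  obtain K :: nat where K: "fst z < real K" using reals_Archimedean2 by blast
  have "continuous (at z within {0..real K} \<times> S) F"
    using assms[of K] z K unfolding continuous_on_eq_continuous_within by (cases z) simp
  moreover have "at z within {0..real K} \<times> S = at z within {0..} \<times> S"
    by (rule at_within_nhd[where S="{..<real K} \<times> UNIV"]) (use K in \<open>auto simp: mem_Times_iff intro!: open_Times\<close>)
  ultimately show "continuous (at z within {0..} \<times> S) F" by (simp add: continuous_within)
qed

lemma sum_levels_stable:
  assumes "nat \<lceil>\<sigma>\<rceil> \<le> K" "\<And>l. hat \<sigma> l = 0 \<Longrightarrow> f l = (0::'a::comm_monoid_add)"
  shows "(\<Sum>l\<le>nat \<lceil>\<sigma>\<rceil>. f l) = (\<Sum>l\<le>K. f l)"
proof (rule sum.mono_neutral_left)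
  show "\<forall>i\<in>{..K} - {..nat \<lceil>\<sigma>\<rceil>}. f i = 0"
  proof
    fix l assume "l \<in> {..K} - {..nat \<lceil>\<sigma>\<rceil>}"
    then have "hat \<sigma> l = 0" unfolding hat_def by (simp add: max_def) linarith
    then show "f l = 0" by (rule assms(2))
  qed
qed (use assms(1) in auto)

text \<open>  An antiderivative of \<open>sin (\<alpha> x) sin (\<beta> x)\<close> minus its mean. For \<open>\<alpha> = \<beta>\<close> the first quotient is \<open>0\<close> by
  the convention on division by zero, and this is the right value, as the mean \<open>1/2\<close> has been removed.\<close>

definition sine_product_integral :: "real \<Rightarrow> real \<Rightarrow> real \<Rightarrow> real" where
  "sine_product_integral \<alpha> \<beta> x = (sin ((\<alpha> - \<beta>) * x) / (\<alpha> - \<beta>) - sin ((\<alpha> + \<beta>) * x) / (\<alpha> + \<beta>)) / 2"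

lemma has_derivative_sine_product_integral:
  assumes "\<alpha> > 0" "\<beta> > 0"
  shows "(sine_product_integral \<alpha> \<beta> has_real_derivative
    sin (\<alpha> * x) * sin (\<beta> * x) - (if \<alpha> = \<beta> then 1/2 else 0)) (at x)"
proof -
  have 1: "((\<lambda>x. sin ((\<alpha> - \<beta>) * x) / (\<alpha> - \<beta>)) has_real_derivative (if \<alpha> = \<beta> then 0 else cos ((\<alpha> - \<beta>) * x))) (at x)"
    by (cases "\<alpha> = \<beta>") (auto intro!: derivative_eq_intros)
  have 2: "((\<lambda>x. sin ((\<alpha> + \<beta>) * x) / (\<alpha> + \<beta>)) has_real_derivative cos ((\<alpha> + \<beta>) * x)) (at x)"
    using assms by (auto intro!: derivative_eq_intros)
  have "sin (\<alpha> * x) * sin (\<beta> * x) = (cos ((\<alpha> - \<beta>) * x) - cos ((\<alpha> + \<beta>) * x)) / 2"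
    by (simp add: sin_times_sin algebra_simps)
  then show ?thesis
    using DERIV_cdivide[OF DERIV_diff[OF 1 2], of 2] unfolding sine_product_integral_def
    by (auto simp: diff_divide_distrib split: if_splits)
qed

lemma sine_product_integral_le:
  assumes "\<alpha> \<ge> q" "\<beta> \<ge> q" "\<alpha> = \<beta> \<or> \<bar>\<alpha> - \<beta>\<bar> \<ge> q" "q > 0"
  shows "\<bar>sine_product_integral \<alpha> \<beta> x\<bar> \<le> 1 / q"
proof -
  have 1: "\<bar>sin y / z\<bar> \<le> 1 / q" if "\<bar>z\<bar> \<ge> q" for y z :: real
    using that assms(4) abs_sin_le_one[of y] by (auto simp: abs_divide intro!: frac_le)
  have "\<bar>sin ((\<alpha> - \<beta>) * x) / (\<alpha> - \<beta>)\<bar> \<le> 1 / q" using assms 1[of "\<alpha> - \<beta>"] by (cases "\<alpha> = \<beta>") auto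
  moreover have "\<bar>sin ((\<alpha> + \<beta>) * x) / (\<alpha> + \<beta>)\<bar> \<le> 1 / q" using assms by (intro 1) auto
  moreover have "\<bar>(p - q) / 2\<bar> \<le> e" if "\<bar>p\<bar> \<le> e" "\<bar>q\<bar> \<le> e" for p q e :: real using that by (simp add: abs_le_iff)
  ultimately show ?thesis unfolding sine_product_integral_def by blast
qed

text \<open>  Makes the frequencies \<open>2\<^sup>q (2 j + 1)\<close> belonging to different levels \<open>q\<close> or components \<open>j\<close> distinct.\<close>

lemma odd_multiple_unique:
  assumes "2 ^ p * (2 * i + 1) = 2 ^ q * (2 * j + (1::nat))" shows "p = q \<and> i = j"
proof -
  have *: "p \<le> q \<Longrightarrow> p = q" if "2 ^ p * (2 * i + 1) = 2 ^ q * (2 * j + (1::nat))" for p q i j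
  proof (rule ccontr)
    assume "p \<le> q" "p \<noteq> q"
    then obtain d where q: "q = p + Suc d" using less_imp_Suc_add by (metis add_Suc_right le_neq_implies_less)
    have "2 ^ p * (2 * i + 1) = 2 ^ p * (2 * (2 ^ d * (2 * j + 1)))"
      using that unfolding q power_add power_Suc by (simp only: mult.assoc)
    then have "2 * i + 1 = 2 * (2 ^ d * (2 * j + 1))" by (subst (asm) mult_cancel1) simp
    then show False by presburger
  qed
  have "p = q" using *[OF assms] *[OF assms[symmetric]] by linarith
  then show ?thesis using assms by simp
qed

text \<open>  \<open>y y\<^sup>T - I / (n - 2)\<close>, the deviation of \<open>y y\<^sup>T\<close> from the mean that an isotropic oscillation must have in order
  that its projection onto any \<open>(n - 2)\<close>-dimensional subspace has mean square \<open>1\<close>.\<close>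

definition isotropic_defect :: "real ^ 'n \<Rightarrow> real ^ 'n ^ 'n" where
  "isotropic_defect y = (\<chi> i j. y $ i * y $ j - (if i = j then 1 / (real CARD('n) - 2) else 0))"

text \<open>  The component \<open>i\<close> of \<open>\<rho> \<sigma>\<close> is a sum of sine waves, one for each level, with weights \<open>\<surd>(hat \<sigma> l)\<close>. All the
  frequencies, over levels and components, are distinct. So products of different waves have mean zero, and the
  squares of the weights add up to \<open>1\<close>: the mean of \<open>\<rho> \<rho>\<^sup>T\<close> is the same multiple of the identity for every
  \<open>\<sigma>\<close>, also halfway between two levels. The antiderivatives \<open>r\<close> and \<open>P\<close> are small because the frequencies and
  their nonzero differences are multiples of \<open>2 ^ N m\<close> as soon as \<open>\<sigma> \<ge> m\<close>. The constant \<open>C\<close> is independent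
  of \<open>N\<close>, so the frequencies can be chosen once the amplitude \<open>C\<close> of \<open>\<rho>\<close> is known.\<close>

lemma oscillations:
  fixes L :: real
  assumes "L > 0" and n: "3 \<le> CARD('n)"
  obtains C where "C > 0" and "\<And>N :: nat \<Rightarrow> nat. strict_mono N \<Longrightarrow>
    \<exists>(\<rho> :: real \<Rightarrow> real \<Rightarrow> real ^ 'n) r (P :: real \<Rightarrow> real \<Rightarrow> real ^ 'n ^ 'n).
      (\<forall>\<sigma>\<ge>0. \<forall>x. (r \<sigma> has_vector_derivative \<rho> \<sigma> x) (at x) \<and>
         (P \<sigma> has_vector_derivative isotropic_defect (\<rho> \<sigma> x)) (at x) \<and>
         \<rho> \<sigma> (x + L) = \<rho> \<sigma> x \<and> r \<sigma> (x + L) = r \<sigma> x \<and> P \<sigma> (x + L) = P \<sigma> x \<and>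
         norm (\<rho> \<sigma> x) \<le> C \<and>
         (\<forall>m. real m \<le> \<sigma> \<longrightarrow> norm (r \<sigma> x) \<le> C / 2 ^ N m \<and> norm (P \<sigma> x) \<le> C / 2 ^ N m)) \<and>
      (\<forall>\<sigma> k. cdiff k UNIV (\<rho> \<sigma>) \<and> cdiff k UNIV (r \<sigma>) \<and> cdiff k UNIV (P \<sigma>)) \<and>
      continuous_on ({0..} \<times> UNIV) (\<lambda>(\<sigma>, x). \<rho> \<sigma> x) \<and>
      continuous_on ({0..} \<times> UNIV) (\<lambda>(\<sigma>, x). r \<sigma> x) \<and>
      continuous_on ({0..} \<times> UNIV) (\<lambda>(\<sigma>, x). P \<sigma> x)"
proof -
  define n where "n = real CARD('n)"
  have n3: "n \<ge> 3" using n by (simp add: n_def)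
  define c where "c = sqrt (2 / (n - 2))"
  have c: "c > 0" "c * c = 2 / (n - 2)" using n3 by (simp_all add: c_def)
  define k where "k = 2 * pi / L"
  have k: "k > 0" using assms(1) by (simp add: k_def)
  define C where "C = n * (2 * c) + n * (2 * c / k) + n * (n * (4 * (c * c) / k)) + 1"
  have Cb: "n * (2 * c) \<le> C" "n * (2 * c / k) \<le> C" "n * (n * (4 * (c * c) / k)) \<le> C" "C > 0"
  proof -
    have "0 \<le> n * (2 * c)" "0 \<le> n * (2 * c / k)" "0 \<le> n * (n * (4 * (c * c) / k))" using c(1) k n3 by simp_all
    then show "n * (2 * c) \<le> C" "n * (2 * c / k) \<le> C" "n * (n * (4 * (c * c) / k)) \<le> C" "C > 0"
      unfolding C_def by linarith+
  qed
  obtain \<nu> :: "'n \<Rightarrow> nat" where \<nu>: "inj \<nu>"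
    using finite_imp_inj_to_nat_seg[of "UNIV :: 'n set"] by auto
  show thesis
  proof (rule that[OF Cb(4)])
    fix N :: "nat \<Rightarrow> nat" assume N: "strict_mono N"
    define f where "f l i = 2 ^ N l * (2 * \<nu> i + 1)" for l i
    define w where "w l i = real (f l i) * k" for l i
    have w_eq: "w l i = w l' j \<longleftrightarrow> l = l' \<and> i = j" for l l' i j
    proof
      assume "w l i = w l' j"
      then have "f l i = f l' j" using k by (simp add: w_def)
      from odd_multiple_unique[OF this[unfolded f_def]] show "l = l' \<and> i = j"
        using \<nu> strict_mono_eq[OF N] by (auto dest: injD)
    qed auto
    have w_ge: "2 ^ N m * k \<le> w l i" if "m \<le> l" for m l i
    proof -
      have "(2::nat) ^ N m \<le> 2 ^ N l" using strict_mono_less_eq[OF N] that by simp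
      also have "\<dots> \<le> f l i" by (simp add: f_def)
      finally have "real (2 ^ N m) \<le> real (f l i)" by (simp only: of_nat_le_iff)
      then show ?thesis using k by (simp add: w_def)
    qed
    have w_pos: "w l i > 0" for l i using w_ge[of 0 l i] k by (smt (verit) le0 mult_pos_pos zero_less_power)
    have w_diff: "w l i = w l' j \<or> \<bar>w l i - w l' j\<bar> \<ge> 2 ^ N m * k" if "m \<le> l" "m \<le> l'" for m l l' i j
    proof -
      have mult: "\<exists>z::int. int (f l i) = 2 ^ N m * z" if "m \<le> l" for l i
      proof -
        have "N l = N m + (N l - N m)" using strict_mono_less_eq[OF N] that by simp
        then have "int (f l i) = 2 ^ N m * (2 ^ (N l - N m) * (2 * int (\<nu> i) + 1))"
          unfolding f_def by (metis (no_types, lifting) mult.assoc of_nat_1 of_nat_add of_nat_mult of_nat_numeral of_nat_power power_add)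
        then show ?thesis by blast
      qed
      from mult[OF that(1), of i] mult[OF that(2), of j]
      obtain z z' where z: "int (f l i) = 2 ^ N m * z" "int (f l' j) = 2 ^ N m * z'" by blast
      have eq: "w l i - w l' j = 2 ^ N m * k * real_of_int (z - z')"
      proof -
        have "w l i - w l' j = (real_of_int (int (f l i)) - real_of_int (int (f l' j))) * k" by (simp add: w_def algebra_simps)
        then show ?thesis unfolding z by (simp add: algebra_simps)
      qed
      show ?thesis
      proof (cases "z = z'")
        case False
        then have "1 \<le> \<bar>real_of_int (z - z')\<bar>" by linarith
        then show ?thesis using k unfolding eq abs_mult by simp
      qed (use eq in simp)
    qed
    define W where "W \<sigma> l = sqrt (hat \<sigma> l)" for \<sigma> l
    define \<rho> :: "real \<Rightarrow> real \<Rightarrow> real ^ 'n" where "\<rho> \<sigma> x = (\<chi> i. c * (\<Sum>l\<le>nat \<lceil>\<sigma>\<rceil>. W \<sigma> l * sin (w l i * x)))" for \<sigma> x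
    define r :: "real \<Rightarrow> real \<Rightarrow> real ^ 'n" where "r \<sigma> x = (\<chi> i. c * (\<Sum>l\<le>nat \<lceil>\<sigma>\<rceil>. W \<sigma> l * (- cos (w l i * x) / w l i)))" for \<sigma> x
    define P :: "real \<Rightarrow> real \<Rightarrow> real ^ 'n ^ 'n" where
      "P \<sigma> x = (\<chi> i j. c * c * (\<Sum>l\<le>nat \<lceil>\<sigma>\<rceil>. \<Sum>l'\<le>nat \<lceil>\<sigma>\<rceil>. W \<sigma> l * W \<sigma> l' * sine_product_integral (w l i) (w l' j) x))" for \<sigma> x
    have W: "0 \<le> W \<sigma> l" "W \<sigma> l \<le> 1" for \<sigma> l by (auto simp: W_def)
    have sumW: "(\<Sum>l\<le>K. W \<sigma> l) \<le> 2" if "0 \<le> \<sigma>" for \<sigma> K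
      unfolding W_def by (rule sum_sqrt_hat_le[OF that])
    have sumW2: "(\<Sum>l\<le>nat \<lceil>\<sigma>\<rceil>. W \<sigma> l * W \<sigma> l) = 1" if "0 \<le> \<sigma>" for \<sigma>
      unfolding W_def using sum_hat[OF that, of "nat \<lceil>\<sigma>\<rceil>"] that by (simp add: real_sqrt_mult[symmetric])
    have Wm: "m \<le> l" if "real m \<le> \<sigma>" "W \<sigma> l \<noteq> 0" for m \<sigma> l
      using that unfolding W_def hat_def by (auto simp: max_def split: if_splits)
    have r_der: "(r \<sigma> has_vector_derivative \<rho> \<sigma> x) (at x)" for \<sigma> x
      unfolding r_def[abs_def] \<rho>_def
    proof (intro has_vector_derivative_vec_lambda)
      fix i
      have "((\<lambda>x. - cos (w l i * x) / w l i) has_real_derivative sin (w l i * x)) (at x)" for l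
        using w_pos[of l i] by (auto intro!: derivative_eq_intros)
      then show "((\<lambda>x. c * (\<Sum>l\<le>nat \<lceil>\<sigma>\<rceil>. W \<sigma> l * (- cos (w l i * x) / w l i))) has_vector_derivative
          c * (\<Sum>l\<le>nat \<lceil>\<sigma>\<rceil>. W \<sigma> l * sin (w l i * x))) (at x)"
        unfolding has_real_derivative_iff_has_vector_derivative[symmetric]
        by (intro DERIV_cmult DERIV_sum)
    qed
    have P_der: "(P \<sigma> has_vector_derivative isotropic_defect (\<rho> \<sigma> x)) (at x)" if \<sigma>: "0 \<le> \<sigma>" for \<sigma> x
      unfolding P_def[abs_def] isotropic_defect_def
    proof (intro has_vector_derivative_vec_lambda)
      fix i j
      let ?K = "nat \<lceil>\<sigma>\<rceil>"
      have "((\<lambda>x. c * c * (\<Sum>l\<le>?K. \<Sum>l'\<le>?K. W \<sigma> l * W \<sigma> l' * sine_product_integral (w l i) (w l' j) x)) has_real_derivative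
          c * c * (\<Sum>l\<le>?K. \<Sum>l'\<le>?K. W \<sigma> l * W \<sigma> l' * (sin (w l i * x) * sin (w l' j * x) - (if w l i = w l' j then 1/2 else 0)))) (at x)"
        by (intro DERIV_cmult DERIV_sum has_derivative_sine_product_integral w_pos)
      also have "c * c * (\<Sum>l\<le>?K. \<Sum>l'\<le>?K. W \<sigma> l * W \<sigma> l' * (sin (w l i * x) * sin (w l' j * x) - (if w l i = w l' j then 1/2 else 0)))
        = \<rho> \<sigma> x $ i * \<rho> \<sigma> x $ j - c * c * (\<Sum>l\<le>?K. \<Sum>l'\<le>?K. W \<sigma> l * W \<sigma> l' * (if w l i = w l' j then 1/2 else 0))"
      proof -
        have "(\<Sum>l\<le>?K. \<Sum>l'\<le>?K. W \<sigma> l * W \<sigma> l' * (sin (w l i * x) * sin (w l' j * x))) =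
            (\<Sum>l\<le>?K. W \<sigma> l * sin (w l i * x)) * (\<Sum>l\<le>?K. W \<sigma> l * sin (w l j * x))"
          unfolding sum_product by (intro sum.cong refl) (simp add: mult_ac)
        then show ?thesis unfolding \<rho>_def by (simp add: right_diff_distrib sum_subtractf mult_ac)
      qed
      also have "c * c * (\<Sum>l\<le>?K. \<Sum>l'\<le>?K. W \<sigma> l * W \<sigma> l' * (if w l i = w l' j then 1/2 else 0)) = (if i = j then 1 / (n - 2) else 0)"
      proof (cases "i = j")
        case True
        have "(\<Sum>l\<le>?K. \<Sum>l'\<le>?K. W \<sigma> l * W \<sigma> l' * (if w l i = w l' j then 1/2 else 0)) = (\<Sum>l\<le>?K. W \<sigma> l * W \<sigma> l * (1/2))"
          unfolding w_eq using True by (intro sum.cong refl) (simp add: if_distrib cong: if_cong)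
        also have "\<dots> = 1 / 2" unfolding sum_distrib_right[symmetric] sumW2[OF \<sigma>] by simp
        finally show ?thesis using True c(2) by simp
      next
        case False
        then show ?thesis unfolding w_eq by simp
      qed
      finally show "((\<lambda>x. c * c * (\<Sum>l\<le>?K. \<Sum>l'\<le>?K. W \<sigma> l * W \<sigma> l' * sine_product_integral (w l i) (w l' j) x)) has_vector_derivative
          \<rho> \<sigma> x $ i * \<rho> \<sigma> x $ j - (if i = j then 1 / (real CARD('n) - 2) else 0)) (at x)"
        unfolding has_real_derivative_iff_has_vector_derivative n_def .
    qed
    have period: "sin ((\<alpha> * k) * (x + L)) = sin (\<alpha> * k * x)" "cos ((\<alpha> * k) * (x + L)) = cos (\<alpha> * k * x)" if "\<alpha> \<in> \<int>" for \<alpha> x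
    proof -
      from that obtain z where z: "\<alpha> = of_int z" by (auto elim: Ints_cases)
      have "\<alpha> * k * (x + L) = \<alpha> * k * x + 2 * pi * of_int z" using assms(1) by (simp add: k_def z field_simps)
      then show "sin ((\<alpha> * k) * (x + L)) = sin (\<alpha> * k * x)" "cos ((\<alpha> * k) * (x + L)) = cos (\<alpha> * k * x)"
        by (simp_all add: sin_add cos_add)
    qed
    have sper: "sin (w l i * (x + L)) = sin (w l i * x)" "cos (w l i * (x + L)) = cos (w l i * x)" for l i x
      unfolding w_def using period[of "real (f l i)" x] by auto
    have Jper: "sine_product_integral (w l i) (w l' j) (x + L) = sine_product_integral (w l i) (w l' j) x" for l l' i j x
    proof -
      have "w l i - w l' j = (real (f l i) - real (f l' j)) * k" "w l i + w l' j = (real (f l i) + real (f l' j)) * k"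
        by (simp_all add: w_def algebra_simps)
      then show ?thesis unfolding sine_product_integral_def
        using period(1)[of "real (f l i) - real (f l' j)" x] period(1)[of "real (f l i) + real (f l' j)" x] by simp
    qed
    have bound_vec: "norm y \<le> n * B" if "\<And>i. norm (y $ i) \<le> B" for y :: "'b::real_normed_vector ^ 'n" and B
    proof -
      have "norm y \<le> (\<Sum>i\<in>(UNIV::'n set). B)" using norm_vec_le_sum[of y] sum_mono[of UNIV "\<lambda>i. norm (y $ i)" "\<lambda>_. B"] that by force
      then show ?thesis by (simp add: n_def)
    qed
    have sum_bound: "\<bar>\<Sum>l\<le>K. W \<sigma> l * g l\<bar> \<le> 2 * B" if "0 \<le> \<sigma>" "0 \<le> B" "\<And>l. W \<sigma> l \<noteq> 0 \<Longrightarrow> \<bar>g l\<bar> \<le> B" for \<sigma> K g B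
    proof -
      have "\<bar>\<Sum>l\<le>K. W \<sigma> l * g l\<bar> \<le> (\<Sum>l\<le>K. W \<sigma> l * B)"
      proof (rule order_trans[OF sum_abs], rule sum_mono)
        fix l
        show "\<bar>W \<sigma> l * g l\<bar> \<le> W \<sigma> l * B"
        proof (cases "W \<sigma> l = 0")
          case False
          then show ?thesis using that(3)[OF False] W(1)[of \<sigma> l] by (simp add: abs_mult mult_left_mono)
        qed simp
      qed
      also have "\<dots> \<le> 2 * B" unfolding sum_distrib_right[symmetric] by (rule mult_right_mono[OF sumW[OF that(1)] that(2)])
      finally show ?thesis .
    qed
    have \<rho>_le: "norm (\<rho> \<sigma> x) \<le> C" if "0 \<le> \<sigma>" for \<sigma> x
    proof -
      have "norm (\<rho> \<sigma> x) \<le> n * (c * (2 * 1))"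
      proof (rule bound_vec)
        fix i
        show "norm (\<rho> \<sigma> x $ i) \<le> c * (2 * 1)"
          using sum_bound[OF that, of 1 "\<lambda>l. sin (w l i * x)"] c(1) by (simp add: \<rho>_def abs_mult)
      qed
      then show ?thesis using Cb(1) by (simp add: mult_ac)
    qed
    have r_le: "norm (r \<sigma> x) \<le> C / 2 ^ N m" if "0 \<le> \<sigma>" "real m \<le> \<sigma>" for \<sigma> x m
    proof -
      have "norm (r \<sigma> x) \<le> n * (c * (2 * (1 / (2 ^ N m * k))))"
      proof (rule bound_vec)
        fix i
        have "\<bar>- cos (w l i * x) / w l i\<bar> \<le> 1 / (2 ^ N m * k)" if "W \<sigma> l \<noteq> 0" for l
          using w_ge[OF Wm[OF \<open>real m \<le> \<sigma>\<close> that], of i] w_pos[of l i] k by (auto simp: abs_divide intro!: frac_le)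
        then have "\<bar>\<Sum>l\<le>nat \<lceil>\<sigma>\<rceil>. W \<sigma> l * (- cos (w l i * x) / w l i)\<bar> \<le> 2 * (1 / (2 ^ N m * k))"
          using k by (intro sum_bound \<open>0 \<le> \<sigma>\<close>) auto
        then have "c * \<bar>\<Sum>l\<le>nat \<lceil>\<sigma>\<rceil>. W \<sigma> l * (- cos (w l i * x) / w l i)\<bar> \<le> c * (2 * (1 / (2 ^ N m * k)))"
          using c(1) by (intro mult_left_mono) auto
        then show "norm (r \<sigma> x $ i) \<le> c * (2 * (1 / (2 ^ N m * k)))"
          unfolding r_def vec_lambda_beta real_norm_def abs_mult using c(1) by (simp only: abs_of_pos)
      qed
      also have "\<dots> = n * (2 * c / k) / 2 ^ N m" by (simp add: mult_ac)
      also have "\<dots> \<le> C / 2 ^ N m" by (intro divide_right_mono Cb(2)) simp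
      finally show ?thesis .
    qed
    have P_le: "norm (P \<sigma> x) \<le> C / 2 ^ N m" if "0 \<le> \<sigma>" "real m \<le> \<sigma>" for \<sigma> x m
    proof -
      have "norm (P \<sigma> x) \<le> n * (n * (c * c * (2 * (2 * (1 / (2 ^ N m * k))))))"
      proof (rule bound_vec, rule bound_vec)
        fix i j
        let ?q = "2 ^ N m * k" and ?K = "nat \<lceil>\<sigma>\<rceil>"
        have J: "\<bar>sine_product_integral (w l i) (w l' j) x\<bar> \<le> 1 / ?q" if "W \<sigma> l \<noteq> 0" "W \<sigma> l' \<noteq> 0" for l l'
          using w_ge w_diff Wm[OF \<open>real m \<le> \<sigma>\<close>] that k by (intro sine_product_integral_le) auto
        have in1: "\<bar>\<Sum>l'\<le>?K. W \<sigma> l' * sine_product_integral (w l i) (w l' j) x\<bar> \<le> 2 * (1 / ?q)" if "W \<sigma> l \<noteq> 0" for l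
          by (rule sum_bound[OF \<open>0 \<le> \<sigma>\<close> _ J[OF that]]) (use k in auto)
        have "\<bar>\<Sum>l\<le>?K. W \<sigma> l * (\<Sum>l'\<le>?K. W \<sigma> l' * sine_product_integral (w l i) (w l' j) x)\<bar> \<le> 2 * (2 * (1 / ?q))"
          by (rule sum_bound[OF \<open>0 \<le> \<sigma>\<close> _ in1]) (use k in auto)
        also have "(\<Sum>l\<le>?K. W \<sigma> l * (\<Sum>l'\<le>?K. W \<sigma> l' * sine_product_integral (w l i) (w l' j) x)) =
          (\<Sum>l\<le>?K. \<Sum>l'\<le>?K. W \<sigma> l * W \<sigma> l' * sine_product_integral (w l i) (w l' j) x)"
          by (simp add: sum_distrib_left mult_ac)
        finally have "c * c * \<bar>\<Sum>l\<le>?K. \<Sum>l'\<le>?K. W \<sigma> l * W \<sigma> l' * sine_product_integral (w l i) (w l' j) x\<bar> \<le> c * c * (2 * (2 * (1 / ?q)))"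
          using c(1) by (intro mult_left_mono) auto
        then show "norm (P \<sigma> x $ i $ j) \<le> c * c * (2 * (2 * (1 / ?q)))"
          unfolding P_def vec_lambda_beta real_norm_def abs_mult using c(1) by (simp only: abs_of_pos)
      qed
      also have "\<dots> = n * (n * (4 * (c * c) / k)) / 2 ^ N m" by (simp add: mult_ac)
      also have "\<dots> \<le> C / 2 ^ N m" by (intro divide_right_mono Cb(3)) simp
      finally show ?thesis .
    qed
    have J_cdiff: "cdiff m UNIV (sine_product_integral \<alpha> \<beta>)" for m \<alpha> \<beta>
      unfolding sine_product_integral_def[abs_def] divide_inverse by (intro cdiff_intros cdiff_sin)
    have smooth: "cdiff m UNIV (\<rho> \<sigma>) \<and> cdiff m UNIV (r \<sigma>) \<and> cdiff m UNIV (P \<sigma>)" for m \<sigma>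
      unfolding \<rho>_def[abs_def] r_def[abs_def] P_def[abs_def] divide_inverse
      by (intro conjI cdiff_vec_lambda cdiff_mult cdiff_sum cdiff_const cdiff_sin cdiff_cos cdiff_minus cdiff_ident J_cdiff)
    have Wc: "continuous_on A (\<lambda>z. W (g z) l)" if "continuous_on A g" for A :: "(real \<times> real) set" and g l
      unfolding W_def hat_def by (intro continuous_intros that)
    have Jc: "continuous_on A (\<lambda>z. sine_product_integral \<alpha> \<beta> (g z))" if "continuous_on A g" for A :: "(real \<times> real) set" and g \<alpha> \<beta>
      unfolding sine_product_integral_def divide_inverse by (intro continuous_intros that)
    have ceil: "nat \<lceil>\<sigma>\<rceil> \<le> K" if "\<sigma> \<in> {0..real K}" for \<sigma> K using that by simp
    have stable: "(\<Sum>l\<le>nat \<lceil>\<sigma>\<rceil>. W \<sigma> l * g l) = (\<Sum>l\<le>K. W \<sigma> l * g l)" if "\<sigma> \<in> {0..real K}" for \<sigma> K and g :: "nat \<Rightarrow> real"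
      by (rule sum_levels_stable[OF ceil[OF that]]) (simp add: W_def)
    have cont: "continuous_on ({0..} \<times> UNIV) (\<lambda>(\<sigma>, x). \<chi> i. c * (\<Sum>l\<le>nat \<lceil>\<sigma>\<rceil>. W \<sigma> l * g l i x))"
      if g: "\<And>l i. continuous_on UNIV (g l i)" for g :: "nat \<Rightarrow> 'n \<Rightarrow> real \<Rightarrow> real"
    proof (rule continuous_on_exhaust_levels)
      fix K
      have "continuous_on ({0..real K} \<times> UNIV) (\<lambda>z. \<chi> i. c * (\<Sum>l\<le>K. W (fst z) l * g l i (snd z)))"
        by (intro continuous_on_vec_lambda continuous_intros Wc continuous_on_compose2[OF g]) auto
      then show "continuous_on ({0..real K} \<times> UNIV) (\<lambda>(\<sigma>, x). \<chi> i. c * (\<Sum>l\<le>nat \<lceil>\<sigma>\<rceil>. W \<sigma> l * g l i x))"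
        by (rule iffD1[OF continuous_on_cong, rotated 2]) (auto simp: stable)
    qed
    have contP: "continuous_on ({0..} \<times> UNIV) (\<lambda>(\<sigma>, x). P \<sigma> x)"
    proof (rule continuous_on_exhaust_levels)
      fix K
      have "continuous_on ({0..real K} \<times> UNIV) (\<lambda>z. \<chi> i j. c * c * (\<Sum>l\<le>K. W (fst z) l * (\<Sum>l'\<le>K. W (fst z) l' * sine_product_integral (w l i) (w l' j) (snd z))))"
        by (intro continuous_on_vec_lambda continuous_intros Wc Jc)
      moreover have "P \<sigma> x = (\<chi> i j. c * c * (\<Sum>l\<le>K. W \<sigma> l * (\<Sum>l'\<le>K. W \<sigma> l' * sine_product_integral (w l i) (w l' j) x)))"
        if "\<sigma> \<in> {0..real K}" for \<sigma> x
        unfolding P_def stable[OF that, symmetric] by (simp add: sum_distrib_left mult_ac)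
      ultimately show "continuous_on ({0..real K} \<times> UNIV) (\<lambda>(\<sigma>, x). P \<sigma> x)"
        by (elim iffD1[OF continuous_on_cong, rotated 2]) auto
    qed
    have cont\<rho>: "continuous_on ({0..} \<times> UNIV) (\<lambda>(\<sigma>, x). \<rho> \<sigma> x)"
      unfolding \<rho>_def by (intro cont continuous_intros)
    have contr: "continuous_on ({0..} \<times> UNIV) (\<lambda>(\<sigma>, x). r \<sigma> x)"
      unfolding r_def divide_inverse by (intro cont continuous_intros)
    show "\<exists>(\<rho> :: real \<Rightarrow> real \<Rightarrow> real ^ 'n) r (P :: real \<Rightarrow> real \<Rightarrow> real ^ 'n ^ 'n).
      (\<forall>\<sigma>\<ge>0. \<forall>x. (r \<sigma> has_vector_derivative \<rho> \<sigma> x) (at x) \<and>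
         (P \<sigma> has_vector_derivative isotropic_defect (\<rho> \<sigma> x)) (at x) \<and>
         \<rho> \<sigma> (x + L) = \<rho> \<sigma> x \<and> r \<sigma> (x + L) = r \<sigma> x \<and> P \<sigma> (x + L) = P \<sigma> x \<and>
         norm (\<rho> \<sigma> x) \<le> C \<and>
         (\<forall>m. real m \<le> \<sigma> \<longrightarrow> norm (r \<sigma> x) \<le> C / 2 ^ N m \<and> norm (P \<sigma> x) \<le> C / 2 ^ N m)) \<and>
      (\<forall>\<sigma> k. cdiff k UNIV (\<rho> \<sigma>) \<and> cdiff k UNIV (r \<sigma>) \<and> cdiff k UNIV (P \<sigma>)) \<and>
      continuous_on ({0..} \<times> UNIV) (\<lambda>(\<sigma>, x). \<rho> \<sigma> x) \<and>
      continuous_on ({0..} \<times> UNIV) (\<lambda>(\<sigma>, x). r \<sigma> x) \<and>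
      continuous_on ({0..} \<times> UNIV) (\<lambda>(\<sigma>, x). P \<sigma> x)"
    proof (rule exI[of _ \<rho>], rule exI[of _ r], rule exI[of _ P], intro conjI allI impI)
      fix \<sigma> x :: real assume s: "0 \<le> \<sigma>"
      show "\<rho> \<sigma> (x + L) = \<rho> \<sigma> x" "r \<sigma> (x + L) = r \<sigma> x" "P \<sigma> (x + L) = P \<sigma> x"
        by (simp_all add: \<rho>_def r_def P_def sper Jper)
    qed (use r_der P_der \<rho>_le r_le P_le smooth cont\<rho> contr contP in \<open>blast+\<close>)
  qed
qed

section \<open>Corrugation of the tantrix\<close>

text \<open>  In this section \<open>p\<close> is a velocity and \<open>q\<close> an acceleration of a curve in the same point. Then \<open>sgn p\<close> is the
  value of the tantrix, \<open>sgn_derivative p q\<close> its derivative (\<open>has_vector_derivative_sgn\<close>), and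
  \<open>jet_curvature p q\<close> and \<open>jet_normal p q\<close> are the curvature and the principal normal.\<close>

definition sgn_derivative :: "real ^ 'n \<Rightarrow> real ^ 'n \<Rightarrow> real ^ 'n" where
  "sgn_derivative p q = (q - (q \<bullet> sgn p) *\<^sub>R sgn p) /\<^sub>R norm p"

definition jet_curvature :: "real ^ 'n \<Rightarrow> real ^ 'n \<Rightarrow> real" where
  "jet_curvature p q = norm (sgn_derivative p q) / norm p"

definition jet_normal :: "real ^ 'n \<Rightarrow> real ^ 'n \<Rightarrow> real ^ 'n" where
  "jet_normal p q = sgn (sgn_derivative p q)"

text \<open>  The projection onto the orthogonal complement of tangent and principal normal.\<close>

definition binormal_part :: "real ^ 'n \<Rightarrow> real ^ 'n \<Rightarrow> real ^ 'n \<Rightarrow> real ^ 'n" where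
  "binormal_part p q y = y - (y \<bullet> sgn p) *\<^sub>R sgn p - (y \<bullet> jet_normal p q) *\<^sub>R jet_normal p q"

definition quadratic_form :: "real ^ 'n ^ 'n \<Rightarrow> real ^ 'n \<Rightarrow> real" where
  "quadratic_form P y = (\<Sum>i\<in>UNIV. \<Sum>j\<in>UNIV. P $ i $ j * (y $ i * y $ j))"

text \<open>  The trace of \<open>P\<close> compressed to the complement of tangent and principal normal, written as the full trace
  minus two diagonal entries.\<close>

definition binormal_trace :: "real ^ 'n \<Rightarrow> real ^ 'n \<Rightarrow> real ^ 'n ^ 'n \<Rightarrow> real" where
  "binormal_trace p q P = (\<Sum>i\<in>UNIV. P $ i $ i) - quadratic_form P (sgn p) - quadratic_form P (jet_normal p q)"

text \<open>  The oscillation of the length of the corrugated tantrix relative to the length of the curve; its derivative is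
  what the speed deviates from \<open>c\<close>.\<close>

definition length_ripple :: "real ^ 'n \<Rightarrow> real ^ 'n \<Rightarrow> real \<Rightarrow> real ^ 'n ^ 'n \<Rightarrow> real" where
  "length_ripple p q c P = (c - jet_curvature p q) / 2 * binormal_trace p q P"

text \<open>  The displacement of the tantrix when \<open>r\<close> and \<open>P\<close> are small functions, and the velocity added to that of
  the tantrix when \<open>r\<close> and \<open>P\<close> are replaced by their derivatives. The part along the principal normal
  makes the speed free of square roots.\<close>

definition displacement :: "real ^ 'n \<Rightarrow> real ^ 'n \<Rightarrow> real \<Rightarrow> real ^ 'n \<Rightarrow> real ^ 'n ^ 'n \<Rightarrow> real ^ 'n" where
  "displacement p q c r P = (norm p * sqrt (c\<^sup>2 - (jet_curvature p q)\<^sup>2)) *\<^sub>R binormal_part p q r - (norm p * length_ripple p q c P) *\<^sub>R jet_normal p q"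

lemma sgn_eq: "sgn (x::real ^ 'n) = x /\<^sub>R norm x" by (rule sgn_div_norm)

lemma inner_sgn_self: "x \<noteq> 0 \<Longrightarrow> sgn x \<bullet> sgn (x :: 'a::real_inner) = 1"
  by (simp add: power2_norm_eq_inner[symmetric] norm_sgn)

lemma sgn_derivative_orthogonal: "p \<noteq> 0 \<Longrightarrow> sgn_derivative p q \<bullet> sgn p = 0"
  by (simp add: sgn_derivative_def inner_diff_left inner_sgn_self)

lemma jet_normal_orthogonal: "p \<noteq> 0 \<Longrightarrow> jet_normal p q \<bullet> sgn p = 0"
  using sgn_derivative_orthogonal[of p q] by (simp add: jet_normal_def sgn_eq)

lemma norm_sgn_derivative: "p \<noteq> 0 \<Longrightarrow> norm (sgn_derivative p q) = norm p * jet_curvature p q"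
  by (simp add: jet_curvature_def)

lemma sgn_derivative_eq_jet_normal: "p \<noteq> 0 \<Longrightarrow> sgn_derivative p q = (norm p * jet_curvature p q) *\<^sub>R jet_normal p q"
  by (cases "sgn_derivative p q = 0") (simp_all add: jet_normal_def norm_sgn_derivative[symmetric] sgn_eq)

lemma jet_curvature_nonneg: "0 \<le> jet_curvature p q" by (simp add: jet_curvature_def)

lemma binormal_part_orthogonal:
  assumes "p \<noteq> 0" "sgn_derivative p q \<noteq> 0"
  shows "binormal_part p q y \<bullet> sgn p = 0" "binormal_part p q y \<bullet> jet_normal p q = 0"
  using assms jet_normal_orthogonal[OF assms(1), of q] inner_sgn_self[OF assms(1)] inner_sgn_self[OF assms(2)]
  by (simp_all add: binormal_part_def inner_diff_left jet_normal_def inner_commute[of "sgn p" "sgn (sgn_derivative p q)"])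

lemma norm_binormal_part:
  assumes "p \<noteq> 0" "sgn_derivative p q \<noteq> 0"
  shows "(norm (binormal_part p q y))\<^sup>2 = (norm y)\<^sup>2 - (y \<bullet> sgn p)\<^sup>2 - (y \<bullet> jet_normal p q)\<^sup>2"
proof -
  have "(norm (binormal_part p q y))\<^sup>2 = binormal_part p q y \<bullet> y"
    using binormal_part_orthogonal[OF assms, of y] unfolding power2_norm_eq_inner
    by (subst (2) binormal_part_def) (simp add: inner_diff_right)
  moreover have "binormal_part p q y \<bullet> y = (norm y)\<^sup>2 - (y \<bullet> sgn p)\<^sup>2 - (y \<bullet> jet_normal p q)\<^sup>2"
    unfolding binormal_part_def inner_diff_left power2_norm_eq_inner
    by (simp add: inner_commute[of "sgn p" y] inner_commute[of "jet_normal p q" y] power2_eq_square)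
  ultimately show ?thesis by simp
qed

lemma quadratic_form_isotropic_defect:
  "quadratic_form (isotropic_defect y) (z :: real ^ 'n) = (y \<bullet> z)\<^sup>2 - (norm z)\<^sup>2 / (real CARD('n) - 2)"
proof -
  have "quadratic_form (isotropic_defect y) z = (\<Sum>i\<in>UNIV. \<Sum>j\<in>UNIV. (y $ i * z $ i) * (y $ j * z $ j)) -
      (\<Sum>i\<in>UNIV. \<Sum>j\<in>UNIV. (if i = j then 1 / (real CARD('n) - 2) else 0) * (z $ i * z $ j))"
    unfolding quadratic_form_def isotropic_defect_def sum_subtractf[symmetric] vec_lambda_beta
    by (intro sum.cong refl) (simp add: algebra_simps)
  also have "(\<Sum>i\<in>UNIV. \<Sum>j\<in>UNIV. (y $ i * z $ i) * (y $ j * z $ j)) = (y \<bullet> z)\<^sup>2"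
    by (simp add: inner_vec_def power2_eq_square sum_product)
  also have "(\<Sum>i\<in>UNIV. \<Sum>j\<in>UNIV. (if i = j then 1 / (real CARD('n) - 2) else 0) * (z $ i * z $ j)) = (\<Sum>i\<in>UNIV. 1 / (real CARD('n) - 2) * (z $ i * z $ i))"
    by (simp add: if_distrib if_distribR cong: if_cong)
  also have "\<dots> = (norm z)\<^sup>2 / (real CARD('n) - 2)"
    by (simp add: power2_norm_eq_inner inner_vec_def sum_divide_distrib)
  finally show ?thesis .
qed

text \<open>  The \<open>n\<close> diagonal entries lose \<open>n / (n - 2)\<close> and two of these are taken back, so the total loss is \<open>1\<close>.\<close>

lemma binormal_trace_isotropic_defect:
  fixes p q :: "real ^ 'n"
  assumes "p \<noteq> 0" "sgn_derivative p q \<noteq> 0" "3 \<le> CARD('n)"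
  shows "binormal_trace p q (isotropic_defect y) = (norm (binormal_part p q y))\<^sup>2 - 1"
proof -
  have n: "real CARD('n) - 2 > 0" using assms(3) by simp
  have "(\<Sum>i\<in>UNIV. isotropic_defect y $ i $ i) = (norm y)\<^sup>2 - real CARD('n) / (real CARD('n) - 2)"
    by (simp add: isotropic_defect_def sum_subtractf power2_norm_eq_inner inner_vec_def)
  then have "binormal_trace p q (isotropic_defect y) = (norm (binormal_part p q y))\<^sup>2 - (real CARD('n) / (real CARD('n) - 2) - 1 / (real CARD('n) - 2) - 1 / (real CARD('n) - 2))"
    using assms(1,2) by (simp add: binormal_trace_def quadratic_form_isotropic_defect norm_binormal_part norm_sgn jet_normal_def)
  also have "real CARD('n) / (real CARD('n) - 2) - 1 / (real CARD('n) - 2) - 1 / (real CARD('n) - 2) = 1"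
    using n unfolding diff_divide_distrib[symmetric] by simp
  finally show ?thesis .
qed

text \<open>  With \<open>h = (c - \<kappa>) (s - 1) / 2\<close> one has
  \<open>(c + h)\<^sup>2 - (\<kappa> - h)\<^sup>2 = (c + \<kappa>) (c - \<kappa> + 2 h) = (c\<^sup>2 - \<kappa>\<^sup>2) s\<close>, to be used for the square \<open>s\<close> of the norm of the
  projected oscillation. As \<open>s \<ge> 0\<close>, the speed is at least half of its mean, so the corrugated tantrix is
  immersed.\<close>

lemma norm_leading_velocity:
  fixes p q :: "real ^ 'n"
  assumes "p \<noteq> 0" "sgn_derivative p q \<noteq> 0" "3 \<le> CARD('n)" "jet_curvature p q < c"
  shows "norm (sgn_derivative p q + displacement p q c y (isotropic_defect y)) = norm p * (c + length_ripple p q c (isotropic_defect y))"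
    and "norm p * c / 2 \<le> norm (sgn_derivative p q + displacement p q c y (isotropic_defect y))"
proof -
  let ?k = "jet_curvature p q" and ?t = "binormal_trace p q (isotropic_defect y)" and ?R = "binormal_part p q y"
  have t: "?t = (norm ?R)\<^sup>2 - 1" by (rule binormal_trace_isotropic_defect[OF assms(1-3)])
  have k: "0 \<le> ?k" by (rule jet_curvature_nonneg)
  have ck: "0 \<le> c\<^sup>2 - ?k\<^sup>2" using assms(4) k by (simp add: power_mono)
  have eq: "sgn_derivative p q + displacement p q c y (isotropic_defect y) =
      norm p *\<^sub>R (sqrt (c\<^sup>2 - ?k\<^sup>2) *\<^sub>R ?R + (?k - (c - ?k) / 2 * ?t) *\<^sub>R jet_normal p q)"
    unfolding displacement_def sgn_derivative_eq_jet_normal[OF assms(1)] length_ripple_def by (simp add: algebra_simps)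
  have nn: "jet_normal p q \<bullet> jet_normal p q = 1" using assms(2) by (simp add: jet_normal_def inner_sgn_self)
  have "(norm (sqrt (c\<^sup>2 - ?k\<^sup>2) *\<^sub>R ?R + (?k - (c - ?k) / 2 * ?t) *\<^sub>R jet_normal p q))\<^sup>2 =
      (c\<^sup>2 - ?k\<^sup>2) * (norm ?R)\<^sup>2 + (?k - (c - ?k) / 2 * ?t)\<^sup>2"
    unfolding power2_norm_eq_inner inner_add_left inner_add_right inner_scaleR_left inner_scaleR_right
    using binormal_part_orthogonal(2)[OF assms(1,2), of y] nn ck
    by (simp add: inner_commute power2_eq_square mult.assoc[symmetric])
  also have "\<dots> = (c + (c - ?k) / 2 * ?t)\<^sup>2"
    unfolding t by (simp add: power2_eq_square field_simps)
  finally have sq: "(norm (sqrt (c\<^sup>2 - ?k\<^sup>2) *\<^sub>R ?R + (?k - (c - ?k) / 2 * ?t) *\<^sub>R jet_normal p q))\<^sup>2 = (c + (c - ?k) / 2 * ?t)\<^sup>2" .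
  have "(c - ?k) / 2 * (-1) \<le> (c - ?k) / 2 * ?t" using assms(4) t by (intro mult_left_mono) auto
  then have ge: "c / 2 \<le> c + (c - ?k) / 2 * ?t" using k assms(4) by (simp add: field_simps)
  moreover have "0 < c" using k assms(4) by linarith
  ultimately have "norm (sqrt (c\<^sup>2 - ?k\<^sup>2) *\<^sub>R ?R + (?k - (c - ?k) / 2 * ?t) *\<^sub>R jet_normal p q) = c + (c - ?k) / 2 * ?t"
    by (intro power2_eq_imp_eq[OF sq]) simp_all
  then show 1: "norm (sgn_derivative p q + displacement p q c y (isotropic_defect y)) = norm p * (c + length_ripple p q c (isotropic_defect y))"
    unfolding eq by (simp add: length_ripple_def)
  show "norm p * c / 2 \<le> norm (sgn_derivative p q + displacement p q c y (isotropic_defect y))"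
    unfolding 1 length_ripple_def using mult_left_mono[OF ge, of "norm p"] by simp
qed

text \<open>  The bound tends to zero as \<open>c\<close> tends to the curvature, uniformly in bounded oscillations \<open>y\<close>. At the end times this
  makes the corrugated tantrices converge together with their derivatives.\<close>

lemma norm_displacement_le:
  fixes p q :: "real ^ 'n"
  assumes "p \<noteq> 0" "sgn_derivative p q \<noteq> 0" "3 \<le> CARD('n)" "jet_curvature p q < c"
  shows "norm (displacement p q c y (isotropic_defect y)) \<le>
    norm p * (sqrt (c\<^sup>2 - (jet_curvature p q)\<^sup>2) * norm y + (c - jet_curvature p q) / 2 * ((norm y)\<^sup>2 + 1))"
proof -
  have le: "(norm (binormal_part p q y))\<^sup>2 \<le> (norm y)\<^sup>2" unfolding norm_binormal_part[OF assms(1,2)] by simp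
  then have le': "norm (binormal_part p q y) \<le> norm y" by (rule power2_le_imp_le) simp
  have "\<bar>binormal_trace p q (isotropic_defect y)\<bar> \<le> (norm y)\<^sup>2 + 1"
    unfolding binormal_trace_isotropic_defect[OF assms(1-3)] using le zero_le_power2[of "norm (binormal_part p q y)"] by linarith
  then have "\<bar>length_ripple p q c (isotropic_defect y)\<bar> \<le> (c - jet_curvature p q) / 2 * ((norm y)\<^sup>2 + 1)"
    unfolding length_ripple_def abs_mult using assms(4) by (intro mult_mono) auto
  moreover have "norm (jet_normal p q) = 1" using assms(2) by (simp add: jet_normal_def norm_sgn)
  moreover have "norm (displacement p q c y (isotropic_defect y)) \<le>
      norm p * sqrt (c\<^sup>2 - (jet_curvature p q)\<^sup>2) * norm (binormal_part p q y) + norm p * \<bar>length_ripple p q c (isotropic_defect y)\<bar> * norm (jet_normal p q)"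
    unfolding displacement_def
    by (rule order_trans[OF norm_triangle_ineq4]) (use assms(4) jet_curvature_nonneg[of p q] in \<open>simp add: abs_mult power_mono\<close>)
  moreover have "norm p * sqrt (c\<^sup>2 - (jet_curvature p q)\<^sup>2) * norm (binormal_part p q y) \<le> norm p * sqrt (c\<^sup>2 - (jet_curvature p q)\<^sup>2) * norm y"
    using le' assms(4) jet_curvature_nonneg[of p q] by (intro mult_left_mono) (auto simp: power_mono)
  ultimately show ?thesis
    using mult_left_mono[of "\<bar>length_ripple p q c (isotropic_defect y)\<bar>" "(c - jet_curvature p q) / 2 * ((norm y)\<^sup>2 + 1)" "norm p"]
    by (simp add: distrib_left mult.assoc)
qed

lemma displacement_orthogonal: "p \<noteq> 0 \<Longrightarrow> sgn_derivative p q \<noteq> 0 \<Longrightarrow> displacement p q c r P \<bullet> sgn p = 0"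
  using binormal_part_orthogonal[of p q r] jet_normal_orthogonal[of p q] by (simp add: displacement_def inner_diff_left)

lemma displacement_0 [simp]: "displacement p q c 0 0 = 0" and length_ripple_0 [simp]: "length_ripple p q c 0 = 0"
  by (simp_all add: displacement_def binormal_part_def length_ripple_def binormal_trace_def quadratic_form_def)

lemma quadratic_form_scaleR: "quadratic_form (h *\<^sub>R P) y = h * quadratic_form P y"
  by (simp add: quadratic_form_def sum_distrib_left mult.assoc)

lemma length_ripple_scaleR: "length_ripple p q c (h *\<^sub>R P) = h * length_ripple p q c P"
  by (simp add: length_ripple_def binormal_trace_def quadratic_form_scaleR sum_distrib_left[symmetric] right_diff_distrib[symmetric])

lemma displacement_scaleR: "displacement p q c (h *\<^sub>R r) (h *\<^sub>R P) = h *\<^sub>R displacement p q c r P"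
  by (simp add: displacement_def length_ripple_scaleR binormal_part_def scaleR_diff_right mult_ac)

lemma cdiff_sgn:
  fixes f :: "'a::real_normed_vector \<Rightarrow> 'b::real_inner"
  assumes "cdiff k S f" "\<And>x. x \<in> S \<Longrightarrow> f x \<noteq> 0" shows "cdiff k S (\<lambda>x. sgn (f x))"
  unfolding sgn_div_norm by (intro cdiff_scaleR cdiff_inverse cdiff_norm assms) (use assms(2) in auto)

lemma cdiff_sgn_derivative:
  fixes f g :: "'a::real_normed_vector \<Rightarrow> real ^ 'n"
  assumes "cdiff k S f" "cdiff k S g" "\<And>x. x \<in> S \<Longrightarrow> f x \<noteq> 0"
  shows "cdiff k S (\<lambda>x. sgn_derivative (f x) (g x))"
  unfolding sgn_derivative_def by (intro cdiff_scaleR cdiff_inverse cdiff_norm cdiff_diff cdiff_inner cdiff_sgn assms) (use assms(3) in auto)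

lemma cdiff_jet_curvature:
  fixes f g :: "'a::real_normed_vector \<Rightarrow> real ^ 'n"
  assumes "cdiff k S f" "cdiff k S g" "\<And>x. x \<in> S \<Longrightarrow> f x \<noteq> 0" "\<And>x. x \<in> S \<Longrightarrow> sgn_derivative (f x) (g x) \<noteq> 0"
  shows "cdiff k S (\<lambda>x. jet_curvature (f x) (g x))"
  unfolding jet_curvature_def by (intro cdiff_divide cdiff_norm cdiff_sgn_derivative assms) (use assms(3) in auto)

lemma cdiff_jet_normal:
  fixes f g :: "'a::real_normed_vector \<Rightarrow> real ^ 'n"
  assumes "cdiff k S f" "cdiff k S g" "\<And>x. x \<in> S \<Longrightarrow> f x \<noteq> 0" "\<And>x. x \<in> S \<Longrightarrow> sgn_derivative (f x) (g x) \<noteq> 0"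
  shows "cdiff k S (\<lambda>x. jet_normal (f x) (g x))"
  unfolding jet_normal_def by (intro cdiff_sgn cdiff_sgn_derivative assms)

lemma cdiff_quadratic_form:
  fixes P :: "'a::real_normed_vector \<Rightarrow> real ^ 'n ^ 'n"
  shows "cdiff k S P \<Longrightarrow> cdiff k S f \<Longrightarrow> cdiff k S (\<lambda>x. quadratic_form (P x) (f x))"
  unfolding quadratic_form_def by (intro cdiff_sum cdiff_mult cdiff_vec_nth)

lemma cdiff_length_ripple:
  fixes f g :: "'a::real_normed_vector \<Rightarrow> real ^ 'n"
  assumes "cdiff k S f" "cdiff k S g" "\<And>x. x \<in> S \<Longrightarrow> f x \<noteq> 0" "\<And>x. x \<in> S \<Longrightarrow> sgn_derivative (f x) (g x) \<noteq> 0"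
    and "cdiff k S c" "cdiff k S P"
  shows "cdiff k S (\<lambda>x. length_ripple (f x) (g x) (c x) (P x))"
  unfolding length_ripple_def binormal_trace_def
  by (intro cdiff_mult cdiff_divide cdiff_diff cdiff_sum cdiff_vec_nth cdiff_quadratic_form cdiff_jet_curvature cdiff_jet_normal cdiff_sgn cdiff_const assms) auto

lemma cdiff_displacement:
  fixes f g r :: "'a::real_normed_vector \<Rightarrow> real ^ 'n"
  assumes "cdiff k S f" "cdiff k S g" "\<And>x. x \<in> S \<Longrightarrow> f x \<noteq> 0" "\<And>x. x \<in> S \<Longrightarrow> sgn_derivative (f x) (g x) \<noteq> 0"
    and "cdiff k S c" "cdiff k S r" "cdiff k S P" "\<And>x. x \<in> S \<Longrightarrow> jet_curvature (f x) (g x) < c x"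
  shows "cdiff k S (\<lambda>x. displacement (f x) (g x) (c x) (r x) (P x))"
proof -
  have pos: "0 < (c x)\<^sup>2 - (jet_curvature (f x) (g x))\<^sup>2" if "x \<in> S" for x
    using power_strict_mono[OF assms(8)[OF that] jet_curvature_nonneg, of 2] by simp
  show ?thesis
    unfolding displacement_def binormal_part_def power2_eq_square
    by (intro cdiff_diff cdiff_scaleR cdiff_mult cdiff_norm cdiff_sqrt cdiff_inner cdiff_sgn cdiff_jet_curvature cdiff_jet_normal cdiff_length_ripple assms pos[unfolded power2_eq_square])
qed

text \<open>  The values \<open>(p, q, c, r, P)\<close> that determine the corrugated tantrix in a point. Treating it
  as a map on a finite-dimensional space makes all errors uniform on compact sets of values: they vanish for
  \<open>r = 0\<close>, \<open>P = 0\<close> and are continuous. The set \<open>immersed_slots\<close> consists of the pairs of such values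
  and their velocities along the curve for which the corrugated tantrix is immersed.\<close>

type_synonym 'n slot = "(real ^ 'n) \<times> (real ^ 'n) \<times> real \<times> (real ^ 'n) \<times> (real ^ 'n ^ 'n)"

definition corrugated_point :: "'n::finite slot \<Rightarrow> real ^ 'n" where
  "corrugated_point = (\<lambda>(p, q, c, r, P). sgn p + displacement p q c r P)"

definition regular_slots :: "'n::finite slot set" where
  "regular_slots = {(p, q, c, r, P). p \<noteq> 0 \<and> sgn_derivative p q \<noteq> 0 \<and> jet_curvature p q < c}"

definition nonzero_slots :: "'n::finite slot set" where
  "nonzero_slots = {z \<in> regular_slots. corrugated_point z \<noteq> 0}"

definition corrugated_tantrix :: "'n::finite slot \<Rightarrow> real ^ 'n" where
  "corrugated_tantrix z = sgn (corrugated_point z)"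

definition corrugated_tantrix_velocity :: "'n::finite slot \<Rightarrow> 'n slot \<Rightarrow> real ^ 'n" where
  "corrugated_tantrix_velocity z = frechet_derivative corrugated_tantrix (at z)"

text \<open>  The small function whose derivative is the oscillating part of the centroid density.\<close>

definition centroid_drift :: "'n::finite slot \<Rightarrow> real ^ 'n" where
  "centroid_drift = (\<lambda>(p, q, c, r, P). length_ripple p q c P *\<^sub>R p)"

definition length_drift :: "'n::finite slot \<Rightarrow> real" where
  "length_drift = (\<lambda>(p, q, c, r, P). length_ripple p q c P * norm p)"

definition centroid_drift_velocity :: "'n::finite slot \<Rightarrow> 'n slot \<Rightarrow> real ^ 'n" where
  "centroid_drift_velocity z = frechet_derivative centroid_drift (at z)"

definition length_drift_velocity :: "'n::finite slot \<Rightarrow> 'n slot \<Rightarrow> real" where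
  "length_drift_velocity z = frechet_derivative length_drift (at z)"

definition immersed_slots :: "('n::finite slot \<times> 'n slot) set" where
  "immersed_slots = {(z, z'). z \<in> nonzero_slots \<and> corrugated_tantrix_velocity z z' \<noteq> 0}"

text \<open>  The integrand \<open>\<bar>\<Theta>'\<bar> \<Theta>\<close> of the centroid of the corrugated tantrix, without its oscillating part. The latter integrates
  to zero around a circle. Similarly, \<open>length_density\<close> is the speed without its oscillating part.\<close>

definition centroid_density :: "'n::finite slot \<times> 'n slot \<Rightarrow> real ^ 'n" where
  "centroid_density = (\<lambda>(z, z'). norm (corrugated_tantrix_velocity z z') *\<^sub>R corrugated_tantrix z - centroid_drift_velocity z z')"

definition length_density :: "'n::finite slot \<times> 'n slot \<Rightarrow> real" where
  "length_density = (\<lambda>(z, z'). norm (corrugated_tantrix_velocity z z') - length_drift_velocity z z')"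

lemma cdiff_corrugated_point: "cdiff k regular_slots (corrugated_point :: 'n::finite slot \<Rightarrow> _)"
  unfolding corrugated_point_def case_prod_unfold
  by (intro cdiff_add cdiff_sgn cdiff_displacement cdiff_fst cdiff_snd cdiff_ident) (auto simp: regular_slots_def)

lemma cdiff_corrugated_tantrix: "cdiff k nonzero_slots (corrugated_tantrix :: 'n::finite slot \<Rightarrow> _)"
  unfolding corrugated_tantrix_def by (intro cdiff_sgn cdiff_subset[OF cdiff_corrugated_point]) (auto simp: nonzero_slots_def)

lemma cdiff_centroid_drift: "cdiff k regular_slots (centroid_drift :: 'n::finite slot \<Rightarrow> _)"
  unfolding centroid_drift_def case_prod_unfold
  by (intro cdiff_scaleR cdiff_length_ripple cdiff_fst cdiff_snd cdiff_ident) (auto simp: regular_slots_def)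

lemma cdiff_length_drift: "cdiff k regular_slots (length_drift :: 'n::finite slot \<Rightarrow> _)"
  unfolding length_drift_def case_prod_unfold
  by (intro cdiff_mult cdiff_norm cdiff_length_ripple cdiff_fst cdiff_snd cdiff_ident) (auto simp: regular_slots_def)

lemma open_regular_slots: "open (regular_slots :: 'n::finite slot set)"
proof -
  define A where "A = {z :: 'n slot. fst z \<noteq> 0}"
  define B where "B = {z \<in> A. sgn_derivative (fst z) (fst (snd z)) \<noteq> 0}"
  have A: "open A" unfolding A_def by (intro open_Collect_neq continuous_intros)
  have "continuous_on A (\<lambda>z. sgn_derivative (fst z) (fst (snd z)))"
    by (rule cdiff_continuous_on[where k=0], intro cdiff_sgn_derivative cdiff_fst cdiff_snd cdiff_ident) (auto simp: A_def)
  from continuous_open_preimage[OF this A, of "- {0}"] have "open (A \<inter> (\<lambda>z. sgn_derivative (fst z) (fst (snd z))) -` (- {0}))"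
    by (simp add: open_Compl)
  moreover have "A \<inter> (\<lambda>z. sgn_derivative (fst z) (fst (snd z))) -` (- {0}) = B" by (auto simp: B_def)
  ultimately have B: "open B" by simp
  have "continuous_on B (\<lambda>z. fst (snd (snd z)) - jet_curvature (fst z) (fst (snd z)))"
    by (rule cdiff_continuous_on[where k=0], intro cdiff_diff cdiff_jet_curvature cdiff_fst cdiff_snd cdiff_ident) (auto simp: A_def B_def)
  from continuous_open_preimage[OF this B, of "{0<..}"]
  have "open (B \<inter> (\<lambda>z. fst (snd (snd z)) - jet_curvature (fst z) (fst (snd z))) -` {0<..})" by simp
  moreover have "B \<inter> (\<lambda>z. fst (snd (snd z)) - jet_curvature (fst z) (fst (snd z))) -` {0<..} = regular_slots"
    by (auto simp: A_def B_def regular_slots_def)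
  ultimately show ?thesis by simp
qed

lemma open_nonzero_slots: "open (nonzero_slots :: 'n::finite slot set)"
proof -
  have "open (regular_slots \<inter> corrugated_point -` (- {0} :: (real ^ 'n) set))"
    by (rule continuous_open_preimage[OF cdiff_continuous_on[OF cdiff_corrugated_point[of 0]] open_regular_slots]) (simp add: open_Compl)
  moreover have "regular_slots \<inter> corrugated_point -` (- {0} :: (real ^ 'n) set) = nonzero_slots" by (auto simp: nonzero_slots_def)
  ultimately show ?thesis by simp
qed

lemma nonzero_slots_subset: "nonzero_slots \<subseteq> regular_slots" by (auto simp: nonzero_slots_def)

lemma cdiff_frechet_apply:
  fixes F :: "'a::euclidean_space \<Rightarrow> 'b::real_normed_vector"
  assumes "cdiff (Suc k) S F" "open S"
  shows "cdiff k (S \<times> UNIV) (\<lambda>(z, v). frechet_derivative F (at z) v)"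
proof -
  have "cdiff k (S \<times> UNIV) (\<lambda>w :: 'a \<times> 'a. \<Sum>b\<in>Basis. (snd w \<bullet> b) *\<^sub>R frechet_derivative F (at (fst w)) b)"
    by (intro cdiff_sum cdiff_scaleR cdiff_inner cdiff_snd cdiff_ident cdiff_const
        cdiff_compose[OF cdiff_frechet(2)[OF assms] cdiff_fst[OF cdiff_ident]]) auto
  moreover have "frechet_derivative F (at z) v = (\<Sum>b\<in>Basis. (v \<bullet> b) *\<^sub>R frechet_derivative F (at z) b)" if "z \<in> S" for z v
  proof -
    have l: "linear (frechet_derivative F (at z))"
      using cdiff_frechet(1)[OF assms that] by (rule has_derivative_linear)
    have "frechet_derivative F (at z) v = frechet_derivative F (at z) (\<Sum>b\<in>Basis. (v \<bullet> b) *\<^sub>R b)" by (simp add: euclidean_representation)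
    then show ?thesis by (simp add: linear_sum[OF l] linear_cmul[OF l])
  qed
  ultimately show ?thesis
    by (elim iffD1[OF cdiff_cong, rotated]) auto
qed

lemma cdiff_corrugated_tantrix_velocity: "cdiff k (nonzero_slots \<times> UNIV) (\<lambda>(z, v). corrugated_tantrix_velocity z v :: real ^ 'n::finite)"
  unfolding corrugated_tantrix_velocity_def by (rule cdiff_frechet_apply[OF cdiff_corrugated_tantrix open_nonzero_slots])

lemma open_immersed_slots: "open (immersed_slots :: ('n::finite slot \<times> 'n slot) set)"
proof -
  have "open (nonzero_slots \<times> (UNIV :: 'n slot set))" by (intro open_Times open_nonzero_slots open_UNIV)
  from continuous_open_preimage[OF cdiff_continuous_on[OF cdiff_corrugated_tantrix_velocity[of 0]] this, of "- {0}"]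
  have "open ((nonzero_slots \<times> UNIV) \<inter> (\<lambda>(z, v). corrugated_tantrix_velocity z v :: real ^ 'n) -` (- {0}))" by (simp add: open_Compl)
  moreover have "(nonzero_slots \<times> UNIV) \<inter> (\<lambda>(z, v). corrugated_tantrix_velocity z v :: real ^ 'n) -` (- {0}) = immersed_slots" by (auto simp: immersed_slots_def)
  ultimately show ?thesis by simp
qed

lemma immersed_slots_subset: "immersed_slots \<subseteq> nonzero_slots \<times> UNIV" by (auto simp: immersed_slots_def)

lemma cdiff_speed: "cdiff k immersed_slots (\<lambda>(z, z'). norm (corrugated_tantrix_velocity z z' :: real ^ 'n::finite))"
proof -
  have "cdiff k immersed_slots (\<lambda>w. corrugated_tantrix_velocity (fst w) (snd w) :: real ^ 'n)"
    using cdiff_subset[OF cdiff_corrugated_tantrix_velocity immersed_slots_subset] by (simp add: case_prod_unfold)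
  then show ?thesis unfolding case_prod_unfold by (rule cdiff_norm) (auto simp: immersed_slots_def)
qed

lemma cdiff_on_immersed_slots:
  fixes F :: "'n::finite slot \<Rightarrow> 'b::real_normed_vector"
  shows "cdiff k nonzero_slots F \<Longrightarrow> cdiff k immersed_slots (\<lambda>w. F (fst w))"
  by (rule cdiff_compose[OF _ cdiff_fst[OF cdiff_ident]]) (auto simp: immersed_slots_def)

lemma cdiff_centroid_density: "cdiff k immersed_slots (centroid_density :: 'n::finite slot \<times> 'n slot \<Rightarrow> _)"
proof -
  have "cdiff k (regular_slots \<times> UNIV) (\<lambda>(z, v). centroid_drift_velocity z v :: real ^ 'n)"
    unfolding centroid_drift_velocity_def by (rule cdiff_frechet_apply[OF cdiff_centroid_drift open_regular_slots])
  then have "cdiff k immersed_slots (\<lambda>(z, v). centroid_drift_velocity z v :: real ^ 'n)"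
    by (rule cdiff_subset) (use nonzero_slots_subset in \<open>auto simp: immersed_slots_def\<close>)
  then show ?thesis
    unfolding centroid_density_def case_prod_unfold
    by (intro cdiff_diff cdiff_scaleR cdiff_on_immersed_slots[OF cdiff_corrugated_tantrix] cdiff_speed[unfolded case_prod_unfold])
qed

lemma cdiff_length_density: "cdiff k immersed_slots (length_density :: 'n::finite slot \<times> 'n slot \<Rightarrow> _)"
proof -
  have "cdiff k (regular_slots \<times> UNIV) (\<lambda>(z, v). length_drift_velocity z v :: real)"
    unfolding length_drift_velocity_def by (rule cdiff_frechet_apply[OF cdiff_length_drift open_regular_slots])
  then have "cdiff k immersed_slots (\<lambda>(z :: 'n slot, v). length_drift_velocity z v :: real)"
    by (rule cdiff_subset) (use nonzero_slots_subset in \<open>auto simp: immersed_slots_def\<close>)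
  then show ?thesis
    unfolding length_density_def case_prod_unfold
    by (intro cdiff_diff cdiff_speed[unfolded case_prod_unfold])
qed

lemma has_vector_derivative_sgn:
  fixes f :: "real \<Rightarrow> real ^ 'n"
  assumes "(f has_vector_derivative v) (at x within S)" "f x \<noteq> 0"
  shows "((\<lambda>x. sgn (f x)) has_vector_derivative sgn_derivative (f x) v) (at x within S)"
proof -
  have "((\<lambda>y. norm (f y)) has_derivative (\<lambda>h. (h *\<^sub>R v) \<bullet> sgn (f x))) (at x within S)"
    using has_derivative_compose[OF assms(1)[unfolded has_vector_derivative_def] has_derivative_norm[OF assms(2)]] .
  then have n: "((\<lambda>y. norm (f y)) has_real_derivative v \<bullet> sgn (f x)) (at x within S)"
    unfolding has_field_derivative_def by (rule has_derivative_eq_rhs) (auto simp: fun_eq_iff)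
  have "((\<lambda>y. inverse (norm (f y))) has_real_derivative - (inverse (norm (f x)) * (v \<bullet> sgn (f x)) * inverse (norm (f x)))) (at x within S)"
    by (rule DERIV_inverse'[OF n]) (use assms(2) in simp)
  from has_vector_derivative_scaleR[OF this assms(1)]
  have "((\<lambda>x. sgn (f x)) has_vector_derivative
      inverse (norm (f x)) *\<^sub>R v + (- (inverse (norm (f x)) * (v \<bullet> sgn (f x)) * inverse (norm (f x)))) *\<^sub>R f x) (at x within S)"
    by (simp add: sgn_div_norm)
  moreover have "inverse (norm (f x)) *\<^sub>R v + (- (inverse (norm (f x)) * (v \<bullet> sgn (f x)) * inverse (norm (f x)))) *\<^sub>R f x = sgn_derivative (f x) v"
    by (simp add: sgn_derivative_def sgn_div_norm[of "f x"] scaleR_diff_right mult_ac)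
  ultimately show ?thesis by simp
qed

lemma frechet_along_line:
  fixes F :: "'a::real_normed_vector \<Rightarrow> 'b::real_normed_vector"
  assumes "(F has_derivative D) (at z)" "((\<lambda>h. F (z + h *\<^sub>R v)) has_vector_derivative d) (at 0)"
  shows "D v = d"
proof -
  have "((\<lambda>h. z + h *\<^sub>R v) has_derivative (\<lambda>h. h *\<^sub>R v)) (at 0)" by (auto intro!: derivative_eq_intros)
  from has_derivative_compose[OF this, of F D] assms(1)
  have "((\<lambda>h. F (z + h *\<^sub>R v)) has_derivative (\<lambda>h. D (h *\<^sub>R v))) (at 0)" by simp
  then have "((\<lambda>h. F (z + h *\<^sub>R v)) has_vector_derivative D v) (at 0)"
    unfolding has_vector_derivative_def
    using linear_cmul[OF has_derivative_linear[OF assms(1)]] by simp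
  from vector_derivative_unique_at[OF this assms(2)] show ?thesis .
qed

lemma base_in_nonzero_slots:
  assumes "p \<noteq> 0" "sgn_derivative p q \<noteq> 0" "jet_curvature p q < c" shows "(p, q, c, 0, 0) \<in> nonzero_slots"
  using assms by (simp add: nonzero_slots_def regular_slots_def corrugated_point_def sgn_zero_iff)

lemma sgn_sgn_vec: "sgn (sgn x) = sgn (x :: 'a::real_inner)"
  by (cases "x = 0") (simp_all add: sgn_div_norm[of "sgn x"] norm_sgn)

lemma corrugated_tantrix_base [simp]: "corrugated_tantrix (p, q, c, 0, 0) = sgn p"
  by (simp add: corrugated_tantrix_def corrugated_point_def sgn_sgn_vec)

text \<open>  Values with \<open>r = 0\<close> and \<open>P = 0\<close> belong to infinite frequency. There the derivative splits into the one along
  the given curve and the one in the direction of the oscillation.\<close>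

lemma derivative_at_base:
  fixes F :: "'n::finite slot \<Rightarrow> 'b::real_normed_vector"
  assumes z: "p \<noteq> 0" "sgn_derivative p q \<noteq> 0" "jet_curvature p q < c" and F: "cdiff 1 nonzero_slots F"
    and d1: "((\<lambda>h. F (p + h *\<^sub>R q, q + h *\<^sub>R s, c, 0, 0)) has_vector_derivative d1) (at 0)"
    and d2: "((\<lambda>h. F (p, q, c, h *\<^sub>R \<rho>, h *\<^sub>R Q)) has_vector_derivative d2) (at 0)"
  shows "frechet_derivative F (at (p, q, c, 0, 0)) (q, s, 0, \<rho>, Q) = d1 + d2"
proof -
  have D: "(F has_derivative frechet_derivative F (at (p, q, c, 0, 0))) (at (p, q, c, 0, 0))"
    using cdiff_frechet(1)[OF F[unfolded One_nat_def] open_nonzero_slots base_in_nonzero_slots[OF z]] .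
  have "frechet_derivative F (at (p, q, c, 0, 0)) (q, s, 0, 0, 0) = d1"
    by (rule frechet_along_line[OF D]) (use d1 in simp)
  moreover have "frechet_derivative F (at (p, q, c, 0, 0)) (0, 0, 0, \<rho>, Q) = d2"
    by (rule frechet_along_line[OF D]) (use d2 in simp)
  ultimately show ?thesis
    using linear_add[OF has_derivative_linear[OF D], of "(q, s, 0, 0, 0)" "(0, 0, 0, \<rho>, Q)"] by simp
qed

lemma corrugated_tantrix_velocity_base:
  fixes p q :: "real ^ 'n::finite"
  assumes z: "p \<noteq> 0" "sgn_derivative p q \<noteq> 0" "jet_curvature p q < c"
  shows "corrugated_tantrix_velocity (p, q, c, 0, 0) (q, s, 0, \<rho>, Q) = sgn_derivative p q + displacement p q c \<rho> Q"
  unfolding corrugated_tantrix_velocity_def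
proof (rule derivative_at_base[OF z cdiff_corrugated_tantrix])
  have "((\<lambda>h. p + h *\<^sub>R q) has_vector_derivative q) (at 0)" by (auto intro!: derivative_eq_intros)
  from has_vector_derivative_sgn[OF this] z(1)
  show "((\<lambda>h. corrugated_tantrix (p + h *\<^sub>R q, q + h *\<^sub>R s, c, 0, 0)) has_vector_derivative sgn_derivative p q) (at 0)" by simp
  let ?V = "displacement p q c \<rho> Q"
  have "((\<lambda>h. sgn p + h *\<^sub>R ?V) has_vector_derivative ?V) (at 0)" by (auto intro!: derivative_eq_intros)
  from has_vector_derivative_sgn[OF this] z(1)
  have "((\<lambda>h. sgn (sgn p + h *\<^sub>R ?V)) has_vector_derivative sgn_derivative (sgn p) ?V) (at 0)" by (simp add: sgn_zero_iff)
  moreover have "sgn_derivative (sgn p) ?V = ?V"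
    using displacement_orthogonal[OF z(1,2), of c \<rho> Q] z(1) by (simp add: sgn_derivative_def sgn_sgn_vec norm_sgn)
  ultimately show "((\<lambda>h. corrugated_tantrix (p, q, c, h *\<^sub>R \<rho>, h *\<^sub>R Q)) has_vector_derivative ?V) (at 0)"
    by (simp add: corrugated_tantrix_def corrugated_point_def displacement_scaleR)
qed

lemma centroid_drift_velocity_base:
  fixes p q :: "real ^ 'n::finite"
  assumes z: "p \<noteq> 0" "sgn_derivative p q \<noteq> 0" "jet_curvature p q < c"
  shows "centroid_drift_velocity (p, q, c, 0, 0) (q, s, 0, \<rho>, Q) = length_ripple p q c Q *\<^sub>R p"
proof -
  have "centroid_drift_velocity (p, q, c, 0, 0) (q, s, 0, \<rho>, Q) = 0 + length_ripple p q c Q *\<^sub>R p"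
    unfolding centroid_drift_velocity_def
    by (rule derivative_at_base[OF z cdiff_subset[OF cdiff_centroid_drift nonzero_slots_subset]])
      (auto simp: centroid_drift_def length_ripple_scaleR intro!: derivative_eq_intros)
  then show ?thesis by simp
qed

lemma length_drift_velocity_base:
  fixes p q :: "real ^ 'n::finite"
  assumes z: "p \<noteq> 0" "sgn_derivative p q \<noteq> 0" "jet_curvature p q < c"
  shows "length_drift_velocity (p, q, c, 0, 0) (q, s, 0, \<rho>, Q) = length_ripple p q c Q * norm p"
proof -
  have "((\<lambda>h. h * length_ripple p q c Q * norm p) has_vector_derivative length_ripple p q c Q * norm p) (at 0)"
    by (auto simp: has_real_derivative_iff_has_vector_derivative[symmetric] intro!: derivative_eq_intros)
  then have "length_drift_velocity (p, q, c, 0, 0) (q, s, 0, \<rho>, Q) = 0 + length_ripple p q c Q * norm p"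
    unfolding length_drift_velocity_def
    by (intro derivative_at_base[OF z cdiff_subset[OF cdiff_length_drift nonzero_slots_subset]])
      (auto simp: length_drift_def length_ripple_scaleR)
  then show ?thesis by simp
qed

text \<open>  The velocity of the values \<open>(p, q, c, r, P)\<close> along a curve, where \<open>p' = q\<close>, \<open>q' = s\<close>, \<open>r' = \<rho>\<close> and \<open>P'\<close> is
  the isotropic defect of \<open>\<rho>\<close>.\<close>

definition velocity :: "real ^ 'n \<Rightarrow> real ^ 'n \<Rightarrow> real ^ 'n \<Rightarrow> 'n::finite slot" where
  "velocity q s \<rho> = (q, s, 0, \<rho>, isotropic_defect \<rho>)"

lemma base_in_immersed_slots:
  fixes p q :: "real ^ 'n::finite"
  assumes z: "p \<noteq> 0" "sgn_derivative p q \<noteq> 0" "jet_curvature p q < c" and n: "3 \<le> CARD('n)"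
  shows "((p, q, c, 0, 0), velocity q s \<rho>) \<in> immersed_slots"
proof -
  have "0 < c" using z(3) jet_curvature_nonneg[of p q] by linarith
  then have "0 < norm p * c / 2" using z(1) by simp
  also have "\<dots> \<le> norm (corrugated_tantrix_velocity (p, q, c, 0, 0) (velocity q s \<rho>))"
    unfolding velocity_def corrugated_tantrix_velocity_base[OF z] by (rule norm_leading_velocity(2)[OF z(1,2) n z(3)])
  finally show ?thesis using base_in_nonzero_slots[OF z] by (simp add: immersed_slots_def)
qed

text \<open>  At infinite frequency the centroid density is \<open>(c + h) p - h p = c p\<close> by the Pythagorean identity.\<close>

lemma centroid_density_base:
  fixes p q :: "real ^ 'n::finite"
  assumes z: "p \<noteq> 0" "sgn_derivative p q \<noteq> 0" "jet_curvature p q < c" and n: "3 \<le> CARD('n)"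
  shows "centroid_density ((p, q, c, 0, 0), velocity q s \<rho>) = c *\<^sub>R p"
    and "length_density ((p, q, c, 0, 0), velocity q s \<rho>) = c * norm p"
proof -
  have "norm p *\<^sub>R sgn p = p" using z(1) by (simp add: sgn_div_norm)
  then have "(norm p * (c + length_ripple p q c (isotropic_defect \<rho>))) *\<^sub>R sgn p = (c + length_ripple p q c (isotropic_defect \<rho>)) *\<^sub>R p"
    by (metis mult.commute scaleR_scaleR)
  then show "centroid_density ((p, q, c, 0, 0), velocity q s \<rho>) = c *\<^sub>R p"
    using norm_leading_velocity(1)[OF z(1,2) n z(3), of \<rho>]
    by (simp add: centroid_density_def velocity_def corrugated_tantrix_velocity_base[OF z] centroid_drift_velocity_base[OF z] scaleR_add_left)
  show "length_density ((p, q, c, 0, 0), velocity q s \<rho>) = c * norm p"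
    using norm_leading_velocity(1)[OF z(1,2) n z(3), of \<rho>]
    by (simp add: length_density_def velocity_def corrugated_tantrix_velocity_base[OF z] length_drift_velocity_base[OF z] algebra_simps)
qed

text \<open>  The direction in which the values move when a constant is added to all the velocities \<open>p\<close>.\<close>

definition tilt :: "real ^ 'n \<Rightarrow> 'n::finite slot \<times> 'n slot" where
  "tilt w = ((w, 0, 0, 0, 0), (0, 0, 0, 0, 0))"

lemma centroid_density_derivative_base:
  fixes p q :: "real ^ 'n::finite"
  assumes z: "p \<noteq> 0" "sgn_derivative p q \<noteq> 0" "jet_curvature p q < c" and n: "3 \<le> CARD('n)"
  shows "frechet_derivative centroid_density (at ((p, q, c, 0, 0), velocity q s \<rho>)) (tilt w) = c *\<^sub>R w"
proof -
  let ?z = "((p, q, c, 0, 0), velocity q s \<rho>)"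
  let ?A = "{h. (p + h *\<^sub>R w, q, c, 0, 0) \<in> (nonzero_slots :: 'n slot set)}"
  have D: "(centroid_density has_derivative frechet_derivative centroid_density (at ?z)) (at ?z)"
    by (rule cdiff_frechet(1)[OF cdiff_centroid_density open_immersed_slots base_in_immersed_slots[OF assms]])
  have "?A = (\<lambda>h. (p + h *\<^sub>R w, q, c, 0, 0)) -` nonzero_slots" by auto
  also have "open \<dots>" by (intro continuous_open_vimage open_nonzero_slots continuous_intros)
  finally have A: "open ?A" .
  have base: "centroid_density ((p', q, c, 0, 0), velocity q s \<rho>) = c *\<^sub>R p'" if "(p', q, c, 0, 0) \<in> nonzero_slots" for p'
  proof (rule centroid_density_base)
    show "p' \<noteq> 0" "sgn_derivative p' q \<noteq> 0" "jet_curvature p' q < c" using that by (auto simp: nonzero_slots_def regular_slots_def)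
  qed (rule n)
  have "((\<lambda>h. c *\<^sub>R (p + h *\<^sub>R w)) has_vector_derivative c *\<^sub>R w) (at 0)"
    by (auto intro!: derivative_eq_intros)
  then have "((\<lambda>h. centroid_density ((p + h *\<^sub>R w, q, c, 0, 0), velocity q s \<rho>)) has_vector_derivative c *\<^sub>R w) (at 0)"
    by (rule has_vector_derivative_transform_within_open[OF _ A]) (use base_in_nonzero_slots[OF z] base in auto)
  then have "((\<lambda>h. centroid_density (?z + h *\<^sub>R tilt w)) has_vector_derivative c *\<^sub>R w) (at 0)"
    by (simp add: tilt_def velocity_def)
  from frechet_along_line[OF D this] show ?thesis .
qed

lemma small_near_compact:
  fixes F :: "'a::euclidean_space \<Rightarrow> real"
  assumes K: "compact K" and U: "open U" "K \<subseteq> U" and F: "continuous_on U F" "\<And>z. z \<in> K \<Longrightarrow> F z = 0" and e: "e > 0"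
  obtains d where "d > 0" "\<And>z h. z \<in> K \<Longrightarrow> norm h \<le> d \<Longrightarrow> z + h \<in> U \<and> \<bar>F (z + h)\<bar> \<le> e"
proof -
  have "open (U \<inter> F -` ball 0 e)" by (rule continuous_open_preimage[OF F(1) U(1) open_ball])
  moreover have "K \<subseteq> U \<inter> F -` ball 0 e" using U(2) F(2) e by auto
  ultimately obtain d where d: "d > 0" "{x + y | x y. x \<in> K \<and> y \<in> cball 0 d} \<subseteq> U \<inter> F -` ball 0 e"
  proof -
    assume o: "open (U \<inter> F -` ball 0 e)" and s: "K \<subseteq> U \<inter> F -` ball 0 e"
    obtain d where d: "d > 0" "(\<Union>x\<in>K. ball x d) \<subseteq> U \<inter> F -` ball 0 e"
      using compact_subset_open_imp_ball_epsilon_subset[OF K o s] by blast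
    show thesis
    proof (rule that[of "d / 2"])
      show "{x + y |x y. x \<in> K \<and> y \<in> cball 0 (d / 2)} \<subseteq> U \<inter> F -` ball 0 e"
        using d by (force simp: dist_norm)
    qed (use d in auto)
  qed
  show thesis
  proof (rule that[OF d(1)])
    fix z h assume "z \<in> K" "norm (h :: 'a) \<le> d"
    then have "z + h \<in> U \<inter> F -` ball 0 e" using d(2) by force
    then show "z + h \<in> U \<and> \<bar>F (z + h)\<bar> \<le> e" by auto
  qed
qed

text \<open>  The velocity of the corrugated tantrix in the limit of infinite frequency.\<close>

definition leading_velocity :: "real ^ 'n \<Rightarrow> real ^ 'n \<Rightarrow> real \<Rightarrow> real ^ 'n \<Rightarrow> real ^ 'n" where
  "leading_velocity p q c \<rho> = sgn_derivative p q + displacement p q c \<rho> (isotropic_defect \<rho>)"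

lemma continuous_on_isotropic_defect:
  "continuous_on S f \<Longrightarrow> continuous_on S (\<lambda>x. isotropic_defect (f x))"
  unfolding isotropic_defect_def by (intro continuous_intros)

text \<open>  All the quantities vanish for \<open>r = 0\<close>, \<open>P = 0\<close> and are continuous on an open set, hence small
  near a compact set of values. The bound on the derivative in the direction of a tilt will make the closing map a
  contraction.\<close>

lemma corrugation_estimates:
  fixes K :: "((real ^ 'n) \<times> (real ^ 'n) \<times> (real ^ 'n) \<times> real \<times> (real ^ 'n)) set"
  assumes n: "3 \<le> CARD('n)" and K: "compact K"
    and dom: "\<And>p q s c \<rho>. (p, q, s, c, \<rho>) \<in> K \<Longrightarrow> p \<noteq> 0 \<and> sgn_derivative p q \<noteq> 0 \<and> jet_curvature p q < c" and e: "e > 0"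
  obtains d where "d > 0" "\<And>p q s c \<rho> r P. (p, q, s, c, \<rho>) \<in> K \<Longrightarrow> norm r \<le> d \<Longrightarrow> norm P \<le> d \<Longrightarrow>
    ((p, q, c, r, P), velocity q s \<rho>) \<in> immersed_slots \<and>
    norm (corrugated_tantrix (p, q, c, r, P) - sgn p) \<le> e \<and>
    norm (corrugated_tantrix_velocity (p, q, c, r, P) (velocity q s \<rho>) - leading_velocity p q c \<rho>) \<le> e \<and>
    norm (centroid_density ((p, q, c, r, P), velocity q s \<rho>) - c *\<^sub>R p) \<le> e \<and>
    (\<forall>w. norm (frechet_derivative centroid_density (at ((p, q, c, r, P), velocity q s \<rho>)) (tilt w) - c *\<^sub>R w) \<le> e * norm w) \<and>
    \<bar>length_density ((p, q, c, r, P), velocity q s \<rho>) - c * norm p\<bar> \<le> e \<and>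
    \<bar>length_drift (p, q, c, r, P)\<bar> \<le> e"
proof -
  define base :: "(real ^ 'n) \<times> (real ^ 'n) \<times> (real ^ 'n) \<times> real \<times> (real ^ 'n) \<Rightarrow> 'n slot \<times> 'n slot"
    where "base = (\<lambda>(p, q, s, c, \<rho>). ((p, q, c, 0, 0), velocity q s \<rho>))"
  have cbase: "continuous_on S base" for S
    unfolding base_def velocity_def case_prod_unfold by (intro continuous_intros continuous_on_isotropic_defect)
  have K': "compact (base ` K)" by (rule compact_continuous_image[OF cbase K])
  have sub: "base ` K \<subseteq> immersed_slots"
    using dom base_in_immersed_slots[OF _ _ _ n] by (force simp: base_def)
  \<comment> \<open>the sum of the quantities to be controlled, so that one compactness argument serves them all\<close>
  define G where "G = (\<lambda>w :: 'n slot \<times> 'n slot.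
    case w of ((p, q, c, r, P), (q', s, c', \<rho>, Q)) \<Rightarrow>
      norm (corrugated_tantrix (p, q, c, r, P) - sgn p)
      + norm (corrugated_tantrix_velocity (p, q, c, r, P) (q', s, c', \<rho>, Q) - (sgn_derivative p q + displacement p q c \<rho> Q))
      + norm (centroid_density w - c *\<^sub>R p)
      + (\<Sum>b\<in>Basis. norm (frechet_derivative centroid_density (at w) (tilt b) - c *\<^sub>R b))
      + \<bar>length_density w - c * norm p\<bar> + \<bar>length_drift (p, q, c, r, P)\<bar>)"
  have G0: "G w = 0" if "w \<in> base ` K" for w
  proof -
    obtain p q s c \<rho> where w: "w = ((p, q, c, 0, 0), velocity q s \<rho>)" "(p, q, s, c, \<rho>) \<in> K"
    proof -
      obtain k where k: "k \<in> K" "w = base k" using \<open>w \<in> base ` K\<close> by blast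
      obtain p q s c \<rho> where "k = (p, q, s, c, \<rho>)" by (rule prod_cases5)
      then show thesis using k by (intro that) (auto simp: base_def)
    qed
    note z = dom[OF w(2), THEN conjunct1] dom[OF w(2), THEN conjunct2, THEN conjunct1] dom[OF w(2), THEN conjunct2, THEN conjunct2]
    show ?thesis
      using centroid_density_derivative_base[OF z n, of s \<rho>] centroid_density_base[OF z n, of s \<rho>] corrugated_tantrix_velocity_base[OF z, of s \<rho>]
      unfolding G_def w(1) by (simp add: velocity_def length_drift_def)
  qed
  have cG: "continuous_on immersed_slots G"
  proof -
    have sub0: "fst w \<in> regular_slots" if "w \<in> immersed_slots" for w :: "'n slot \<times> 'n slot"
      using that nonzero_slots_subset by (auto simp: immersed_slots_def)
    have d0: "fst (fst w) \<noteq> 0 \<and> sgn_derivative (fst (fst w)) (fst (snd (fst w))) \<noteq> 0 \<and>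
        jet_curvature (fst (fst w)) (fst (snd (fst w))) < fst (snd (snd (fst w)))" if "w \<in> immersed_slots" for w :: "'n slot \<times> 'n slot"
      using sub0[OF that] by (auto simp: regular_slots_def case_prod_unfold)
    have "cdiff 0 immersed_slots (\<lambda>w. corrugated_tantrix_velocity (fst w) (snd w) :: real ^ 'n)"
      using cdiff_subset[OF cdiff_corrugated_tantrix_velocity immersed_slots_subset] by (simp only: case_prod_unfold)
    then have c1: "continuous_on immersed_slots (\<lambda>w. corrugated_tantrix_velocity (fst w) (snd w) :: real ^ 'n)" by simp
    have c2: "continuous_on immersed_slots (\<lambda>w. corrugated_tantrix (fst w) :: real ^ 'n)"
      by (rule cdiff_continuous_on[OF cdiff_on_immersed_slots[OF cdiff_corrugated_tantrix]])
    have c3: "continuous_on immersed_slots (\<lambda>w. length_drift (fst w :: 'n slot))"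
      by (rule cdiff_continuous_on[OF cdiff_on_immersed_slots[OF cdiff_subset[OF cdiff_length_drift nonzero_slots_subset]]])
    have c4: "continuous_on immersed_slots (\<lambda>w :: 'n slot \<times> 'n slot. sgn_derivative (fst (fst w)) (fst (snd (fst w))) +
        displacement (fst (fst w)) (fst (snd (fst w))) (fst (snd (snd (fst w)))) (fst (snd (snd (snd (snd w))))) (snd (snd (snd (snd (snd w))))))"
      by (rule cdiff_continuous_on[where k=0], intro cdiff_add cdiff_sgn_derivative cdiff_displacement cdiff_fst cdiff_snd cdiff_ident)
        (use d0 in blast)+
    have c5: "continuous_on immersed_slots (\<lambda>w :: 'n slot \<times> 'n slot. sgn (fst (fst w)))"
      by (rule cdiff_continuous_on[where k=0], intro cdiff_sgn cdiff_fst cdiff_ident) (use d0 in blast)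
    have c6: "continuous_on immersed_slots (\<lambda>w. frechet_derivative centroid_density (at w) v :: real ^ 'n)" for v
      by (rule cdiff_continuous_on[OF cdiff_frechet(2)[OF cdiff_centroid_density open_immersed_slots]])
    have c7: "continuous_on immersed_slots (centroid_density :: _ \<Rightarrow> real ^ 'n)" by (rule cdiff_continuous_on[OF cdiff_centroid_density])
    have c8: "continuous_on immersed_slots (length_density :: 'n slot \<times> 'n slot \<Rightarrow> real)" by (rule cdiff_continuous_on[OF cdiff_length_density])
    show ?thesis
      unfolding G_def case_prod_unfold prod.collapse
      by (intro continuous_on_add continuous_on_norm continuous_on_diff continuous_on_sum continuous_on_rabs
          c1 c2 c3 c4 c5 c6 c7 c8 continuous_on_scaleR continuous_on_mult continuous_on_fst continuous_on_snd continuous_on_id continuous_on_const)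
  qed
  obtain d where d: "d > 0" "\<And>z h. z \<in> base ` K \<Longrightarrow> norm h \<le> d \<Longrightarrow> z + h \<in> immersed_slots \<and> \<bar>G (z + h)\<bar> \<le> e"
    using small_near_compact[OF K' open_immersed_slots sub cG G0 e] by blast
  show thesis
  proof (rule that[of "d / 2"])
    fix p q s :: "real ^ 'n" and c and \<rho> r :: "real ^ 'n" and P :: "real ^ 'n ^ 'n"
    assume w: "(p, q, s, c, \<rho>) \<in> K" "norm r \<le> d / 2" "norm P \<le> d / 2"
    let ?h = "((0, 0, 0, r, P), 0) :: 'n slot \<times> 'n slot" and ?z = "((p, q, c, r, P), velocity q s \<rho>)"
    have "norm ?h \<le> norm r + norm P"
      using norm_Pair_le[of r P] by (simp add: norm_Pair)
    then have "norm ?h \<le> d" using w by simp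
    from d(2)[OF imageI[OF w(1)] this] have *: "?z \<in> immersed_slots" "\<bar>G ?z\<bar> \<le> e"
      by (simp_all add: base_def velocity_def)
    have Geq: "G ?z = norm (corrugated_tantrix (p, q, c, r, P) - sgn p)
      + norm (corrugated_tantrix_velocity (p, q, c, r, P) (velocity q s \<rho>) - leading_velocity p q c \<rho>)
      + norm (centroid_density ?z - c *\<^sub>R p)
      + (\<Sum>b\<in>Basis. norm (frechet_derivative centroid_density (at ?z) (tilt b) - c *\<^sub>R b))
      + \<bar>length_density ?z - c * norm p\<bar> + \<bar>length_drift (p, q, c, r, P)\<bar>"
      by (simp add: G_def velocity_def leading_velocity_def)
    let ?D = "frechet_derivative centroid_density (at ?z)"
    have D: "linear ?D"
      by (rule has_derivative_linear[OF cdiff_frechet(1)[OF cdiff_centroid_density open_immersed_slots *(1)]])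
    have S0: "0 \<le> (\<Sum>b\<in>Basis. norm (?D (tilt b) - c *\<^sub>R b))" by (intro sum_nonneg) simp
    have Dw: "norm (?D (tilt w) - c *\<^sub>R w) \<le> e * norm w" for w
    proof -
      define \<Phi> where "\<Phi> w = ?D (tilt w) - c *\<^sub>R w" for w
      have sh: "tilt (x + y) = tilt x + tilt y" "tilt (h *\<^sub>R x) = h *\<^sub>R tilt x" for h and x y :: "real ^ 'n"
        by (simp_all add: tilt_def)
      have lin: "linear \<Phi>"
        by (rule linearI; unfold \<Phi>_def sh linear_add[OF D] linear_cmul[OF D]) (simp_all add: algebra_simps)
      have "\<Phi> w = \<Phi> (\<Sum>b\<in>Basis. (w \<bullet> b) *\<^sub>R b)" by (simp only: euclidean_representation)
      also have "\<dots> = (\<Sum>b\<in>Basis. (w \<bullet> b) *\<^sub>R \<Phi> b)" by (simp only: linear_sum[OF lin] linear_cmul[OF lin])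
      also have "norm \<dots> \<le> (\<Sum>b\<in>Basis. norm w * norm (\<Phi> b))"
        by (rule order_trans[OF norm_sum], rule sum_mono) (simp add: Basis_le_norm mult_right_mono)
      also have "\<dots> = norm w * (\<Sum>b\<in>Basis. norm (\<Phi> b))" by (rule sum_distrib_left[symmetric])
      also have "(\<Sum>b\<in>Basis. norm (\<Phi> b)) \<le> G ?z"
        unfolding Geq \<Phi>_def by simp
      also have "G ?z \<le> e" using *(2) by simp
      finally have "norm (\<Phi> w) \<le> norm w * e" by (simp add: mult_left_mono)
      then show ?thesis unfolding \<Phi>_def by (simp add: mult.commute)
    qed
    have "norm (corrugated_tantrix (p, q, c, r, P) - sgn p) \<le> e"
      "norm (corrugated_tantrix_velocity (p, q, c, r, P) (velocity q s \<rho>) - leading_velocity p q c \<rho>) \<le> e"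
      "norm (centroid_density ?z - c *\<^sub>R p) \<le> e" "\<bar>length_density ?z - c * norm p\<bar> \<le> e" "\<bar>length_drift (p, q, c, r, P)\<bar> \<le> e"
      using *(2) S0 unfolding Geq by (smt (verit) norm_ge_zero)+
    with *(1) Dw show "?z \<in> immersed_slots \<and>
      norm (corrugated_tantrix (p, q, c, r, P) - sgn p) \<le> e \<and>
      norm (corrugated_tantrix_velocity (p, q, c, r, P) (velocity q s \<rho>) - leading_velocity p q c \<rho>) \<le> e \<and>
      norm (centroid_density ?z - c *\<^sub>R p) \<le> e \<and> (\<forall>w. norm (?D (tilt w) - c *\<^sub>R w) \<le> e * norm w) \<and>
      \<bar>length_density ?z - c * norm p\<bar> \<le> e \<and> \<bar>length_drift (p, q, c, r, P)\<bar> \<le> e" by blast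
  qed (use d in simp)
qed

section \<open>Corrugation of the homotopy\<close>

lemma continuous_on_SUP_compact:
  fixes g :: "'t::metric_space \<Rightarrow> 'z::metric_space \<Rightarrow> real"
  assumes g: "continuous_on (T \<times> Z) (\<lambda>(t, z). g t z)" and Z: "compact Z" "Z \<noteq> {}"
  shows "continuous_on T (\<lambda>t. SUP z\<in>Z. g t z)"
  unfolding continuous_on_def
proof (intro ballI tendstoI)
  fix t e assume t: "t \<in> T" and e: "(0::real) < e"
  have bdd: "bdd_above (g s ` Z)" if "s \<in> T" for s
    by (intro bounded_imp_bdd_above compact_imp_bounded compact_continuous_image continuous_on_slice[OF g that] Z(1))
  obtain X where X: "t \<in> X" "open X" "\<forall>s\<in>X \<inter> T. \<forall>z\<in>Z. dist (g s z) (g t z) \<le> e / 2"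
  proof (rule continuous_on_prod_compactE[OF g Z(1) t, of "e / 2"])
    fix X assume "t \<in> X" "open X" "\<forall>s\<in>X \<inter> T. \<forall>z\<in>Z. dist (case (s, z) of (t, z) \<Rightarrow> g t z) (case (t, z) of (t, z) \<Rightarrow> g t z) \<le> e / 2"
    then show thesis by (intro that[of X]) simp_all
  qed (use e in simp)
  have le: "(SUP z\<in>Z. g s z) \<le> (SUP z\<in>Z. g s' z) + e / 2"
    if "s \<in> T" "s' \<in> T" "\<And>z. z \<in> Z \<Longrightarrow> dist (g s z) (g s' z) \<le> e / 2" for s s'
  proof (rule cSUP_least[OF Z(2)])
    fix z assume z: "z \<in> Z"
    have "g s z \<le> g s' z + e / 2" using that(3)[OF z] unfolding dist_real_def abs_le_iff by linarith
    also have "g s' z \<le> (SUP z\<in>Z. g s' z)" by (rule cSUP_upper[OF z bdd[OF that(2)]])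
    finally show "g s z \<le> (SUP z\<in>Z. g s' z) + e / 2" by simp
  qed
  have "eventually (\<lambda>s. s \<in> X \<and> s \<in> T) (at t within T)"
    using X(1,2) by (auto simp: eventually_at_topological)
  then show "eventually (\<lambda>s. dist (SUP z\<in>Z. g s z) (SUP z\<in>Z. g t z) < e) (at t within T)"
  proof eventually_elim
    case (elim s)
    have "(SUP z\<in>Z. g s z) \<le> (SUP z\<in>Z. g t z) + e / 2" using X(3) elim t by (intro le) auto
    moreover have "(SUP z\<in>Z. g t z) \<le> (SUP z\<in>Z. g s z) + e / 2" using X(3) elim t by (intro le) (auto simp: dist_commute)
    ultimately show ?case using e by (simp add: dist_real_def abs_le_iff)
  qed
qed

text \<open>  A family over the open time interval that stays closer and closer to a continuous one near the end times
  extends continuously, however wild its own behaviour (here the frequencies tend to infinity).\<close>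

lemma continuous_on_glue_ends:
  fixes F G :: "real \<times> 'a::metric_space \<Rightarrow> 'b::real_normed_vector"
  assumes F: "continuous_on ({0<..<1} \<times> I) F" and G: "continuous_on ({0..1} \<times> I) G"
    and \<eta>: "continuous_on ({0..1} \<times> I) \<eta>"
    and ends: "\<And>t x. t \<in> {0, 1} \<Longrightarrow> x \<in> I \<Longrightarrow> F (t, x) = G (t, x) \<and> \<eta> (t, x) = (0::real)"
    and near: "\<And>t x. t \<in> {0<..<1} \<Longrightarrow> x \<in> I \<Longrightarrow> norm (F (t, x) - G (t, x)) \<le> \<eta> (t, x)"
  shows "continuous_on ({0..1} \<times> I) F"
  unfolding continuous_on_eq_continuous_within
proof
  fix z :: "real \<times> 'a" assume z: "z \<in> {0..1} \<times> I"
  show "continuous (at z within {0..1} \<times> I) F"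
  proof (cases "fst z \<in> {0<..<1}")
    case True
    have "continuous (at z within {0<..<1} \<times> I) F"
      using F z True unfolding continuous_on_eq_continuous_within by (cases z) auto
    moreover have "at z within {0<..<1} \<times> I = at z within {0..1} \<times> I"
      by (rule at_within_nhd[where S="{0<..<1} \<times> UNIV"]) (use True in \<open>auto simp: mem_Times_iff intro!: open_Times\<close>)
    ultimately show ?thesis by (simp add: continuous_within)
  next
    case False
    then obtain t x where tx: "z = (t, x)" "t \<in> {0, 1}" "x \<in> I" using z by (cases z) auto
    have le: "norm (F w - G w) \<le> \<eta> w" if "w \<in> {0..1} \<times> I" for w
    proof -
      obtain s y where w: "w = (s, y)" by (cases w)
      show ?thesis using that near[of s y] ends[of s y] unfolding w by (cases "s \<in> {0, 1}") auto
    qed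
    have "(\<eta> \<longlongrightarrow> 0) (at z within {0..1} \<times> I)"
      using bspec[OF \<eta>[unfolded continuous_on_def] z] ends[OF tx(2,3)] tx(1) by simp
    moreover have "eventually (\<lambda>w. norm (F w - G w) \<le> \<eta> w) (at z within {0..1} \<times> I)"
      using le by (auto simp: eventually_at_filter)
    ultimately have "((\<lambda>w. F w - G w) \<longlongrightarrow> 0) (at z within {0..1} \<times> I)"
      by (rule Lim_null_comparison[rotated])
    moreover have "(G \<longlongrightarrow> G z) (at z within {0..1} \<times> I)" using G z unfolding continuous_on_def by blast
    ultimately have "((\<lambda>w. (F w - G w) + G w) \<longlongrightarrow> 0 + G z) (at z within {0..1} \<times> I)" by (rule tendsto_add)
    then show ?thesis using ends[OF tx(2,3)] tx(1) by (simp add: continuous_within)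
  qed
qed

lemma continuous_on_joint:
  assumes "continuous_on (T \<times> S) (\<lambda>(t, x). F t x)" "continuous_on A g" "continuous_on A h"
    "\<And>w. w \<in> A \<Longrightarrow> g w \<in> T" "\<And>w. w \<in> A \<Longrightarrow> h w \<in> S"
  shows "continuous_on A (\<lambda>w. F (g w) (h w))"
proof -
  have "continuous_on A (\<lambda>w. case (g w, h w) of (t, x) \<Rightarrow> F t x)"
    by (rule continuous_on_compose2[OF assms(1) continuous_on_Pair[OF assms(2,3)]]) (use assms(4,5) in auto)
  then show ?thesis by simp
qed

text \<open>  The functions \<open>u t\<close> are the smoothed velocities of the homotopy and \<open>u1 t\<close>, \<open>u2 t\<close> their derivatives. Velocities may be
  tilted by vectors of norm at most \<open>r0\<close> without making the curvature vanish, \<open>cm\<close> is a lower bound of the curvatures, and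
  the curvature is constant at the end times.\<close>

locale corrugation_data = curve_dom +
  fixes u u1 u2 :: "real \<Rightarrow> real \<Rightarrow> real ^ 'n::finite" and r0 cm :: real and K :: nat
  assumes n: "3 \<le> CARD('n)"
    and u_der: "\<And>t x. t \<in> {0..1} \<Longrightarrow> (u t has_vector_derivative u1 t x) (at x)"
    and u1_der: "\<And>t x. t \<in> {0<..<1} \<Longrightarrow> (u1 t has_vector_derivative u2 t x) (at x)"
    and u1_smooth: "\<And>t. t \<in> {0<..<1} \<Longrightarrow> cdiff K UNIV (u1 t)"
    and u_cont: "continuous_on ({0..1} \<times> UNIV) (\<lambda>(t, x). u t x)"
    and u1_cont: "continuous_on ({0..1} \<times> UNIV) (\<lambda>(t, x). u1 t x)"
    and u2_cont: "continuous_on ({0<..<1} \<times> UNIV) (\<lambda>(t, x). u2 t x)"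
    and u_per: "\<And>t. t \<in> {0..1} \<Longrightarrow> map_on \<Gamma> (u t)" "\<And>t. t \<in> {0..1} \<Longrightarrow> map_on \<Gamma> (u1 t)"
      "\<And>t. t \<in> {0<..<1} \<Longrightarrow> map_on \<Gamma> (u2 t)"
    and u_mean: "\<And>t. t \<in> {0..1} \<Longrightarrow> \<Gamma> = Circle a b \<Longrightarrow> integral {a..b} (u t) = 0"
    and r0: "0 < r0"
    and nondeg: "\<And>t x w. t \<in> {0..1} \<Longrightarrow> x \<in> {a..b} \<Longrightarrow> norm w \<le> r0 \<Longrightarrow>
        u t x + w \<noteq> 0 \<and> sgn_derivative (u t x + w) (u1 t x) \<noteq> 0"
    and cm: "0 < cm" "\<And>t x. t \<in> {0..1} \<Longrightarrow> x \<in> {a..b} \<Longrightarrow> cm \<le> jet_curvature (u t x) (u1 t x)"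
    and ends: "\<And>t. t \<in> {0, 1} \<Longrightarrow> \<exists>k. \<forall>x\<in>{a..b}. jet_curvature (u t x) (u1 t x) = k"
begin

text \<open>  Vanishes at the end times, where the curves are to be left alone.\<close>

definition tilt_radius :: "real \<Rightarrow> real" where "tilt_radius t = r0 * (t * (1 - t))"

text \<open>  The factor \<open>c\<close> between the speeds of the corrugated tantrix and of the curve. The supremum runs over all points and all
  allowed tilts; the summand makes the inequality strict at inner times. At the end times it
  reduces to the constant curvature of the curve.\<close>

definition target_curvature :: "real \<Rightarrow> real" where
  "target_curvature t = (SUP z\<in>{a..b} \<times> cball (0 :: real ^ 'n) 1. jet_curvature (u t (fst z) + tilt_radius t *\<^sub>R snd z) (u1 t (fst z))) + t * (1 - t)"

lemma time_weight: assumes "t \<in> {0..1::real}" shows "0 \<le> t * (1 - t)" "t * (1 - t) \<le> 1 / 4"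
proof -
  show "0 \<le> t * (1 - t)" using assms by simp
  have "1 / 4 - t * (1 - t) = (t - 1 / 2)\<^sup>2" by (simp add: power2_eq_square field_simps)
  then show "t * (1 - t) \<le> 1 / 4" using zero_le_power2[of "t - 1 / 2"] by linarith
qed

lemma time_weight_pos: "t \<in> {0<..<1::real} \<Longrightarrow> 0 < t * (1 - t)" by simp

lemma tilt_radius_pos: "t \<in> {0<..<1} \<Longrightarrow> 0 < tilt_radius t" using r0 time_weight_pos by (simp add: tilt_radius_def)

lemma tilt_radius_le: assumes "t \<in> {0..1}" shows "0 \<le> tilt_radius t" "tilt_radius t \<le> r0"
proof -
  show "0 \<le> tilt_radius t" using r0 time_weight(1)[OF assms] by (simp add: tilt_radius_def)
  have "r0 * (t * (1 - t)) \<le> r0 * 1" using r0 time_weight(2)[OF assms] by (intro mult_left_mono) auto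
  then show "tilt_radius t \<le> r0" by (simp add: tilt_radius_def)
qed

lemma tilt_radius_v: "t \<in> {0..1} \<Longrightarrow> norm v \<le> 1 \<Longrightarrow> norm (tilt_radius t *\<^sub>R (v :: real ^ 'n)) \<le> r0"
  using tilt_radius_le[of t] mult_mono[of "tilt_radius t" r0 "norm v" 1] r0 by simp

lemma nondeg_v:
  assumes "t \<in> {0..1}" "x \<in> {a..b}" "norm v \<le> 1"
  shows "u t x + tilt_radius t *\<^sub>R v \<noteq> 0" "sgn_derivative (u t x + tilt_radius t *\<^sub>R v) (u1 t x) \<noteq> 0"
  using nondeg[OF assms(1,2) tilt_radius_v[OF assms(1,3)]] by auto

lemma tilt_radius_cont: "continuous_on A tilt_radius"
  unfolding tilt_radius_def by (intro continuous_intros)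

lemma jet_curvature_cont: "continuous_on ({0..1} \<times> ({a..b} \<times> cball (0 :: real ^ 'n) 1))
    (\<lambda>(t, z). jet_curvature (u t (fst z) + tilt_radius t *\<^sub>R snd z) (u1 t (fst z)))"
proof -
  define A where "A = {0..1::real} \<times> ({a..b} \<times> cball (0 :: real ^ 'n) 1)"
  have cu: "continuous_on A (\<lambda>w. u (fst w) (fst (snd w)))"
    by (rule continuous_on_compose2[OF u_cont, of _ "\<lambda>w. (fst w, fst (snd w))", simplified])
      (auto simp: A_def intro!: continuous_intros)
  have cu1: "continuous_on A (\<lambda>w. u1 (fst w) (fst (snd w)))"
    by (rule continuous_on_compose2[OF u1_cont, of _ "\<lambda>w. (fst w, fst (snd w))", simplified])
      (auto simp: A_def intro!: continuous_intros)
  have cp: "continuous_on A (\<lambda>w. u (fst w) (fst (snd w)) + tilt_radius (fst w) *\<^sub>R snd (snd w))"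
    by (intro continuous_intros cu continuous_on_compose2[OF tilt_radius_cont[of UNIV]]) auto
  have nd: "u (fst w) (fst (snd w)) + tilt_radius (fst w) *\<^sub>R snd (snd w) \<noteq> 0"
    "sgn_derivative (u (fst w) (fst (snd w)) + tilt_radius (fst w) *\<^sub>R snd (snd w)) (u1 (fst w) (fst (snd w))) \<noteq> 0" if "w \<in> A" for w
    using nondeg_v[of "fst w" "fst (snd w)" "snd (snd w)"] that by (auto simp: A_def mem_Times_iff)
  have "cdiff 0 A (\<lambda>w. jet_curvature (u (fst w) (fst (snd w)) + tilt_radius (fst w) *\<^sub>R snd (snd w)) (u1 (fst w) (fst (snd w))))"
  proof (rule cdiff_jet_curvature)
    show "cdiff 0 A (\<lambda>w. u (fst w) (fst (snd w)) + tilt_radius (fst w) *\<^sub>R snd (snd w))" using cp by simp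
    show "cdiff 0 A (\<lambda>w. u1 (fst w) (fst (snd w)))" using cu1 by simp
  qed (use nd in blast)+
  then show ?thesis by (simp add: A_def case_prod_unfold)
qed

lemma compact_param: "compact ({a..b} \<times> cball (0 :: real ^ 'n) 1)" "{a..b} \<times> cball (0 :: real ^ 'n) 1 \<noteq> {}"
  using ab by (auto intro: compact_Times)

lemma target_curvature_cont: "continuous_on {0..1} target_curvature"
  unfolding target_curvature_def by (intro continuous_on_add continuous_on_SUP_compact[OF jet_curvature_cont compact_param] continuous_intros)

lemma jet_curvature_le_target_curvature:
  assumes "t \<in> {0..1}" "x \<in> {a..b}" "norm v \<le> 1"
  shows "jet_curvature (u t x + tilt_radius t *\<^sub>R v) (u1 t x) + t * (1 - t) \<le> target_curvature t"
proof -
  have "bdd_above ((\<lambda>z. jet_curvature (u t (fst z) + tilt_radius t *\<^sub>R snd z) (u1 t (fst z))) ` ({a..b} \<times> cball (0 :: real ^ 'n) 1))"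
    by (intro bounded_imp_bdd_above compact_imp_bounded compact_continuous_image compact_param
        continuous_on_slice[OF jet_curvature_cont assms(1)])
  from cSUP_upper[OF _ this, of "(x, v)"] assms show ?thesis by (simp add: target_curvature_def)
qed

lemma target_curvature_ge: assumes "t \<in> {0..1}" shows "cm \<le> target_curvature t"
proof -
  have "cm \<le> jet_curvature (u t a) (u1 t a)" using cm(2)[OF assms, of a] ab by simp
  then show ?thesis using jet_curvature_le_target_curvature[OF assms, of a 0] time_weight(1)[OF assms] ab by simp
qed

lemma target_curvature_pos: "t \<in> {0..1} \<Longrightarrow> 0 < target_curvature t" using target_curvature_ge[of t] cm(1) by linarith

lemma target_curvature_ends:
  assumes "t \<in> {0, 1}" "x \<in> {a..b}" shows "jet_curvature (u t x) (u1 t x) = target_curvature t"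
proof -
  obtain k where k: "\<forall>x\<in>{a..b}. jet_curvature (u t x) (u1 t x) = k" using ends[OF assms(1)] by blast
  have rt: "tilt_radius t = 0" "t * (1 - t) = 0" using assms(1) by (auto simp: tilt_radius_def)
  have "(SUP z\<in>{a..b} \<times> cball (0 :: real ^ 'n) 1. jet_curvature (u t (fst z) + tilt_radius t *\<^sub>R snd z) (u1 t (fst z))) =
      (SUP z\<in>{a..b} \<times> cball (0 :: real ^ 'n) 1. k)"
    by (rule SUP_cong) (use k rt in auto)
  then show ?thesis using k assms(2) rt compact_param(2) by (simp add: target_curvature_def)
qed

text \<open>  The values that enter the corrugation at time \<open>t\<close> in the point \<open>x\<close>, with a tilt normalized so that \<open>v\<close> ranges
  over the unit ball, and their derivative in \<open>x\<close>.\<close>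

definition slot :: "(real \<Rightarrow> real \<Rightarrow> real ^ 'n) \<Rightarrow> (real \<Rightarrow> real \<Rightarrow> real ^ 'n ^ 'n) \<Rightarrow> real \<Rightarrow> real ^ 'n \<Rightarrow> real \<Rightarrow> 'n slot" where
  "slot r P t v x = (u t x + tilt_radius t *\<^sub>R v, u1 t x, target_curvature t, r t x, P t x)"

definition slot' :: "(real \<Rightarrow> real \<Rightarrow> real ^ 'n) \<Rightarrow> real \<Rightarrow> real \<Rightarrow> 'n slot" where
  "slot' \<rho> t x = velocity (u1 t x) (u2 t x) (\<rho> t x)"

definition admissible :: "real \<Rightarrow> (real \<Rightarrow> real \<Rightarrow> real ^ 'n) \<Rightarrow> (real \<Rightarrow> real \<Rightarrow> real ^ 'n) \<Rightarrow>
    (real \<Rightarrow> real \<Rightarrow> real ^ 'n ^ 'n) \<Rightarrow> real \<Rightarrow> real ^ 'n \<Rightarrow> real \<Rightarrow> bool" where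
  "admissible e \<rho> r P t v x \<longleftrightarrow>
    (slot r P t v x, slot' \<rho> t x) \<in> immersed_slots \<and>
    norm (corrugated_tantrix (slot r P t v x) - sgn (u t x + tilt_radius t *\<^sub>R v)) \<le> e \<and>
    norm (corrugated_tantrix_velocity (slot r P t v x) (slot' \<rho> t x) - leading_velocity (u t x + tilt_radius t *\<^sub>R v) (u1 t x) (target_curvature t) (\<rho> t x)) \<le> e \<and>
    norm (centroid_density (slot r P t v x, slot' \<rho> t x) - target_curvature t *\<^sub>R (u t x + tilt_radius t *\<^sub>R v)) \<le> e \<and>
    (\<forall>w. norm (frechet_derivative centroid_density (at (slot r P t v x, slot' \<rho> t x)) (tilt w) - target_curvature t *\<^sub>R w) \<le> e * norm w) \<and>
    \<bar>length_density (slot r P t v x, slot' \<rho> t x) - target_curvature t * norm (u t x + tilt_radius t *\<^sub>R v)\<bar> \<le> e \<and>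
    \<bar>length_drift (slot r P t v x)\<bar> \<le> e"

text \<open>  At time \<open>t\<close> the oscillation of level \<open>\<sigma> t = 1 / (t (1 - t))\<close> is used. On each compact piece \<open>J m\<close> of the open time
  interval \<open>corrugation_estimates\<close> provides a bound on \<open>r\<close> and \<open>P\<close> for the precision \<open>e0 / Suc m\<close>, and
  the exponents \<open>N m\<close> of the frequencies are chosen after all these bounds. As \<open>m \<le> \<sigma> t \<le> Suc m\<close> for a suitable \<open>m\<close>, the
  error at time \<open>t\<close> is at most \<open>e0 / Suc m \<le> e0 t (1 - t)\<close>.\<close>

lemma corrugation:
  assumes e0: "0 < e0"
  obtains C \<rho> r P where "0 < C"
    "\<And>t x v. t \<in> {0<..<1} \<Longrightarrow> x \<in> points \<Gamma> \<Longrightarrow> norm v \<le> 1 \<Longrightarrow> admissible (e0 * (t * (1 - t))) \<rho> r P t v x"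
    "\<And>t x. t \<in> {0<..<1} \<Longrightarrow> (r t has_vector_derivative \<rho> t x) (at x)"
    "\<And>t x. t \<in> {0<..<1} \<Longrightarrow> (P t has_vector_derivative isotropic_defect (\<rho> t x)) (at x)"
    "\<And>t. t \<in> {0<..<1} \<Longrightarrow> map_on \<Gamma> (\<rho> t)" "\<And>t. t \<in> {0<..<1} \<Longrightarrow> map_on \<Gamma> (r t)" "\<And>t. t \<in> {0<..<1} \<Longrightarrow> map_on \<Gamma> (P t)"
    "\<And>t x. t \<in> {0<..<1} \<Longrightarrow> norm (\<rho> t x) \<le> C"
    "\<And>t k. t \<in> {0<..<1} \<Longrightarrow> cdiff k UNIV (r t)" "\<And>t k. t \<in> {0<..<1} \<Longrightarrow> cdiff k UNIV (P t)"
    "continuous_on ({0<..<1} \<times> UNIV) (\<lambda>(t, x). \<rho> t x)"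
    "continuous_on ({0<..<1} \<times> UNIV) (\<lambda>(t, x). r t x)"
    "continuous_on ({0<..<1} \<times> UNIV) (\<lambda>(t, x). P t x)"
proof -
  have L: "0 < b - a" using ab by simp
  obtain C where C: "C > 0" and oscillation: "\<And>N :: nat \<Rightarrow> nat. strict_mono N \<Longrightarrow>
    \<exists>(\<rho> :: real \<Rightarrow> real \<Rightarrow> real ^ 'n) r (P :: real \<Rightarrow> real \<Rightarrow> real ^ 'n ^ 'n).
      (\<forall>\<sigma>\<ge>0. \<forall>x. (r \<sigma> has_vector_derivative \<rho> \<sigma> x) (at x) \<and>
         (P \<sigma> has_vector_derivative isotropic_defect (\<rho> \<sigma> x)) (at x) \<and>
         \<rho> \<sigma> (x + (b - a)) = \<rho> \<sigma> x \<and> r \<sigma> (x + (b - a)) = r \<sigma> x \<and> P \<sigma> (x + (b - a)) = P \<sigma> x \<and>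
         norm (\<rho> \<sigma> x) \<le> C \<and>
         (\<forall>m. real m \<le> \<sigma> \<longrightarrow> norm (r \<sigma> x) \<le> C / 2 ^ N m \<and> norm (P \<sigma> x) \<le> C / 2 ^ N m)) \<and>
      (\<forall>\<sigma> k. cdiff k UNIV (\<rho> \<sigma>) \<and> cdiff k UNIV (r \<sigma>) \<and> cdiff k UNIV (P \<sigma>)) \<and>
      continuous_on ({0..} \<times> UNIV) (\<lambda>(\<sigma>, x). \<rho> \<sigma> x) \<and>
      continuous_on ({0..} \<times> UNIV) (\<lambda>(\<sigma>, x). r \<sigma> x) \<and>
      continuous_on ({0..} \<times> UNIV) (\<lambda>(\<sigma>, x). P \<sigma> x)"
    using oscillations[OF L n] by blast
  define J where "J m = {t \<in> {0..1::real}. 1 \<le> real (Suc m) * (t * (1 - t))}" for m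
  have J01: "J m \<subseteq> {0<..<1}" for m
  proof
    fix t assume t: "t \<in> J m"
    then have "t \<noteq> 0" "t \<noteq> 1" by (auto simp: J_def)
    then show "t \<in> {0<..<1}" using t by (auto simp: J_def)
  qed
  have cJ: "compact (J m)" for m
  proof -
    have "J m = {0..1} \<inter> {t. 1 \<le> real (Suc m) * (t * (1 - t))}" by (auto simp: J_def)
    moreover have "closed {t::real. 1 \<le> real (Suc m) * (t * (1 - t))}"
      by (intro closed_Collect_le continuous_intros)
    ultimately show ?thesis by (simp add: compact_Int_closed)
  qed
  define KK where "KK m = (\<lambda>(t, x, v, \<rho>). (u t x + tilt_radius t *\<^sub>R v, u1 t x, u2 t x, target_curvature t, \<rho>)) `
      (J m \<times> {a..b} \<times> cball (0 :: real ^ 'n) 1 \<times> cball (0 :: real ^ 'n) C)" for m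
  have cK: "compact (KK m)" for m
  proof -
    let ?A = "J m \<times> {a..b} \<times> cball (0 :: real ^ 'n) 1 \<times> cball (0 :: real ^ 'n) C"
    have J01': "J m \<subseteq> {0..1}" by (auto simp: J_def)
    have cu: "continuous_on ?A (\<lambda>w. u (fst w) (fst (snd w)))"
      by (rule continuous_on_joint[OF u_cont]) (use J01' in \<open>auto intro!: continuous_intros\<close>)
    have cu1: "continuous_on ?A (\<lambda>w. u1 (fst w) (fst (snd w)))"
      by (rule continuous_on_joint[OF u1_cont]) (use J01' in \<open>auto intro!: continuous_intros\<close>)
    have cu2: "continuous_on ?A (\<lambda>w. u2 (fst w) (fst (snd w)))"
      by (rule continuous_on_joint[OF u2_cont]) (use J01[of m] in \<open>auto intro!: continuous_intros\<close>)
    have cc: "continuous_on ?A (\<lambda>w. target_curvature (fst w))"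
      by (rule continuous_on_compose2[OF target_curvature_cont]) (use J01' in \<open>auto intro: continuous_intros\<close>)
    have cr: "continuous_on ?A (\<lambda>w. tilt_radius (fst w))"
      by (rule continuous_on_compose2[OF tilt_radius_cont[of UNIV]]) (auto intro: continuous_intros)
    show ?thesis
      unfolding KK_def case_prod_unfold
      by (intro compact_continuous_image continuous_on_Pair continuous_on_add continuous_on_scaleR cu cu1 cu2 cc cr
          continuous_on_fst continuous_on_snd continuous_on_id compact_Times cJ compact_Icc compact_cball)
  qed
  have domK: "p \<noteq> 0 \<and> sgn_derivative p q \<noteq> 0 \<and> jet_curvature p q < c" if "(p, q, s, c, \<rho>) \<in> KK m" for p q s c \<rho> m
  proof -
    obtain t x v where w: "t \<in> J m" "x \<in> {a..b}" "norm v \<le> 1" "p = u t x + tilt_radius t *\<^sub>R v" "q = u1 t x" "c = target_curvature t"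
      using \<open>(p, q, s, c, \<rho>) \<in> KK m\<close> by (auto simp: KK_def)
    have t: "t \<in> {0<..<1}" "t \<in> {0..1}" using w(1) J01[of m] by (auto simp: J_def)
    show ?thesis using nondeg_v[OF t(2) w(2,3)] jet_curvature_le_target_curvature[OF t(2) w(2,3)] time_weight_pos[OF t(1)] w(4-6) by simp
  qed
  have "\<exists>d>0. \<forall>p q s c \<rho> r P. (p, q, s, c, \<rho>) \<in> KK m \<longrightarrow> norm r \<le> d \<longrightarrow> norm P \<le> d \<longrightarrow>
    ((p, q, c, r, P), velocity q s \<rho>) \<in> immersed_slots \<and>
    norm (corrugated_tantrix (p, q, c, r, P) - sgn p) \<le> e0 / real (Suc m) \<and>
    norm (corrugated_tantrix_velocity (p, q, c, r, P) (velocity q s \<rho>) - leading_velocity p q c \<rho>) \<le> e0 / real (Suc m) \<and>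
    norm (centroid_density ((p, q, c, r, P), velocity q s \<rho>) - c *\<^sub>R p) \<le> e0 / real (Suc m) \<and>
    (\<forall>w. norm (frechet_derivative centroid_density (at ((p, q, c, r, P), velocity q s \<rho>)) (tilt w) - c *\<^sub>R w) \<le> e0 / real (Suc m) * norm w) \<and>
    \<bar>length_density ((p, q, c, r, P), velocity q s \<rho>) - c * norm p\<bar> \<le> e0 / real (Suc m) \<and>
    \<bar>length_drift (p, q, c, r, P)\<bar> \<le> e0 / real (Suc m)" for m
  proof -
    have e: "e0 / real (Suc m) > 0" using e0 by simp
    show ?thesis
      by (rule corrugation_estimates[OF n cK[of m] domK[of _ _ _ _ _ m] e]) blast+
  qed
  then obtain d where d: "\<And>m. d m > 0" and est: "\<And>m p q s c \<rho> r P. (p, q, s, c, \<rho>) \<in> KK m \<Longrightarrow> norm r \<le> d m \<Longrightarrow> norm P \<le> d m \<Longrightarrow>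
    ((p, q, c, r, P), velocity q s \<rho>) \<in> immersed_slots \<and>
    norm (corrugated_tantrix (p, q, c, r, P) - sgn p) \<le> e0 / real (Suc m) \<and>
    norm (corrugated_tantrix_velocity (p, q, c, r, P) (velocity q s \<rho>) - leading_velocity p q c \<rho>) \<le> e0 / real (Suc m) \<and>
    norm (centroid_density ((p, q, c, r, P), velocity q s \<rho>) - c *\<^sub>R p) \<le> e0 / real (Suc m) \<and>
    (\<forall>w. norm (frechet_derivative centroid_density (at ((p, q, c, r, P), velocity q s \<rho>)) (tilt w) - c *\<^sub>R w) \<le> e0 / real (Suc m) * norm w) \<and>
    \<bar>length_density ((p, q, c, r, P), velocity q s \<rho>) - c * norm p\<bar> \<le> e0 / real (Suc m) \<and>
    \<bar>length_drift (p, q, c, r, P)\<bar> \<le> e0 / real (Suc m)" by metis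
  have "\<exists>k. C / d m < 2 ^ k" for m using real_arch_pow[of 2 "C / d m"] by auto
  then obtain k where k: "\<And>m. C / d m < 2 ^ k m" by metis
  \<comment> \<open>summation makes the exponents strictly increasing\<close>
  define N where "N m = (\<Sum>i\<le>m. Suc (k i))" for m
  have N: "strict_mono N" by (rule strict_monoI_Suc) (simp add: N_def)
  have "k m \<le> N m" for m unfolding N_def using member_le_sum[of m "{..m}" "\<lambda>i. Suc (k i)"] by simp
  then have "(2::real) ^ k m \<le> 2 ^ N m" for m by simp
  then have kN: "C / d m < 2 ^ N m" for m using k[of m] by (meson order_less_le_trans)
  have "C \<le> d m * 2 ^ N m" for m using d[of m] kN[of m] by (simp add: pos_divide_less_eq less_imp_le mult.commute)
  then have Nd: "C / 2 ^ N m \<le> d m" for m by (simp add: pos_divide_le_eq)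
  obtain \<rho> r :: "real \<Rightarrow> real \<Rightarrow> real ^ 'n" and P :: "real \<Rightarrow> real \<Rightarrow> real ^ 'n ^ 'n" where o:
    "\<And>\<sigma> x. 0 \<le> \<sigma> \<Longrightarrow> (r \<sigma> has_vector_derivative \<rho> \<sigma> x) (at x)"
    "\<And>\<sigma> x. 0 \<le> \<sigma> \<Longrightarrow> (P \<sigma> has_vector_derivative isotropic_defect (\<rho> \<sigma> x)) (at x)"
    "\<And>\<sigma> x. 0 \<le> \<sigma> \<Longrightarrow> \<rho> \<sigma> (x + (b - a)) = \<rho> \<sigma> x" "\<And>\<sigma> x. 0 \<le> \<sigma> \<Longrightarrow> r \<sigma> (x + (b - a)) = r \<sigma> x"
    "\<And>\<sigma> x. 0 \<le> \<sigma> \<Longrightarrow> P \<sigma> (x + (b - a)) = P \<sigma> x" "\<And>\<sigma> x. 0 \<le> \<sigma> \<Longrightarrow> norm (\<rho> \<sigma> x) \<le> C"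
    "\<And>\<sigma> x m. 0 \<le> \<sigma> \<Longrightarrow> real m \<le> \<sigma> \<Longrightarrow> norm (r \<sigma> x) \<le> C / 2 ^ N m \<and> norm (P \<sigma> x) \<le> C / 2 ^ N m"
    "\<And>\<sigma> k. cdiff k UNIV (\<rho> \<sigma>) \<and> cdiff k UNIV (r \<sigma>) \<and> cdiff k UNIV (P \<sigma>)"
    "continuous_on ({0..} \<times> UNIV) (\<lambda>(\<sigma>, x). \<rho> \<sigma> x)"
    "continuous_on ({0..} \<times> UNIV) (\<lambda>(\<sigma>, x). r \<sigma> x)"
    "continuous_on ({0..} \<times> UNIV) (\<lambda>(\<sigma>, x). P \<sigma> x)"
    using oscillation[OF N] by blast
  define \<sigma> where "\<sigma> t = 1 / (t * (1 - t))" for t :: real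
  have \<sigma>0: "0 \<le> \<sigma> t" if "t \<in> {0<..<1}" for t using time_weight_pos[OF that] by (simp add: \<sigma>_def)
  have comp: "continuous_on ({0<..<1} \<times> UNIV) (\<lambda>(t, x). F (\<sigma> t) x)"
    if "continuous_on ({0..} \<times> UNIV) (\<lambda>(\<sigma>, x). F \<sigma> x)" for F :: "real \<Rightarrow> real \<Rightarrow> 'b::real_normed_vector"
  proof -
    have "continuous_on ({0<..<1} \<times> UNIV) (\<lambda>z :: real \<times> real. \<sigma> (fst z))"
      unfolding \<sigma>_def by (intro continuous_intros) auto
    then show ?thesis unfolding case_prod_unfold
      by (rule continuous_on_joint[OF that _ continuous_on_snd[OF continuous_on_id]]) (use \<sigma>0 in auto)
  qed
  have per: "map_on \<Gamma> F" if "\<And>x. F (x + (b - a)) = F x" for F :: "real \<Rightarrow> 'b"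
    using dom that by auto
  have pp: "map_on \<Gamma> (\<rho> (\<sigma> t))" "map_on \<Gamma> (r (\<sigma> t))" "map_on \<Gamma> (P (\<sigma> t))" if t: "t \<in> {0<..<1}" for t
    by (rule per, rule o(3)[OF \<sigma>0[OF t]], rule per, rule o(4)[OF \<sigma>0[OF t]], rule per, rule o(5)[OF \<sigma>0[OF t]])
  have adm: "admissible (e0 * (t * (1 - t))) (\<lambda>t. \<rho> (\<sigma> t)) (\<lambda>t. r (\<sigma> t)) (\<lambda>t. P (\<sigma> t)) t v x"
    if t: "t \<in> {0<..<1}" and x: "x \<in> {a..b}" and v: "norm v \<le> 1" for t x v
  proof -
    have t01: "0 \<le> t" "t \<le> 1" using t by auto
    define m where "m = nat \<lfloor>\<sigma> t\<rfloor>"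
    have m: "real m \<le> \<sigma> t" "\<sigma> t \<le> real (Suc m)" using \<sigma>0[OF t] by (auto simp: m_def) linarith+
    have "1 = \<sigma> t * (t * (1 - t))" using t by (simp add: \<sigma>_def)
    also have "\<dots> \<le> real (Suc m) * (t * (1 - t))" using m(2) time_weight_pos[OF t] by (intro mult_right_mono) auto
    finally have s: "1 \<le> real (Suc m) * (t * (1 - t))" .
    then have tJ: "t \<in> J m" using t01 by (simp add: J_def)
    have "(u t x + tilt_radius t *\<^sub>R v, u1 t x, u2 t x, target_curvature t, \<rho> (\<sigma> t) x) \<in> KK m"
      unfolding KK_def using tJ x v o(6)[OF \<sigma>0[OF t], of x] by (force intro!: image_eqI[where x="(t, x, v, \<rho> (\<sigma> t) x)"])
    moreover have "norm (r (\<sigma> t) x) \<le> d m" "norm (P (\<sigma> t) x) \<le> d m"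
      using o(7)[OF \<sigma>0[OF t] m(1), of x] Nd[of m] by auto
    ultimately have E: "admissible (e0 / real (Suc m)) (\<lambda>t. \<rho> (\<sigma> t)) (\<lambda>t. r (\<sigma> t)) (\<lambda>t. P (\<sigma> t)) t v x"
      unfolding admissible_def slot_def slot'_def by (rule est)
    have "e0 / real (Suc m) \<le> e0 * (t * (1 - t))"
    proof -
      have "e0 * 1 \<le> e0 * (real (Suc m) * (t * (1 - t)))" using e0 by (intro mult_left_mono s) simp
      then have "e0 \<le> e0 * (t * (1 - t)) * real (Suc m)" by (simp only: mult_1_right mult_ac)
      then show ?thesis by (simp only: pos_divide_le_eq of_nat_0_less_iff zero_less_Suc)
    qed
    then show ?thesis
      using E unfolding admissible_def by (meson mult_right_mono norm_ge_zero order_trans)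
  qed
  show thesis
  proof (rule that[of C "\<lambda>t. \<rho> (\<sigma> t)" "\<lambda>t. r (\<sigma> t)" "\<lambda>t. P (\<sigma> t)"])
    fix t x :: real and v :: "real ^ 'n" assume t: "t \<in> {0<..<1}" and x: "x \<in> points \<Gamma>" and v: "norm v \<le> 1"
    have t': "t \<in> {0..1}" using t by auto
    note p = pp[OF t]
    have eq: "u t (reduce x) = u t x" "u1 t (reduce x) = u1 t x" "u2 t (reduce x) = u2 t x"
      "\<rho> (\<sigma> t) (reduce x) = \<rho> (\<sigma> t) x" "r (\<sigma> t) (reduce x) = r (\<sigma> t) x" "P (\<sigma> t) (reduce x) = P (\<sigma> t) x"
      by (rule reduce_eq[OF u_per(1)[OF t']] reduce_eq[OF u_per(2)[OF t']] reduce_eq[OF u_per(3)[OF t]]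
          reduce_eq[OF p(1)] reduce_eq[OF p(2)] reduce_eq[OF p(3)])+
    show "admissible (e0 * (t * (1 - t))) (\<lambda>t. \<rho> (\<sigma> t)) (\<lambda>t. r (\<sigma> t)) (\<lambda>t. P (\<sigma> t)) t v x"
      using adm[OF t reduce_in[OF x] v] unfolding admissible_def slot_def slot'_def eq .
  next
    fix t x :: real assume t: "t \<in> {0<..<1}"
    show "(r (\<sigma> t) has_vector_derivative \<rho> (\<sigma> t) x) (at x)"
      "(P (\<sigma> t) has_vector_derivative isotropic_defect (\<rho> (\<sigma> t) x)) (at x)" "norm (\<rho> (\<sigma> t) x) \<le> C"
      using o(1,2,6)[OF \<sigma>0[OF t]] by blast+
  next
    fix t :: real and k assume t: "t \<in> {0<..<1}"
    show "cdiff k UNIV (r (\<sigma> t))" "cdiff k UNIV (P (\<sigma> t))" using o(8) by blast+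
  next
    show "continuous_on ({0<..<1} \<times> UNIV) (\<lambda>(t, x). \<rho> (\<sigma> t) x)"
      "continuous_on ({0<..<1} \<times> UNIV) (\<lambda>(t, x). r (\<sigma> t) x)"
      "continuous_on ({0<..<1} \<times> UNIV) (\<lambda>(t, x). P (\<sigma> t) x)"
      by (rule comp[OF o(9)], rule comp[OF o(10)], rule comp[OF o(11)])
  qed (rule C pp; assumption?)+
qed

end

text \<open>  For the fixed points one has \<open>d (w s) (w t) \<le> d (w s) (w t) / 2 + d (\<Psi> s (w t)) (\<Psi> t (w t))\<close>, so continuity in
  the parameter is needed for one fixed argument at a time.\<close>

lemma parametrized_contraction:
  fixes \<Psi> :: "'t::metric_space \<Rightarrow> 'v::euclidean_space \<Rightarrow> 'v"
  assumes maps: "\<And>t v. t \<in> T \<Longrightarrow> v \<in> cball 0 1 \<Longrightarrow> \<Psi> t v \<in> cball 0 1"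
    and lip: "\<And>t v w. t \<in> T \<Longrightarrow> v \<in> cball 0 1 \<Longrightarrow> w \<in> cball 0 1 \<Longrightarrow> dist (\<Psi> t v) (\<Psi> t w) \<le> 1 / 2 * dist v w"
    and cont: "\<And>v. v \<in> cball 0 1 \<Longrightarrow> continuous_on T (\<lambda>t. \<Psi> t v)"
  obtains w where "\<And>t. t \<in> T \<Longrightarrow> w t \<in> cball 0 1 \<and> \<Psi> t (w t) = w t" "continuous_on T w"
proof -
  have "\<exists>v. t \<in> T \<longrightarrow> v \<in> cball 0 1 \<and> \<Psi> t v = v" for t
  proof (cases "t \<in> T")
    case True
    have "\<exists>!v. v \<in> cball 0 1 \<and> \<Psi> t v = v"
      by (rule Banach_fix[where c="1 / 2"])
        (use maps[OF True] lip[OF True] in \<open>auto simp: compact_imp_complete simp del: mem_cball\<close>)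
    then show ?thesis by blast
  qed simp
  then obtain w where "\<forall>t. t \<in> T \<longrightarrow> w t \<in> cball 0 1 \<and> \<Psi> t (w t) = w t" by metis
  then have w: "w t \<in> cball 0 1" "\<Psi> t (w t) = w t" if "t \<in> T" for t using that by blast+
  have "continuous_on T w"
    unfolding continuous_on_iff
  proof (intro ballI allI impI)
    fix t e assume t: "t \<in> T" and e: "(0::real) < e"
    have "\<exists>d>0. \<forall>s\<in>T. dist s t < d \<longrightarrow> dist (\<Psi> s (w t)) (\<Psi> t (w t)) < e / 2"
      using cont[OF w(1)[OF t]] t e unfolding continuous_on_iff by (meson half_gt_zero)
    then obtain d where d: "d > 0" "\<And>s. s \<in> T \<Longrightarrow> dist s t < d \<Longrightarrow> dist (\<Psi> s (w t)) (\<Psi> t (w t)) < e / 2" by blast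
    have "dist (w s) (w t) < e" if s: "s \<in> T" "dist s t < d" for s
    proof -
      have "dist (w s) (w t) = dist (\<Psi> s (w s)) (\<Psi> t (w t))" using w(2) s(1) t by simp
      also have "\<dots> \<le> dist (\<Psi> s (w s)) (\<Psi> s (w t)) + dist (\<Psi> s (w t)) (\<Psi> t (w t))" by (rule dist_triangle)
      also have "dist (\<Psi> s (w s)) (\<Psi> s (w t)) \<le> 1 / 2 * dist (w s) (w t)"
        by (rule lip[OF s(1) w(1)[OF s(1)] w(1)[OF t]])
      finally show ?thesis using d(2)[OF s] by simp
    qed
    then show "\<exists>d>0. \<forall>s\<in>T. dist s t < d \<longrightarrow> dist (w s) (w t) < e" using d(1) by blast
  qed
  with w show thesis by (intro that[of w]) auto
qed

lemma has_vector_derivative_chain: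
  assumes "(f has_vector_derivative f') (at x within S)" "(F has_derivative D) (at (f x))"
  shows "((\<lambda>x. F (f x)) has_vector_derivative D f') (at x within S)"
proof -
  have "((\<lambda>x. F (f x)) has_derivative (\<lambda>h. D (h *\<^sub>R f'))) (at x within S)"
    using has_derivative_compose[OF assms(1)[unfolded has_vector_derivative_def] assms(2)] .
  then show ?thesis
    unfolding has_vector_derivative_def using linear_cmul[OF has_derivative_linear[OF assms(2)]] by simp
qed

context corrugation_data
begin

text \<open>  At inner times \<open>Th t\<close> is the corrugated tantrix of \<open>u t + W t\<close>, with the tilt \<open>W t\<close> found by the contraction principle
  if the curve has to close up; at the end times it is the tantrix of \<open>u t\<close>. By \<open>continuous_on_glue_ends\<close> the family and
  its velocities are continuous up to the end times, since tilts, errors and displacements all vanish there.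
  The estimate of the length holds up to every \<open>y\<close>, because the oscillating part of the length is the difference of two
  small values of \<open>length_drift\<close>.\<close>

lemma spherical_family:
  assumes e: "0 < e"
  obtains Th dTh :: "real \<Rightarrow> real \<Rightarrow> real ^ 'n" and W :: "real \<Rightarrow> real ^ 'n" where
    "\<And>t x. t \<in> {0..1} \<Longrightarrow> x \<in> points \<Gamma> \<Longrightarrow> (Th t has_vector_derivative dTh t x) (at x within points \<Gamma>)"
    "\<And>t x. t \<in> {0..1} \<Longrightarrow> x \<in> points \<Gamma> \<Longrightarrow> norm (Th t x) = 1 \<and> dTh t x \<noteq> 0"
    "continuous_on ({0..1} \<times> {a..b}) (\<lambda>(t, x). Th t x)"
    "continuous_on ({0..1} \<times> {a..b}) (\<lambda>(t, x). dTh t x)"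
    "\<And>t. t \<in> {0..1} \<Longrightarrow> map_on \<Gamma> (Th t)" "\<And>t. t \<in> {0..1} \<Longrightarrow> map_on \<Gamma> (dTh t)"
    "\<And>t. t \<in> {0<..<1} \<Longrightarrow> cdiff K (points \<Gamma>) (Th t)"
    "\<And>t x. t \<in> {0, 1} \<Longrightarrow> x \<in> points \<Gamma> \<Longrightarrow> Th t x = sgn (u t x) \<and> dTh t x = sgn_derivative (u t x) (u1 t x)"
    "\<And>t. t \<in> {0..1} \<Longrightarrow> \<Gamma> = Circle a b \<Longrightarrow> integral {a..b} (\<lambda>x. norm (dTh t x) *\<^sub>R Th t x) = 0"
    "\<And>t x. t \<in> {0..1} \<Longrightarrow> x \<in> {a..b} \<Longrightarrow> norm (Th t x - sgn (u t x + W t)) \<le> e"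
    "\<And>t y. t \<in> {0..1} \<Longrightarrow> y \<in> {a..b} \<Longrightarrow>
      \<bar>integral {a..y} (\<lambda>x. norm (dTh t x)) - target_curvature t * integral {a..y} (\<lambda>x. norm (u t x + W t))\<bar> \<le> e"
    "\<And>t. t \<in> {0..1} \<Longrightarrow> norm (W t) \<le> r0"
proof -
  have L: "0 < b - a" using ab by simp
  \<comment> \<open>the first bound serves the estimate of the length, the second makes the closing map a self-map of the unit ball, the third makes it a contraction\<close>
  define e0 where "e0 = min (e / (b - a + 2)) (min (cm * r0) cm)"
  have e0: "0 < e0" using e L cm(1) r0 by (simp add: e0_def)
  have e0': "e0 * (b - a + 2) \<le> e" "e0 \<le> cm * r0" "e0 \<le> cm" "e0 \<le> e"
  proof -
    have "e0 \<le> e / (b - a + 2)" by (simp add: e0_def)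
    then show 1: "e0 * (b - a + 2) \<le> e" using L by (simp add: pos_le_divide_eq)
    have "e0 * 1 \<le> e0 * (b - a + 2)" using e0 L by (intro mult_left_mono) auto
    then show "e0 \<le> e" using 1 by simp
  qed (simp_all add: e0_def)
  obtain C \<rho> r P where C: "0 < C" and
    adm: "\<And>t x v. t \<in> {0<..<1} \<Longrightarrow> x \<in> points \<Gamma> \<Longrightarrow> norm v \<le> 1 \<Longrightarrow> admissible (e0 * (t * (1 - t))) \<rho> r P t v x"
    and r_der: "\<And>t x. t \<in> {0<..<1} \<Longrightarrow> (r t has_vector_derivative \<rho> t x) (at x)"
    and P_der: "\<And>t x. t \<in> {0<..<1} \<Longrightarrow> (P t has_vector_derivative isotropic_defect (\<rho> t x)) (at x)"
    and per: "\<And>t. t \<in> {0<..<1} \<Longrightarrow> map_on \<Gamma> (\<rho> t)" "\<And>t. t \<in> {0<..<1} \<Longrightarrow> map_on \<Gamma> (r t)" "\<And>t. t \<in> {0<..<1} \<Longrightarrow> map_on \<Gamma> (P t)"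
    and \<rho>C: "\<And>t x. t \<in> {0<..<1} \<Longrightarrow> norm (\<rho> t x) \<le> C"
    and smooth: "\<And>t k. t \<in> {0<..<1} \<Longrightarrow> cdiff k UNIV (r t)" "\<And>t k. t \<in> {0<..<1} \<Longrightarrow> cdiff k UNIV (P t)"
    and conts: "continuous_on ({0<..<1} \<times> UNIV) (\<lambda>(t, x). \<rho> t x)"
      "continuous_on ({0<..<1} \<times> UNIV) (\<lambda>(t, x). r t x)"
      "continuous_on ({0<..<1} \<times> UNIV) (\<lambda>(t, x). P t x)"
  proof -
    show thesis by (rule corrugation[OF e0]) (fact that)
  qed
  define E where "E t = e0 * (t * (1 - t))" for t
  have E: "0 \<le> E t" "E t \<le> e0" if "t \<in> {0..1}" for t
  proof -
    show "0 \<le> E t" using e0 time_weight(1)[OF that] by (simp add: E_def)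
    have "e0 * (t * (1 - t)) \<le> e0 * 1" using e0 time_weight(2)[OF that] by (intro mult_left_mono) auto
    then show "E t \<le> e0" by (simp add: E_def)
  qed
  let ?s = "slot r P" and ?s' = "slot' \<rho>"
  let ?U = "\<lambda>t v x. u t x + tilt_radius t *\<^sub>R v"
  note adm' = adm[folded E_def, unfolded admissible_def]
  have in2: "(?s t v x, ?s' t x) \<in> immersed_slots" if "t \<in> {0<..<1}" "x \<in> points \<Gamma>" "norm v \<le> 1" for t x v
    using adm'[OF that] by blast
  have in1: "?s t v x \<in> nonzero_slots" if "t \<in> {0<..<1}" "x \<in> points \<Gamma>" "norm v \<le> 1" for t x v
    using in2[OF that] by (auto simp: immersed_slots_def)
  have t01: "t \<in> {0..1}" if "t \<in> {0<..<1}" for t :: real using that by auto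
  have s_per: "map_on \<Gamma> (?s t v)" "map_on \<Gamma> (?s' t)" if "t \<in> {0<..<1}" for t v
    using dom u_per(1,2)[OF t01[OF that]] u_per(3)[OF that] per[OF that] by (auto simp: slot_def slot'_def)
  have s_der: "(?s t v has_vector_derivative ?s' t x) (at x)" if "t \<in> {0<..<1}" for t v x
    unfolding slot_def[abs_def] slot'_def velocity_def
    by (intro has_vector_derivative_Pair u1_der[OF that] r_der[OF that] P_der[OF that] has_vector_derivative_const
        has_vector_derivative_add_const[THEN iffD2] u_der[OF t01[OF that]])
  have T_der: "((\<lambda>x. corrugated_tantrix (?s t v x)) has_vector_derivative corrugated_tantrix_velocity (?s t v x) (?s' t x)) (at x)"
    if "t \<in> {0<..<1}" "x \<in> points \<Gamma>" "norm v \<le> 1" for t v x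
    unfolding corrugated_tantrix_velocity_def
    by (rule has_vector_derivative_chain[OF s_der[OF that(1)]]) (rule cdiff_frechet(1)[OF cdiff_corrugated_tantrix open_nonzero_slots in1[OF that]])
  have in0: "?s t v x \<in> regular_slots" if "t \<in> {0<..<1}" "x \<in> points \<Gamma>" "norm v \<le> 1" for t x v
    using in1[OF that] nonzero_slots_subset by blast
  have d_der: "((\<lambda>x. centroid_drift (?s t v x)) has_vector_derivative centroid_drift_velocity (?s t v x) (?s' t x)) (at x)"
    and ld_der: "((\<lambda>x. length_drift (?s t v x)) has_vector_derivative length_drift_velocity (?s t v x) (?s' t x)) (at x)"
    if "t \<in> {0<..<1}" "x \<in> points \<Gamma>" "norm v \<le> 1" for t v x
    unfolding centroid_drift_velocity_def length_drift_velocity_def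
    by (rule has_vector_derivative_chain[OF s_der[OF that(1)]],
        rule cdiff_frechet(1)[OF cdiff_centroid_drift open_regular_slots in0[OF that]],
        rule has_vector_derivative_chain[OF s_der[OF that(1)]],
        rule cdiff_frechet(1)[OF cdiff_length_drift open_regular_slots in0[OF that]])
  have IS: "x \<in> points \<Gamma>" if "x \<in> {a..b}" for x using that Icc_subset by blast
  \<comment> \<open>the time \<open>g w\<close>, the position \<open>h w\<close> and the tilt \<open>k w\<close> vary continuously with a common parameter \<open>w\<close>\<close>
  have slot_cont: "continuous_on A (\<lambda>w. ?s (g w) (k w) (h w))" "continuous_on A (\<lambda>w. ?s' (g w) (h w))"
    if "continuous_on A g" "continuous_on A h" "continuous_on A k" "\<And>w. w \<in> A \<Longrightarrow> g w \<in> {0<..<1}"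
    for A :: "'z::topological_space set" and g h k
  proof -
    note c = continuous_on_joint[OF _ that(1,2)]
    have ss: "\<And>w. w \<in> A \<Longrightarrow> g w \<in> {0..1}" using that(4) t01 by blast
    have cc: "continuous_on A (\<lambda>w. target_curvature (g w))"
      by (rule continuous_on_compose2[OF target_curvature_cont that(1)]) (use ss in auto)
    have cr: "continuous_on A (\<lambda>w. tilt_radius (g w))"
      by (rule continuous_on_compose2[OF tilt_radius_cont[of UNIV] that(1)]) auto
    show "continuous_on A (\<lambda>w. ?s (g w) (k w) (h w))"
      unfolding slot_def
      by (intro continuous_on_Pair continuous_on_add continuous_on_scaleR cc cr that(3)
          c[OF u_cont] c[OF u1_cont] c[OF conts(2)] c[OF conts(3)] ss that(4) UNIV_I)
    show "continuous_on A (\<lambda>w. ?s' (g w) (h w))"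
      unfolding slot'_def velocity_def
      by (intro continuous_on_Pair continuous_on_const continuous_on_isotropic_defect
          c[OF u1_cont] c[OF u2_cont] c[OF conts(1)] ss that(4) UNIV_I)
  qed
  have mo_cont: "continuous_on A (\<lambda>w. centroid_density (?s (g w) (k w) (h w), ?s' (g w) (h w)))"
      "continuous_on A (\<lambda>w. length_density (?s (g w) (k w) (h w), ?s' (g w) (h w)))"
      "continuous_on A (\<lambda>w. corrugated_tantrix (?s (g w) (k w) (h w)))"
      "continuous_on A (\<lambda>w. corrugated_tantrix_velocity (?s (g w) (k w) (h w)) (?s' (g w) (h w)))"
    if "continuous_on A g" "continuous_on A h" "continuous_on A k" "\<And>w. w \<in> A \<Longrightarrow> g w \<in> {0<..<1}"
      "\<And>w. w \<in> A \<Longrightarrow> h w \<in> points \<Gamma>" "\<And>w. w \<in> A \<Longrightarrow> norm (k w) \<le> 1"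
    for A :: "'z::topological_space set" and g h k
  proof -
    note sc = slot_cont[OF that(1-4)]
    have 2: "(\<lambda>w. (?s (g w) (k w) (h w), ?s' (g w) (h w))) ` A \<subseteq> immersed_slots"
      using in2 that(4-6) by (intro image_subsetI) blast
    have 1: "(\<lambda>w. ?s (g w) (k w) (h w)) ` A \<subseteq> nonzero_slots" using in1 that(4-6) by (intro image_subsetI) blast
    show "continuous_on A (\<lambda>w. centroid_density (?s (g w) (k w) (h w), ?s' (g w) (h w)))"
      by (rule continuous_on_compose2[OF cdiff_continuous_on[OF cdiff_centroid_density[of 0]] continuous_on_Pair[OF sc] 2])
    show "continuous_on A (\<lambda>w. length_density (?s (g w) (k w) (h w), ?s' (g w) (h w)))"
      by (rule continuous_on_compose2[OF cdiff_continuous_on[OF cdiff_length_density[of 0]] continuous_on_Pair[OF sc] 2])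
    show "continuous_on A (\<lambda>w. corrugated_tantrix (?s (g w) (k w) (h w)))"
      by (rule continuous_on_compose2[OF cdiff_continuous_on[OF cdiff_corrugated_tantrix[of 0]] sc(1) 1])
    show "continuous_on A (\<lambda>w. corrugated_tantrix_velocity (?s (g w) (k w) (h w)) (?s' (g w) (h w)))"
      by (rule continuous_on_joint[OF cdiff_continuous_on[OF cdiff_corrugated_tantrix_velocity[of 0]] sc]) (use in1 that(4-6) in blast)+
  qed
  \<comment> \<open>the tilt is \<open>tilt_radius t *\<^sub>R v\<close>, so that \<open>v\<close> ranges over the unit ball at all times\<close>
  have "\<exists>v. (\<forall>t\<in>{0<..<1}. norm (v t) \<le> 1 \<and> (\<Gamma> = Circle a b \<longrightarrow>
      integral {a..b} (\<lambda>x. centroid_density (?s t (v t) x, ?s' t x)) = 0)) \<and> continuous_on {0<..<1} v"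
  proof (cases "\<Gamma> = Circle a b")
    case False
    then show ?thesis by (intro exI[of _ "\<lambda>_. 0"]) auto
  next
    case True
    \<comment> \<open>the integral of \<open>target_curvature t *\<^sub>R (u t x + tilt_radius t *\<^sub>R v)\<close> is a nonzero multiple of \<open>v\<close>; a fixed point of \<open>\<Psi>\<close> is a zero of the centroid\<close>
    define err where "err t v x = centroid_density (?s t v x, ?s' t x) - target_curvature t *\<^sub>R ?U t v x" for t v x
    define \<Psi> where "\<Psi> t v = v - inverse (target_curvature t * (b - a) * tilt_radius t) *\<^sub>R integral {a..b} (\<lambda>x. centroid_density (?s t v x, ?s' t x))" for t v
    have mo_int: "(\<lambda>x. centroid_density (?s t v x, ?s' t x)) integrable_on {a..b}" if "t \<in> {0<..<1}" "norm v \<le> 1" for t v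
      by (intro integrable_continuous_real mo_cont(1) continuous_on_const continuous_on_id)
        (use that IS in auto)
    have U_int: "((\<lambda>x. target_curvature t *\<^sub>R ?U t v x) has_integral target_curvature t *\<^sub>R ((b - a) *\<^sub>R (tilt_radius t *\<^sub>R v))) {a..b}" if "t \<in> {0<..<1}" for t v
    proof -
      have "continuous_on {a..b} (u t)"
        by (rule continuous_on_subset[OF continuous_on_slice[OF u_cont t01[OF that]]]) simp
      then have "(u t has_integral 0) {a..b}"
        using u_mean[OF t01[OF that] True] integrable_integral[OF integrable_continuous_real] by fastforce
      moreover have "((\<lambda>x. tilt_radius t *\<^sub>R v) has_integral (b - a) *\<^sub>R (tilt_radius t *\<^sub>R v)) {a..b}"
        using has_integral_const_real[of "tilt_radius t *\<^sub>R v" a b] ab by simp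
      ultimately have "((\<lambda>x. ?U t v x) has_integral 0 + (b - a) *\<^sub>R (tilt_radius t *\<^sub>R v)) {a..b}" by (rule has_integral_add)
      from has_integral_cmul[OF this, of "target_curvature t"] show ?thesis by simp
    qed
    have err_int: "err t v integrable_on {a..b}" "\<Psi> t v = - inverse (target_curvature t * (b - a) * tilt_radius t) *\<^sub>R integral {a..b} (err t v)"
      if "t \<in> {0<..<1}" "norm v \<le> 1" for t v
    proof -
      have h: "(err t v has_integral integral {a..b} (\<lambda>x. centroid_density (?s t v x, ?s' t x)) - target_curvature t *\<^sub>R ((b - a) *\<^sub>R (tilt_radius t *\<^sub>R v))) {a..b}"
        unfolding err_def[abs_def] by (rule has_integral_diff[OF integrable_integral[OF mo_int[OF that]] U_int[OF that(1)]])
      then show "err t v integrable_on {a..b}" by (rule has_integral_integrable)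
      have nz: "target_curvature t * (b - a) * tilt_radius t \<noteq> 0" using target_curvature_pos[OF t01[OF that(1)]] L tilt_radius_pos[OF that(1)] by simp
      have c: "target_curvature t *\<^sub>R ((b - a) *\<^sub>R (tilt_radius t *\<^sub>R v)) = (target_curvature t * (b - a) * tilt_radius t) *\<^sub>R v" by (simp add: mult.assoc)
      then show "\<Psi> t v = - inverse (target_curvature t * (b - a) * tilt_radius t) *\<^sub>R integral {a..b} (err t v)"
        unfolding \<Psi>_def integral_unique[OF h] c
        by (simp only: scaleR_diff_right scaleR_scaleR left_inverse[OF nz] minus_mult_left[symmetric] scaleR_minus_left mult_minus_left)
          simp
    qed
    have err_le: "norm (err t v x) \<le> E t" if "t \<in> {0<..<1}" "norm v \<le> 1" "x \<in> {a..b}" for t v x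
      using adm'[OF that(1) IS[OF that(3)] that(2)] by (simp add: err_def)
    have err_lip: "norm (err t v x - err t w x) \<le> E t * tilt_radius t * norm (v - w)"
      if "t \<in> {0<..<1}" "norm v \<le> 1" "norm w \<le> 1" "x \<in> {a..b}" for t v w x
    proof -
      let ?D = "\<lambda>v. frechet_derivative centroid_density (at (?s t v x, ?s' t x))"
      have "norm (err t v x - err t w x) \<le> (E t * tilt_radius t) * norm (v - w)"
      proof (rule differentiable_bound[where S="cball 0 1" and f="\<lambda>v. err t v x" and
            f'="\<lambda>v h. ?D v (tilt (tilt_radius t *\<^sub>R h)) - target_curvature t *\<^sub>R (tilt_radius t *\<^sub>R h)"])
        fix y :: "real ^ 'n" assume y: "y \<in> cball 0 1"
        have yn: "norm y \<le> 1" using y by simp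
        have 1: "(centroid_density has_derivative ?D y) (at (?s t y x, ?s' t x))"
          by (rule cdiff_frechet(1)[OF cdiff_centroid_density open_immersed_slots in2[OF that(1) IS[OF that(4)] yn]])
        have 2: "((\<lambda>v. (?s t v x, ?s' t x)) has_derivative (\<lambda>h. tilt (tilt_radius t *\<^sub>R h))) (at y within cball 0 1)"
          unfolding slot_def tilt_def slot'_def velocity_def
          by (auto intro!: derivative_eq_intros simp: zero_prod_def)
        have "((\<lambda>v. centroid_density (?s t v x, ?s' t x)) has_derivative (\<lambda>h. ?D y (tilt (tilt_radius t *\<^sub>R h)))) (at y within cball 0 1)"
          by (rule has_derivative_compose[OF 2 1])
        then show "((\<lambda>v. err t v x) has_derivative (\<lambda>h. ?D y (tilt (tilt_radius t *\<^sub>R h)) - target_curvature t *\<^sub>R (tilt_radius t *\<^sub>R h))) (at y within cball 0 1)"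
          unfolding err_def by (auto intro!: derivative_eq_intros)
        show "onorm (\<lambda>h. ?D y (tilt (tilt_radius t *\<^sub>R h)) - target_curvature t *\<^sub>R (tilt_radius t *\<^sub>R h)) \<le> E t * tilt_radius t"
        proof (rule onorm_le)
          fix h
          have "norm (?D y (tilt (tilt_radius t *\<^sub>R h)) - target_curvature t *\<^sub>R (tilt_radius t *\<^sub>R h)) \<le> E t * norm (tilt_radius t *\<^sub>R h)"
            using adm'[OF that(1) IS[OF that(4)] yn] by blast
          then show "norm (?D y (tilt (tilt_radius t *\<^sub>R h)) - target_curvature t *\<^sub>R (tilt_radius t *\<^sub>R h)) \<le> E t * tilt_radius t * norm h"
            using tilt_radius_pos[OF that(1)] by simp
        qed
      qed (use that in auto)
      then show ?thesis .
    qed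
    have int_le: "norm (integral {a..b} g) \<le> B * (b - a)" if "g integrable_on {a..b}" "\<And>x. x \<in> {a..b} \<Longrightarrow> norm (g x) \<le> B"
      for g :: "real \<Rightarrow> real ^ 'n" and B
    proof -
      have "norm (integral {a..b} g) \<le> integral {a..b} (\<lambda>x. B)"
        by (rule integral_norm_bound_integral) (use that in \<open>auto intro: integrable_continuous_real\<close>)
      then show ?thesis using ab by (simp add: mult.commute)
    qed
    have alg: "inverse (c * l * (s * d)) * (e' * d * l) = e' / (c * s)"
      "inverse (c * l * (s * d)) * (e' * d * (s * d) * B * l) = e' * d / c * B"
      "0 < inverse (c * l * (s * d))" if "0 < c" "0 < l" "0 < s" "0 < d" for c l s d e' B :: real
      using that by (simp_all add: field_simps)
    have q: "inverse (target_curvature t * (b - a) * tilt_radius t) * (E t * (b - a)) = e0 / (target_curvature t * r0)"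
      "inverse (target_curvature t * (b - a) * tilt_radius t) * (E t * tilt_radius t * B * (b - a)) = E t / target_curvature t * B"
      "0 < inverse (target_curvature t * (b - a) * tilt_radius t)"
      if "t \<in> {0<..<1}" for t B
      unfolding E_def tilt_radius_def by (rule alg[OF target_curvature_pos[OF t01[OF that]] L r0 time_weight_pos[OF that]])+
    have maps: "\<Psi> t v \<in> cball 0 1" if t: "t \<in> {0<..<1}" and v: "v \<in> cball 0 1" for t v
    proof -
      have v': "norm v \<le> 1" using v by simp
      have "norm (\<Psi> t v) = inverse (target_curvature t * (b - a) * tilt_radius t) * norm (integral {a..b} (err t v))"
        unfolding err_int(2)[OF t v'] using q(3)[OF t] by simp
      also have "\<dots> \<le> inverse (target_curvature t * (b - a) * tilt_radius t) * (E t * (b - a))"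
        using q(3)[OF t] by (intro mult_left_mono int_le err_int(1)[OF t v'] err_le[OF t v']) auto
      also have "\<dots> = e0 / (target_curvature t * r0)" by (rule q(1)[OF t])
      also have "\<dots> \<le> 1"
      proof -
        have "e0 \<le> cm * r0" by (rule e0')
        also have "\<dots> \<le> target_curvature t * r0" using target_curvature_ge[OF t01[OF t]] r0 by (intro mult_right_mono) auto
        finally show ?thesis using target_curvature_pos[OF t01[OF t]] r0 by (simp add: pos_divide_le_eq)
      qed
      finally show ?thesis by simp
    qed
    have lip: "dist (\<Psi> t v) (\<Psi> t w) \<le> 1 / 2 * dist v w" if t: "t \<in> {0<..<1}" and v: "v \<in> cball 0 1" "w \<in> cball 0 1" for t v w
    proof -
      have v': "norm v \<le> 1" "norm w \<le> 1" using v by simp_all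
      note i = err_int(1)[OF t v'(1)] err_int(1)[OF t v'(2)]
      have "\<Psi> t v - \<Psi> t w = - inverse (target_curvature t * (b - a) * tilt_radius t) *\<^sub>R integral {a..b} (\<lambda>x. err t v x - err t w x)"
        unfolding err_int(2)[OF t v'(1)] err_int(2)[OF t v'(2)] integral_diff[OF i] by (simp add: scaleR_diff_right)
      then have "dist (\<Psi> t v) (\<Psi> t w) = inverse (target_curvature t * (b - a) * tilt_radius t) * norm (integral {a..b} (\<lambda>x. err t v x - err t w x))"
        using q(3)[OF t] by (simp add: dist_norm)
      also have "\<dots> \<le> inverse (target_curvature t * (b - a) * tilt_radius t) * (E t * tilt_radius t * norm (v - w) * (b - a))"
        using q(3)[OF t] by (intro mult_left_mono int_le integrable_diff i err_lip[OF t v']) auto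
      also have "\<dots> = E t / target_curvature t * norm (v - w)" by (rule q(2)[OF t])
      also have "\<dots> \<le> 1 / 2 * norm (v - w)"
      proof (rule mult_right_mono)
        have "E t \<le> cm * (1 / 4)"
          unfolding E_def using e0'(3) e0 time_weight[OF t01[OF t]] cm(1) by (intro mult_mono) auto
        then have "2 * E t \<le> target_curvature t" using target_curvature_ge[OF t01[OF t]] cm(1) by linarith
        then show "E t / target_curvature t \<le> 1 / 2" using target_curvature_pos[OF t01[OF t]] by (simp add: field_simps)
      qed simp
      finally show ?thesis by (simp add: dist_norm)
    qed
    have cont: "continuous_on {0<..<1} (\<lambda>t. \<Psi> t v)" if v: "v \<in> cball 0 1" for v
    proof -
      have v': "norm v \<le> 1" using v by simp
      have "continuous_on ({0<..<1} \<times> cbox a b) (\<lambda>w. centroid_density (?s (fst w) v (snd w), ?s' (fst w) (snd w)))"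
        by (rule mo_cont(1)) (use v' IS in \<open>auto intro: continuous_intros\<close>)
      then have "continuous_on {0<..<1} (\<lambda>t. integral (cbox a b) (\<lambda>x. centroid_density (?s t v x, ?s' t x)))"
        by (intro integral_continuous_on_param) (simp add: case_prod_unfold)
      moreover have "continuous_on {0<..<1} target_curvature" by (rule continuous_on_subset[OF target_curvature_cont]) auto
      moreover have "target_curvature t * (b - a) * tilt_radius t \<noteq> 0" if "t \<in> {0<..<1}" for t using q(3)[OF that] by auto
      ultimately show ?thesis
        unfolding \<Psi>_def by (intro continuous_on_diff continuous_on_const continuous_on_scaleR continuous_on_inverse
            continuous_on_mult tilt_radius_cont ballI) auto
    qed
    obtain v where v: "\<And>t. t \<in> {0<..<1} \<Longrightarrow> v t \<in> cball 0 1 \<and> \<Psi> t (v t) = v t" "continuous_on {0<..<1} v"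
      using parametrized_contraction[of "{0<..<1}" \<Psi>, OF maps lip cont] by blast
    have "integral {a..b} (\<lambda>x. centroid_density (?s t (v t) x, ?s' t x)) = 0" if t: "t \<in> {0<..<1}" for t
    proof -
      define X where "X = inverse (target_curvature t * (b - a) * tilt_radius t) *\<^sub>R integral {a..b} (\<lambda>x. centroid_density (?s t (v t) x, ?s' t x))"
      have "v t - X = v t" using v(1)[OF t] unfolding \<Psi>_def X_def by blast
      then have "X = 0" by simp
      then have "inverse (target_curvature t * (b - a) * tilt_radius t) *\<^sub>R integral {a..b} (\<lambda>x. centroid_density (?s t (v t) x, ?s' t x)) = 0"
        by (simp only: X_def)
      then show ?thesis using q(3)[OF t] unfolding scaleR_eq_0_iff by (metis less_irrefl)
    qed
    then show ?thesis using v by (intro exI[of _ v]) auto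
  qed
  then obtain v where v: "\<And>t. t \<in> {0<..<1} \<Longrightarrow> norm (v t) \<le> 1"
    "\<And>t. t \<in> {0<..<1} \<Longrightarrow> \<Gamma> = Circle a b \<Longrightarrow> integral {a..b} (\<lambda>x. centroid_density (?s t (v t) x, ?s' t x)) = 0"
    "continuous_on {0<..<1} v" by blast
  define W where "W t = (if t \<in> {0<..<1} then tilt_radius t *\<^sub>R v t else 0)" for t
  define Th where "Th t x = (if t \<in> {0<..<1} then corrugated_tantrix (?s t (v t) x) else sgn (u t x))" for t x
  define dTh where "dTh t x = (if t \<in> {0<..<1} then corrugated_tantrix_velocity (?s t (v t) x) (?s' t x) else sgn_derivative (u t x) (u1 t x))" for t x
  have W_le: "norm (W t) \<le> tilt_radius t" if "t \<in> {0..1}" for t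
    using v(1)[of t] tilt_radius_le(1)[OF that] mult_left_mono[of "norm (v t)" 1 "tilt_radius t"] by (auto simp: W_def)
  have cases01: "t \<in> {0<..<1} \<or> t \<in> {0, 1}" if "t \<in> {0..1::real}" for t using that by auto
  have W_r0: "norm (W t) \<le> r0" if "t \<in> {0..1}" for t using W_le[OF that] tilt_radius_le(2)[OF that] by linarith
  have ndS: "u t x + W t \<noteq> 0" "sgn_derivative (u t x + W t) (u1 t x) \<noteq> 0" if "t \<in> {0..1}" "x \<in> points \<Gamma>" for t x
    using nondeg[OF that(1) reduce_in[OF that(2)] W_r0[OF that(1)]]
    unfolding reduce_eq[OF u_per(1)[OF that(1)]] reduce_eq[OF u_per(2)[OF that(1)]] by auto
  have W0: "W t = 0" if "t \<in> {0, 1}" for t using that by (auto simp: W_def)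
  have jet_curvature_le: "jet_curvature (u t x + W t) (u1 t x) \<le> target_curvature t" if "t \<in> {0..1}" "x \<in> {a..b}" for t x
  proof (cases "t \<in> {0<..<1}")
    case True
    then have Wt: "W t = tilt_radius t *\<^sub>R v t" by (simp add: W_def)
    show ?thesis using jet_curvature_le_target_curvature[OF that v(1)[OF True]] time_weight(1)[OF that(1)] unfolding Wt by linarith
  next
    case False
    then have "t \<in> {0, 1}" using cases01[OF that(1)] by blast
    then show ?thesis using target_curvature_ends[of t x] that W0[of t] by simp
  qed
  have W_cont: "continuous_on {0..1} W"
  proof -
    have "continuous_on ({0..1} \<times> {0::real}) (\<lambda>z. W (fst z))"
    proof (rule continuous_on_glue_ends[where G="\<lambda>_. 0" and \<eta>="\<lambda>z. tilt_radius (fst z)"])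
      have "continuous_on ({0<..<1} \<times> {0::real}) (\<lambda>z. tilt_radius (fst z) *\<^sub>R v (fst z))"
        by (intro continuous_on_scaleR continuous_on_compose2[OF tilt_radius_cont[of UNIV]] continuous_on_compose2[OF v(3)] continuous_intros) auto
      then show "continuous_on ({0<..<1} \<times> {0::real}) (\<lambda>z. W (fst z))"
        by (rule iffD1[OF continuous_on_cong, rotated 2]) (auto simp: W_def)
      show "continuous_on ({0..1} \<times> {0::real}) (\<lambda>z. tilt_radius (fst z))"
        by (rule continuous_on_compose2[OF tilt_radius_cont[of UNIV]]) (auto intro: continuous_intros)
    next
      fix t :: real and x :: real assume "t \<in> {0<..<1}"
      then show "norm (W (fst (t, x)) - 0) \<le> tilt_radius (fst (t, x))" using W_le[of t] by simp
    qed (auto simp: W_def tilt_radius_def)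
    from continuous_on_compose2[OF this, of "{0..1}" "\<lambda>t. (t, 0)"] show ?thesis by (force intro: continuous_intros)
  qed
  have cU: "continuous_on ({0..1} \<times> {a..b}) (\<lambda>z. u (fst z) (snd z) + W (fst z))"
    by (intro continuous_on_add continuous_on_joint[OF u_cont] continuous_on_compose2[OF W_cont] continuous_intros) auto
  have cu1: "continuous_on ({0..1} \<times> {a..b}) (\<lambda>z. u1 (fst z) (snd z))"
    by (intro continuous_on_joint[OF u1_cont] continuous_intros) auto
  have cE: "continuous_on ({0..1} \<times> {a..b}) (\<lambda>z. E (fst z))" unfolding E_def by (intro continuous_intros)
  have ndI: "u (fst z) (snd z) + W (fst z) \<noteq> 0" "sgn_derivative (u (fst z) (snd z) + W (fst z)) (u1 (fst z) (snd z)) \<noteq> 0"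
    if "z \<in> {0..1} \<times> {a..b}" for z using ndS[of "fst z" "snd z"] that IS by (auto simp: mem_Times_iff)
  have csgn: "continuous_on ({0..1} \<times> {a..b}) (\<lambda>z. sgn (u (fst z) (snd z) + W (fst z)))"
    using cdiff_sgn[of 0 "{0..1} \<times> {a..b}", OF _ ndI(1)] cU by simp
  have ctau: "continuous_on ({0..1} \<times> {a..b}) (\<lambda>z. sgn_derivative (u (fst z) (snd z) + W (fst z)) (u1 (fst z) (snd z)))"
    using cdiff_sgn_derivative[of 0 "{0..1} \<times> {a..b}", OF _ _ ndI(1)] cU cu1 by simp
  have ckap: "continuous_on ({0..1} \<times> {a..b}) (\<lambda>z. jet_curvature (u (fst z) (snd z) + W (fst z)) (u1 (fst z) (snd z)))"
    using cdiff_jet_curvature[of 0 "{0..1} \<times> {a..b}", OF _ _ ndI] cU cu1 by simp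
  have ccurv: "continuous_on ({0..1} \<times> {a..b}) (\<lambda>z. target_curvature (fst z))"
    by (rule continuous_on_compose2[OF target_curvature_cont]) (auto intro: continuous_intros)
  have open_args: "continuous_on ({0<..<1} \<times> {a..b}) (\<lambda>z. v (fst z))"
    by (rule continuous_on_compose2[OF v(3)]) (auto intro: continuous_intros)
  have cont_Th: "continuous_on ({0..1} \<times> {a..b}) (\<lambda>z. Th (fst z) (snd z))"
  proof (rule continuous_on_glue_ends[OF _ csgn cE])
    have "continuous_on ({0<..<1} \<times> {a..b}) (\<lambda>z. corrugated_tantrix (?s (fst z) (v (fst z)) (snd z)))"
      by (rule mo_cont(3)[OF _ _ open_args]) (use v(1) IS in \<open>auto intro: continuous_intros\<close>)
    then show "continuous_on ({0<..<1} \<times> {a..b}) (\<lambda>z. Th (fst z) (snd z))"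
      by (rule iffD1[OF continuous_on_cong, rotated 2]) (auto simp: Th_def)
  next
    fix t x assume t: "t \<in> {0<..<1::real}" and x: "x \<in> {a..b}"
    show "norm (Th (fst (t, x)) (snd (t, x)) - sgn (u (fst (t, x)) (snd (t, x)) + W (fst (t, x)))) \<le> E (fst (t, x))"
      using adm'[OF t IS[OF x] v(1)[OF t]] t by (simp add: Th_def W_def)
  qed (auto simp: Th_def W_def E_def)
  \<comment> \<open>this bound vanishes at the end times because the target curvature is attained there\<close>
  define \<eta> where "\<eta> z = E (fst z) + norm (u (fst z) (snd z) + W (fst z)) *
    (sqrt ((target_curvature (fst z))\<^sup>2 - (jet_curvature (u (fst z) (snd z) + W (fst z)) (u1 (fst z) (snd z)))\<^sup>2) * C +
     (target_curvature (fst z) - jet_curvature (u (fst z) (snd z) + W (fst z)) (u1 (fst z) (snd z))) / 2 * (C\<^sup>2 + 1))" for z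
  have cont_dTh: "continuous_on ({0..1} \<times> {a..b}) (\<lambda>z. dTh (fst z) (snd z))"
  proof (rule continuous_on_glue_ends[OF _ ctau])
    have "continuous_on ({0<..<1} \<times> {a..b}) (\<lambda>z. corrugated_tantrix_velocity (?s (fst z) (v (fst z)) (snd z)) (?s' (fst z) (snd z)))"
      by (rule mo_cont(4)[OF _ _ open_args]) (use v(1) IS in \<open>auto intro: continuous_intros\<close>)
    then show "continuous_on ({0<..<1} \<times> {a..b}) (\<lambda>z. dTh (fst z) (snd z))"
      by (rule iffD1[OF continuous_on_cong, rotated 2]) (auto simp: dTh_def)
    show "continuous_on ({0..1} \<times> {a..b}) \<eta>"
      unfolding \<eta>_def by (intro continuous_intros cE cU ckap ccurv) auto
  next
    fix t x :: real assume t: "t \<in> {0, 1}" and x: "x \<in> {a..b}"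
    have "t * (1 - t) = 0" using t by auto
    then show "dTh (fst (t, x)) (snd (t, x)) = sgn_derivative (u (fst (t, x)) (snd (t, x)) + W (fst (t, x))) (u1 (fst (t, x)) (snd (t, x))) \<and> \<eta> (t, x) = 0"
      using t target_curvature_ends[OF t x] W0[OF t] by (auto simp: dTh_def \<eta>_def E_def)
  next
    fix t x assume t: "t \<in> {0<..<1::real}" and x: "x \<in> {a..b}"
    let ?p = "u t x + W t" and ?k = "jet_curvature (u t x + W t) (u1 t x)"
    have nd: "?p \<noteq> 0" "sgn_derivative ?p (u1 t x) \<noteq> 0" using ndS[OF t01[OF t] IS[OF x]] .
    have "?k + t * (1 - t) \<le> target_curvature t" using jet_curvature_le_target_curvature[OF t01[OF t] x v(1)[OF t]] t by (simp add: W_def)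
    then have kc: "?k < target_curvature t" using time_weight_pos[OF t] by linarith
    have kc2: "0 \<le> (target_curvature t)\<^sup>2 - ?k\<^sup>2" using power_mono[OF less_imp_le[OF kc] jet_curvature_nonneg, of 2] by simp
    have "norm (dTh t x - leading_velocity ?p (u1 t x) (target_curvature t) (\<rho> t x)) \<le> E t"
      using adm'[OF t IS[OF x] v(1)[OF t]] t by (simp add: dTh_def W_def)
    moreover have "norm (leading_velocity ?p (u1 t x) (target_curvature t) (\<rho> t x) - sgn_derivative ?p (u1 t x)) \<le>
        norm ?p * (sqrt ((target_curvature t)\<^sup>2 - ?k\<^sup>2) * norm (\<rho> t x) + (target_curvature t - ?k) / 2 * ((norm (\<rho> t x))\<^sup>2 + 1))"
      using norm_displacement_le[OF nd n kc, of "\<rho> t x"] by (simp add: leading_velocity_def)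
    moreover have "\<dots> \<le> norm ?p * (sqrt ((target_curvature t)\<^sup>2 - ?k\<^sup>2) * C + (target_curvature t - ?k) / 2 * (C\<^sup>2 + 1))"
      using \<rho>C[OF t, of x] kc kc2 by (intro mult_left_mono add_mono power_mono) auto
    moreover have "norm (dTh t x - sgn_derivative ?p (u1 t x)) \<le> norm (dTh t x - leading_velocity ?p (u1 t x) (target_curvature t) (\<rho> t x)) +
        norm (leading_velocity ?p (u1 t x) (target_curvature t) (\<rho> t x) - sgn_derivative ?p (u1 t x))"
      using norm_triangle_ineq[of "dTh t x - leading_velocity ?p (u1 t x) (target_curvature t) (\<rho> t x)"
          "leading_velocity ?p (u1 t x) (target_curvature t) (\<rho> t x) - sgn_derivative ?p (u1 t x)"] by simp
    ultimately show "norm (dTh (fst (t, x)) (snd (t, x)) - sgn_derivative (u (fst (t, x)) (snd (t, x)) + W (fst (t, x))) (u1 (fst (t, x)) (snd (t, x)))) \<le> \<eta> (t, x)"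
      unfolding \<eta>_def by simp
  qed
  have sub: "{a..y} \<subseteq> points \<Gamma>" "{a..y} \<subseteq> {a..b}" if "y \<in> {a..b}" for y using that IS by auto
  show thesis
  proof (rule that[of Th dTh W])
    fix t x :: real assume t: "t \<in> {0..1}" and x: "x \<in> points \<Gamma>"
    show "(Th t has_vector_derivative dTh t x) (at x within points \<Gamma>)"
    proof (cases "t \<in> {0<..<1}")
      case True
      then have "Th t = (\<lambda>x. corrugated_tantrix (?s t (v t) x))" "dTh t x = corrugated_tantrix_velocity (?s t (v t) x) (?s' t x)" by (auto simp: Th_def dTh_def)
      then show ?thesis using T_der[OF True x v(1)[OF True]] has_vector_derivative_at_within by simp
    next
      case False
      then have t': "t \<in> {0, 1}" using cases01[OF t] by blast
      have "Th t = (\<lambda>x. sgn (u t x))" "dTh t x = sgn_derivative (u t x) (u1 t x)" using False by (auto simp: Th_def dTh_def)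
      then show ?thesis
        using has_vector_derivative_sgn[OF has_vector_derivative_at_within[OF u_der[OF t]]] ndS(1)[OF t x] W0[OF t'] by simp
    qed
    show "norm (Th t x) = 1 \<and> dTh t x \<noteq> 0"
    proof (cases "t \<in> {0<..<1}")
      case True
      then show ?thesis using in2[OF True x v(1)[OF True]]
        by (auto simp: Th_def dTh_def immersed_slots_def nonzero_slots_def corrugated_tantrix_def norm_sgn)
    next
      case False
      then have "t \<in> {0, 1}" using cases01[OF t] by blast
      then show ?thesis using ndS[OF t x] W0[of t] False by (auto simp: Th_def dTh_def norm_sgn)
    qed
  next
    show "continuous_on ({0..1} \<times> {a..b}) (\<lambda>(t, x). Th t x)" "continuous_on ({0..1} \<times> {a..b}) (\<lambda>(t, x). dTh t x)"
      using cont_Th cont_dTh by (simp_all add: case_prod_unfold)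
  next
    fix t :: real assume t: "t \<in> {0..1}"
    have "map_on \<Gamma> (Th t) \<and> map_on \<Gamma> (dTh t)"
    proof (cases "t \<in> {0<..<1}")
      case True
      have "Th t = (\<lambda>x. corrugated_tantrix (?s t (v t) x))" "dTh t = (\<lambda>x. corrugated_tantrix_velocity (?s t (v t) x) (?s' t x))"
        using True by (auto simp: Th_def dTh_def)
      then show ?thesis
        using map_on_comp[OF s_per(1)[OF True, of "v t"], of corrugated_tantrix] map_on_comp2[OF s_per(1)[OF True, of "v t"] s_per(2)[OF True], of corrugated_tantrix_velocity]
        by simp
    next
      case False
      then have "Th t = (\<lambda>x. sgn (u t x))" "dTh t = (\<lambda>x. sgn_derivative (u t x) (u1 t x))" by (auto simp: Th_def dTh_def)
      then show ?thesis
        using map_on_comp[OF u_per(1)[OF t], of sgn] map_on_comp2[OF u_per(1)[OF t] u_per(2)[OF t], of sgn_derivative]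
        by simp
    qed
    then show "map_on \<Gamma> (Th t)" "map_on \<Gamma> (dTh t)" by blast+
    show "norm (W t) \<le> r0" by (rule W_r0[OF t])
    show "integral {a..b} (\<lambda>x. norm (dTh t x) *\<^sub>R Th t x) = 0" if circ: "\<Gamma> = Circle a b"
    proof (cases "t \<in> {0<..<1}")
      case True
      note vt = v(1)[OF True]
      have "(\<lambda>x. centroid_density (?s t (v t) x, ?s' t x)) integrable_on {a..b}"
        by (intro integrable_continuous_real mo_cont(1) continuous_on_const continuous_on_id) (use True vt IS in auto)
      from integrable_integral[OF this] have m: "((\<lambda>x. centroid_density (?s t (v t) x, ?s' t x)) has_integral 0) {a..b}"
        using v(2)[OF True circ] by simp
      have "((\<lambda>x. centroid_drift_velocity (?s t (v t) x) (?s' t x)) has_integral centroid_drift (?s t (v t) b) - centroid_drift (?s t (v t) a)) {a..b}"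
        by (rule fundamental_theorem_of_calculus[OF less_imp_le[OF ab]])
          (rule has_vector_derivative_at_within[OF d_der[OF True IS vt]])
      moreover have "?s t (v t) b = ?s t (v t) a"
      proof -
        have "?s t (v t) (a + (b - a)) = ?s t (v t) a" using s_per(1)[OF True, of "v t"] unfolding circ map_on.simps by (rule spec)
        then show ?thesis by simp
      qed
      ultimately have d: "((\<lambda>x. centroid_drift_velocity (?s t (v t) x) (?s' t x)) has_integral 0) {a..b}" by simp
      have "((\<lambda>x. centroid_density (?s t (v t) x, ?s' t x) + centroid_drift_velocity (?s t (v t) x) (?s' t x)) has_integral 0 + 0) {a..b}"
        by (rule has_integral_add[OF m d])
      then have "((\<lambda>x. norm (dTh t x) *\<^sub>R Th t x) has_integral 0) {a..b}"
        using True by (simp add: centroid_density_def Th_def dTh_def)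
      then show ?thesis by (rule integral_unique)
    next
      case False
      then have t': "t \<in> {0, 1}" using cases01[OF t] by blast
      have "integral {a..b} (\<lambda>x. norm (dTh t x) *\<^sub>R Th t x) = integral {a..b} (\<lambda>x. target_curvature t *\<^sub>R u t x)"
      proof (rule integral_cong)
        fix x assume x: "x \<in> {a..b}"
        have nz: "u t x \<noteq> 0" using ndS(1)[OF t IS[OF x]] W0[OF t'] by simp
        have "norm (dTh t x) *\<^sub>R Th t x = (norm (u t x) * target_curvature t) *\<^sub>R sgn (u t x)"
        proof -
          have "dTh t x = sgn_derivative (u t x) (u1 t x)" "Th t x = sgn (u t x)"
            unfolding dTh_def Th_def by (rule if_not_P[OF False])+
          then show ?thesis using target_curvature_ends[OF t' x] norm_sgn_derivative[OF nz, of "u1 t x"] by simp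
        qed
        also have "\<dots> = target_curvature t *\<^sub>R u t x" using nz by (simp add: sgn_div_norm)
        finally show "norm (dTh t x) *\<^sub>R Th t x = target_curvature t *\<^sub>R u t x" .
      qed
      then show ?thesis using u_mean[OF t circ] by simp
    qed
  next
    fix t :: real assume t: "t \<in> {0<..<1}"
    have "cdiff (Suc K) UNIV (u t)"
      by (rule cdiff_real_Suc[OF _ u1_smooth[OF t]]) (use u_der[OF t01[OF t]] in simp)
    then have "cdiff K UNIV (u t)" by (rule cdiff_SucD)
    then have "cdiff K UNIV (?s t (v t))"
      unfolding slot_def[abs_def] by (intro cdiff_Pair cdiff_add cdiff_const u1_smooth[OF t] smooth[OF t])
    then have "cdiff K (points \<Gamma>) (?s t (v t))" by (rule cdiff_subset) simp
    then have "cdiff K (points \<Gamma>) (\<lambda>x. corrugated_tantrix (?s t (v t) x))"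
      by (rule cdiff_compose[OF cdiff_corrugated_tantrix], intro image_subsetI) (rule in1[OF t _ v(1)[OF t]])
    moreover have "Th t = (\<lambda>x. corrugated_tantrix (?s t (v t) x))" using t by (auto simp: Th_def)
    ultimately show "cdiff K (points \<Gamma>) (Th t)" by simp
  next
    fix t x :: real assume "t \<in> {0, 1}"
    then show "Th t x = sgn (u t x) \<and> dTh t x = sgn_derivative (u t x) (u1 t x)" by (auto simp: Th_def dTh_def)
  next
    fix t x :: real assume t: "t \<in> {0..1}" and x: "x \<in> {a..b}"
    show "norm (Th t x - sgn (u t x + W t)) \<le> e"
    proof (cases "t \<in> {0<..<1}")
      case True
      then have "norm (Th t x - sgn (u t x + W t)) \<le> E t"
        using adm'[OF True IS[OF x] v(1)[OF True]] by (simp add: Th_def W_def)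
      then show ?thesis using E(2)[OF t] e0'(4) by linarith
    next
      case False
      then have "t \<in> {0, 1}" using cases01[OF t] by blast
      then have "Th t x = sgn (u t x)" "W t = 0" by (auto simp: Th_def W_def)
      then show ?thesis using e by simp
    qed
  next
    fix t y :: real assume t: "t \<in> {0..1}" and y: "y \<in> {a..b}"
    have ay: "a \<le> y" using y by simp
    have "continuous_on {a..y} (\<lambda>x. norm (u t x + W t))"
      by (intro continuous_on_norm continuous_on_add continuous_on_const continuous_on_subset[OF continuous_on_slice[OF u_cont t]]) simp
    then have cUi: "(\<lambda>x. target_curvature t * norm (u t x + W t)) integrable_on {a..y}"
      by (intro integrable_continuous_real continuous_on_mult continuous_on_const)
    show "\<bar>integral {a..y} (\<lambda>x. norm (dTh t x)) - target_curvature t * integral {a..y} (\<lambda>x. norm (u t x + W t))\<bar> \<le> e"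
    proof (cases "t \<in> {0<..<1}")
      case True
      note vt = v(1)[OF True]
      let ?m = "\<lambda>x. length_density (?s t (v t) x, ?s' t x)"
      have mi: "?m integrable_on {a..y}"
        by (intro integrable_continuous_real mo_cont(2) continuous_on_const continuous_on_id) (use True vt sub(1)[OF y] in auto)
      have di: "((\<lambda>x. length_drift_velocity (?s t (v t) x) (?s' t x)) has_integral length_drift (?s t (v t) y) - length_drift (?s t (v t) a)) {a..y}"
      proof (rule fundamental_theorem_of_calculus[OF ay])
        fix x assume "x \<in> {a..y}"
        then have "x \<in> points \<Gamma>" using sub(1)[OF y] by blast
        then show "((\<lambda>x. length_drift (?s t (v t) x)) has_vector_derivative length_drift_velocity (?s t (v t) x) (?s' t x)) (at x within {a..y})"
          by (rule has_vector_derivative_at_within[OF ld_der[OF True _ vt]])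
      qed
      have "((\<lambda>x. ?m x + length_drift_velocity (?s t (v t) x) (?s' t x)) has_integral integral {a..y} ?m + (length_drift (?s t (v t) y) - length_drift (?s t (v t) a))) {a..y}"
        by (rule has_integral_add[OF integrable_integral[OF mi] di])
      then have eq: "integral {a..y} (\<lambda>x. norm (dTh t x)) = integral {a..y} ?m + (length_drift (?s t (v t) y) - length_drift (?s t (v t) a))"
        using True by (intro integral_unique) (simp add: length_density_def dTh_def)
      have dl: "\<bar>length_drift (?s t (v t) x)\<bar> \<le> E t" if "x \<in> {a..b}" for x
        using adm'[OF True IS[OF that] vt] by blast
      have "norm (integral {a..y} (\<lambda>x. ?m x - target_curvature t * norm (u t x + W t))) \<le> integral {a..y} (\<lambda>x. E t)"
      proof (rule integral_norm_bound_integral)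
        show "(\<lambda>x. ?m x - target_curvature t * norm (u t x + W t)) integrable_on {a..y}"
          by (intro integrable_diff mi cUi)
        fix x assume "x \<in> {a..y}"
        then have "x \<in> points \<Gamma>" using sub(1)[OF y] by blast
        then show "norm (?m x - target_curvature t * norm (u t x + W t)) \<le> E t"
          using adm'[OF True _ vt] True by (simp add: W_def)
      qed (intro integrable_continuous_real continuous_on_const)
      also have "integral {a..y} (\<lambda>x. E t) = E t * (y - a)" using ay by (simp add: mult.commute)
      also have "\<dots> \<le> E t * (b - a)" using E(1)[OF t] y by (intro mult_left_mono) auto
      also have "integral {a..y} (\<lambda>x. ?m x - target_curvature t * norm (u t x + W t)) = integral {a..y} ?m - target_curvature t * integral {a..y} (\<lambda>x. norm (u t x + W t))"
        by (subst integral_diff[OF mi cUi]) simp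
      finally have "\<bar>integral {a..y} ?m - target_curvature t * integral {a..y} (\<lambda>x. norm (u t x + W t))\<bar> \<le> E t * (b - a)" by simp
      moreover have "\<bar>length_drift (?s t (v t) y)\<bar> \<le> E t" "\<bar>length_drift (?s t (v t) a)\<bar> \<le> E t" using dl y ab by auto
      ultimately have "\<bar>integral {a..y} (\<lambda>x. norm (dTh t x)) - target_curvature t * integral {a..y} (\<lambda>x. norm (u t x + W t))\<bar> \<le> E t * (b - a) + E t + E t"
        unfolding eq by linarith
      also have "\<dots> = E t * (b - a + 2)" by (simp add: algebra_simps)
      also have "\<dots> \<le> e0 * (b - a + 2)" using E(2)[OF t] L by (intro mult_right_mono) auto
      also have "\<dots> \<le> e" by (rule e0')
      finally show ?thesis .
    next
      case False
      then have t': "t \<in> {0, 1}" using cases01[OF t] by blast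
      have "integral {a..y} (\<lambda>x. norm (dTh t x)) = integral {a..y} (\<lambda>x. target_curvature t * norm (u t x + W t))"
      proof (rule integral_cong)
        fix x assume x: "x \<in> {a..y}"
        then have x': "x \<in> {a..b}" using y by auto
        have nz: "u t x \<noteq> 0" using ndS(1)[OF t IS[OF x']] W0[OF t'] by simp
        show "norm (dTh t x) = target_curvature t * norm (u t x + W t)"
        proof -
          have "dTh t x = sgn_derivative (u t x) (u1 t x)" unfolding dTh_def by (rule if_not_P[OF False])
          then show ?thesis using target_curvature_ends[OF t' x'] norm_sgn_derivative[OF nz, of "u1 t x"] W0[OF t'] by (simp add: mult.commute)
        qed
      qed
      then show ?thesis using e by simp
    qed
  qed
qed

end

section \<open>Reparametrization to constant curvature\<close>

lemma antiderivative_inverse: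
  fixes n :: "real \<Rightarrow> real"
  assumes n: "continuous_on UNIV n" and m: "0 < m" "\<And>x. m \<le> n x"
  obtains \<psi> where "\<And>z. antiderivative a n (\<psi> z) = z"
    "\<And>z. (\<psi> has_real_derivative inverse (n (\<psi> z))) (at z)" "\<And>y. \<psi> (antiderivative a n y) = y"
proof -
  let ?S = "antiderivative a n"
  have S: "(?S has_real_derivative n x) (at x)" for x
    using has_vector_derivative_antiderivative[OF n] unfolding has_real_derivative_iff_has_vector_derivative .
  have grow: "m * (y - x) \<le> ?S y - ?S x" if "x \<le> y" for x y
  proof (cases "x < y")
    case True
    obtain z where "?S y - ?S x = (y - x) * n z" using MVT2[OF True, of ?S n] S by blast
    then show ?thesis using m(2)[of z] True by (simp add: mult.commute mult_right_mono)
  qed (use that in auto)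
  have inj: "inj ?S"
  proof (rule injI)
    fix x y assume "?S x = ?S y"
    then show "x = y"
      using grow[of x y] grow[of y x] m(1)
      by (metis diff_self diff_gt_0_iff_gt linorder_le_cases linorder_not_less mult_pos_pos order_antisym_conv)
  qed
  have cont: "continuous_on UNIV ?S"
    using S by (meson DERIV_isCont continuous_at_imp_continuous_on)
  have "\<exists>y. ?S y = z" for z
  proof -
    let ?p = "a + \<bar>z\<bar> / m" and ?q = "a - \<bar>z\<bar> / m"
    have d: "0 \<le> \<bar>z\<bar> / m" using m(1) by simp
    have "m * (?p - a) = \<bar>z\<bar>" "m * (a - ?q) = \<bar>z\<bar>" using m(1) by simp_all
    then have "z \<le> ?S ?p" "?S ?q \<le> z" using grow[of a ?p] grow[of ?q a] d by simp_all
    then show ?thesis using IVT'[of ?S ?q z ?p] continuous_on_subset[OF cont] d by (metis diff_add_cancel le_add_same_cancel1 le_diff_eq order_trans subset_UNIV)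
  qed
  then obtain \<psi> where \<psi>: "\<And>z. ?S (\<psi> z) = z" by metis
  have lip: "\<bar>\<psi> z - \<psi> w\<bar> \<le> \<bar>z - w\<bar> / m" for z w
    using grow[of "\<psi> z" "\<psi> w"] grow[of "\<psi> w" "\<psi> z"] m(1) \<psi>
    by (cases "\<psi> z \<le> \<psi> w") (simp_all add: pos_le_divide_eq mult.commute abs_if)
  have "continuous (at z) \<psi>" for z
    unfolding continuous_at_eps_delta
  proof (intro allI impI)
    fix e :: real assume "0 < e"
    then have e: "0 < e * m" using m(1) by simp
    have "\<bar>\<psi> x' - \<psi> z\<bar> < e" if "\<bar>x' - z\<bar> < e * m" for x'
    proof -
      have "\<bar>x' - z\<bar> / m < e" using that m(1) by (simp add: pos_divide_less_eq)
      then show ?thesis using lip[of x' z] by linarith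
    qed
    then show "\<exists>d>0. \<forall>x'. dist x' z < d \<longrightarrow> dist (\<psi> x') (\<psi> z) < e"
      using e by (intro exI[of _ "e * m"]) (simp add: dist_real_def)
  qed
  then have "(\<psi> has_real_derivative inverse (n (\<psi> z))) (at z)" for z
    by (intro has_field_derivative_inverse_basic[OF S _ _ open_UNIV UNIV_I]) (use \<psi> m(1) m(2)[of "\<psi> z"] in auto)
  moreover have "\<psi> (?S y) = y" for y using inj \<psi> by (meson injD)
  ultimately show thesis using that[of \<psi>] \<psi> by blast
qed

context curve_dom
begin

text \<open>  With \<open>S\<close> the arc length of \<open>Th t\<close> and \<open>A\<close> the length of the curve to be found, \<open>\<phi>\<close> solves \<open>S (\<phi> x) = c A x\<close>, where \<open>c\<close> is the ratio of
  the total lengths. So \<open>Th t \<circ> \<phi>\<close> has the speed \<open>c v\<close>, and the curve with velocity \<open>v (Th t \<circ> \<phi>)\<close> has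
  curvature \<open>c\<close>. It closes up because the substitution \<open>\<phi>\<close> turns the integral of its velocity into the centroid
  of \<open>Th t\<close>, up to the factor \<open>c\<close>.\<close>

lemma constant_speed_reparametrization:
  fixes Th dTh :: "real \<Rightarrow> real \<Rightarrow> real ^ 'n" and v v1 :: "real \<Rightarrow> real \<Rightarrow> real" and p :: "real \<Rightarrow> real ^ 'n"
  assumes Th: "\<And>t x. t \<in> {0..1} \<Longrightarrow> x \<in> points \<Gamma> \<Longrightarrow> (Th t has_vector_derivative dTh t x) (at x within points \<Gamma>)"
    and unit: "\<And>t x. t \<in> {0..1} \<Longrightarrow> x \<in> points \<Gamma> \<Longrightarrow> norm (Th t x) = 1 \<and> dTh t x \<noteq> 0"
    and Th_cont: "continuous_on ({0..1} \<times> {a..b}) (\<lambda>(t, x). Th t x)"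
    and dTh_cont: "continuous_on ({0..1} \<times> {a..b}) (\<lambda>(t, x). dTh t x)"
    and dTh_cont': "\<And>t. t \<in> {0..1} \<Longrightarrow> continuous_on (points \<Gamma>) (dTh t)"
    and Th_per: "\<And>t. t \<in> {0..1} \<Longrightarrow> map_on \<Gamma> (Th t)" "\<And>t. t \<in> {0..1} \<Longrightarrow> map_on \<Gamma> (dTh t)"
    and v: "\<And>t x. t \<in> {0..1} \<Longrightarrow> x \<in> points \<Gamma> \<Longrightarrow> (v t has_vector_derivative v1 t x) (at x within points \<Gamma>)"
    and v_pos: "\<And>t x. t \<in> {0..1} \<Longrightarrow> x \<in> points \<Gamma> \<Longrightarrow> 0 < v t x"
    and v_cont: "continuous_on ({0..1} \<times> {a..b}) (\<lambda>(t, x). v t x)"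
    and v1_cont: "continuous_on ({0..1} \<times> {a..b}) (\<lambda>(t, x). v1 t x)"
    and v_per: "\<And>t. t \<in> {0..1} \<Longrightarrow> map_on \<Gamma> (v t)"
    and closing: "\<And>t. t \<in> {0..1} \<Longrightarrow> \<Gamma> = Circle a b \<Longrightarrow> integral {a..b} (\<lambda>x. norm (dTh t x) *\<^sub>R Th t x) = 0"
    and p: "continuous_on {0..1} p"
  obtains g :: "real \<Rightarrow> real \<Rightarrow> real ^ 'n" and \<phi> :: "real \<Rightarrow> real \<Rightarrow> real" and c :: "real \<Rightarrow> real" where
    "\<And>t. t \<in> {0..1} \<Longrightarrow> g t a = p t" "\<And>t. t \<in> {0..1} \<Longrightarrow> map_on \<Gamma> (g t)"
    "\<And>t x. t \<in> {0..1} \<Longrightarrow> x \<in> points \<Gamma> \<Longrightarrow>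
      (g t has_vector_derivative v t x *\<^sub>R Th t (\<phi> t x)) (at x within points \<Gamma>)"
    "\<And>t x. t \<in> {0..1} \<Longrightarrow> x \<in> {a..b} \<Longrightarrow> \<phi> t x \<in> {a..b}" "\<And>t. t \<in> {0..1} \<Longrightarrow> \<phi> t b = b"
    "\<And>t x. t \<in> {0..1} \<Longrightarrow> x \<in> {a..b} \<Longrightarrow>
      integral {a..\<phi> t x} (\<lambda>x. norm (dTh t x)) = c t * integral {a..x} (v t)"
    "\<And>t x. t \<in> {0..1} \<Longrightarrow> x \<in> points \<Gamma> \<Longrightarrow> curvature \<Gamma> (g t) x = c t"
    "\<And>t K. t \<in> {0..1} \<Longrightarrow> cdiff K (points \<Gamma>) (Th t) \<Longrightarrow> cdiff K (points \<Gamma>) (v t) \<Longrightarrow> cdiff (Suc K) (points \<Gamma>) (g t)"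
    "\<And>j. j \<le> 2 \<Longrightarrow> continuous_on ({0..1} \<times> {a..b}) (\<lambda>(t, x). nth_vderiv \<Gamma> j (g t) x)"
proof -
  have IS: "x \<in> points \<Gamma>" if "x \<in> {a..b}" for x using that Icc_subset by blast
  have aS: "a \<in> {a..b}" "b \<in> {a..b}" using ab by auto
  \<comment> \<open>retraction of the line onto the domain; composing with it gives functions on the whole line\<close>
  define cl where "cl x = (if \<Gamma> = Circle a b then x else max a (min b x))" for x
  have cl_S: "cl x \<in> points \<Gamma>" for x using dom ab by (auto simp: cl_def)
  have cl_id: "cl x = x" if "x \<in> points \<Gamma>" for x using that dom by (auto simp: cl_def)
  have clI: "cl x = x" if "a \<le> x" "x \<le> b" for x using that by (auto simp: cl_def)
  have cl_cont: "continuous_on A cl" for A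
    unfolding cl_def by (cases "\<Gamma> = Circle a b") (auto intro!: continuous_intros)
  define n where "n t x = norm (dTh t x)" for t x
  have n_pos: "0 < n t x" if "t \<in> {0..1}" "x \<in> points \<Gamma>" for t x using unit[OF that] by (simp add: n_def)
  have n_per: "map_on \<Gamma> (n t)" if "t \<in> {0..1}" for t
    unfolding n_def[abs_def] by (rule map_on_comp[OF Th_per(2)[OF that]])
  have n_cont: "continuous_on ({0..1} \<times> {a..b}) (\<lambda>(t, x). n t x)"
    using dTh_cont unfolding n_def case_prod_unfold by (rule continuous_on_norm)
  have v_cont': "continuous_on (points \<Gamma>) (v t)" if "t \<in> {0..1}" for t
    using v[OF that] by (auto simp: continuous_on_eq_continuous_within intro: has_vector_derivative_continuous)
  have n_cont': "continuous_on (points \<Gamma>) (n t)" if "t \<in> {0..1}" for t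
    unfolding n_def by (intro continuous_on_norm dTh_cont' that)
  have Th_cont': "continuous_on (points \<Gamma>) (Th t)" if "t \<in> {0..1}" for t
    using Th[OF that] by (auto simp: continuous_on_eq_continuous_within intro: has_vector_derivative_continuous)
  have ext: "continuous_on UNIV (\<lambda>x. F (cl x))" if "continuous_on (points \<Gamma>) F" for F :: "real \<Rightarrow> 'b::topological_space"
    by (rule continuous_on_compose2[OF that cl_cont]) (use cl_S in auto)
  obtain m where m: "0 < m" "\<And>t x. t \<in> {0..1} \<Longrightarrow> x \<in> {a..b} \<Longrightarrow> m \<le> n t x"
  proof -
    have "compact ({0..1::real} \<times> {a..b})" "{0..1::real} \<times> {a..b} \<noteq> {}" using ab by (auto intro: compact_Times)
    from continuous_attains_inf[OF this n_cont] obtain z where z: "z \<in> {0..1} \<times> {a..b}"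
      "\<And>w. w \<in> {0..1} \<times> {a..b} \<Longrightarrow> (case z of (t, x) \<Rightarrow> n t x) \<le> (case w of (t, x) \<Rightarrow> n t x)" by blast
    show thesis
    proof (rule that[of "case z of (t, x) \<Rightarrow> n t x"])
      show "0 < (case z of (t, x) \<Rightarrow> n t x)" using z(1) n_pos IS by auto
      show "(case z of (t, x) \<Rightarrow> n t x) \<le> n t x" if "t \<in> {0..1}" "x \<in> {a..b}" for t x
        using z(2)[of "(t, x)"] that by simp
    qed
  qed
  have mS: "m \<le> n t x" if "t \<in> {0..1}" "x \<in> points \<Gamma>" for t x
    using ball_points[OF n_per[OF that(1)], of "\<lambda>s. m \<le> s"] m(2)[OF that(1)] that(2) by blast
  define S where "S t = antiderivative a (\<lambda>x. n t (cl x))" for t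
  define A where "A t = antiderivative a (\<lambda>x. v t (cl x))" for t
  have S_der: "(S t has_vector_derivative n t (cl x)) (at x)" and A_der: "(A t has_vector_derivative v t (cl x)) (at x)"
    if "t \<in> {0..1}" for t x
    unfolding S_def A_def by (intro has_vector_derivative_antiderivative ext n_cont' v_cont' that)+
  have S_int: "S t x = integral {a..x} (n t)" and A_int: "A t x = integral {a..x} (v t)" if "x \<in> {a..b}" for t x
    unfolding S_def A_def using that
    by (auto simp: antiderivative_eq_integral clI intro!: integral_cong)
  have A_strict: "A t x < A t y" if "t \<in> {0..1}" "x < y" for t x y
  proof -
    have "(A t has_real_derivative v t (cl x)) (at x)" for x
      using A_der[OF that(1)] unfolding has_real_derivative_iff_has_vector_derivative .
    from MVT2[OF that(2) this] obtain z where "A t y - A t x = (y - x) * v t (cl z)" by blast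
    moreover have "0 < (y - x) * v t (cl z)" using v_pos[OF that(1) cl_S[of z]] that(2) by (intro mult_pos_pos) auto
    ultimately show ?thesis by linarith
  qed
  have S_grow: "m * \<bar>y - x\<bar> \<le> \<bar>S t y - S t x\<bar>" if t: "t \<in> {0..1}" for t x y
  proof -
    have D: "(S t has_real_derivative n t (cl x)) (at x)" for x
      using S_der[OF t] unfolding has_real_derivative_iff_has_vector_derivative .
    have *: "m * \<bar>y - x\<bar> \<le> \<bar>S t y - S t x\<bar>" if xy: "x < y" for x y
    proof -
      obtain z where "S t y - S t x = (y - x) * n t (cl z)" using MVT2[OF xy D] by blast
      moreover have "(y - x) * m \<le> (y - x) * n t (cl z)" using mS[OF t cl_S[of z]] xy by (intro mult_left_mono) auto
      moreover have "\<bar>y - x\<bar> = y - x" using xy by simp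
      ultimately show ?thesis by (simp only: mult.commute[of m])
    qed
    show ?thesis using *[of x y] *[of y x] by (cases x y rule: linorder_cases) (auto simp: abs_minus_commute)
  qed
  have Sa: "S t a = 0" "A t a = 0" for t by (simp_all add: S_def A_def)
  define c where "c t = S t b / A t b" for t
  have Ab: "0 < A t b" if "t \<in> {0..1}" for t using A_strict[OF that ab] Sa by simp
  have Sb: "0 < S t b" if "t \<in> {0..1}" for t
  proof -
    have "(S t has_real_derivative n t (cl x)) (at x)" for x
      using S_der[OF that] unfolding has_real_derivative_iff_has_vector_derivative .
    from MVT2[OF ab this] obtain z where "S t b - S t a = (b - a) * n t (cl z)" by blast
    then show ?thesis using n_pos[OF that cl_S[of z]] ab Sa by simp
  qed
  have c_pos: "0 < c t" if "t \<in> {0..1}" for t using Ab[OF that] Sb[OF that] by (simp add: c_def)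
  have "\<exists>\<phi>. t \<in> {0..1} \<longrightarrow> (\<forall>x. S t (\<phi> x) = c t * A t x) \<and>
      (\<forall>x. (\<phi> has_real_derivative c t * v t (cl x) / n t (cl (\<phi> x))) (at x))" for t
  proof (cases "t \<in> {0..1}")
    case True
    obtain \<psi> where \<psi>: "\<And>z. S t (\<psi> z) = z" "\<And>z. (\<psi> has_real_derivative inverse (n t (cl (\<psi> z)))) (at z)"
      unfolding S_def
      by (rule antiderivative_inverse[OF ext[OF n_cont'[OF True]] m(1) mS[OF True cl_S], of a]) blast
    have "((\<lambda>x. c t * A t x) has_real_derivative c t * v t (cl x)) (at x)" for x
      using A_der[OF True, of x] unfolding has_real_derivative_iff_has_vector_derivative[symmetric] by (rule DERIV_cmult)
    from DERIV_chain2[OF \<psi>(2) this]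
    have "((\<lambda>x. \<psi> (c t * A t x)) has_real_derivative c t * v t (cl x) / n t (cl (\<psi> (c t * A t x)))) (at x)" for x
      by (simp add: divide_inverse mult.commute)
    then show ?thesis using \<psi>(1) by (intro exI[of _ "\<lambda>x. \<psi> (c t * A t x)"]) simp
  next
    case False
    then show ?thesis by blast
  qed
  then obtain \<phi> where \<phi>': "\<forall>t. t \<in> {0..1} \<longrightarrow> (\<forall>x. S t (\<phi> t x) = c t * A t x) \<and>
      (\<forall>x. (\<phi> t has_real_derivative c t * v t (cl x) / n t (cl (\<phi> t x))) (at x))" by metis
  then have \<phi>: "S t (\<phi> t x) = c t * A t x"
    and \<phi>_der: "(\<phi> t has_real_derivative c t * v t (cl x) / n t (cl (\<phi> t x))) (at x)" if "t \<in> {0..1}" for t x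
    using that by blast+
  have S_inj: "x = y" if "t \<in> {0..1}" "S t x = S t y" for t x y
    using S_grow[OF that(1), of x y] that(2) m(1) by (simp add: mult_le_0_iff)
  have \<phi>_ends: "\<phi> t a = a" "\<phi> t b = b" if "t \<in> {0..1}" for t
  proof -
    show "\<phi> t a = a" by (rule S_inj[OF that]) (simp add: \<phi>[OF that] Sa)
    show "\<phi> t b = b" by (rule S_inj[OF that]) (use Ab[OF that] in \<open>simp add: \<phi>[OF that] c_def\<close>)
  qed
  have \<phi>_mono: "\<phi> t x \<le> \<phi> t y" if "t \<in> {0..1}" "x \<le> y" for t x y
  proof (rule DERIV_nonneg_imp_nondecreasing[OF that(2)])
    fix z
    show "\<exists>d. (\<phi> t has_real_derivative d) (at z) \<and> 0 \<le> d"
      using \<phi>_der[OF that(1), of z] c_pos[OF that(1)] v_pos[OF that(1) cl_S[of z]] n_pos[OF that(1) cl_S[of "\<phi> t z"]]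
      by (intro exI[of _ "c t * v t (cl z) / n t (cl (\<phi> t z))"]) (simp add: less_imp_le)
  qed
  have \<phi>_in: "\<phi> t x \<in> {a..b}" if "t \<in> {0..1}" "x \<in> {a..b}" for t x
    using \<phi>_mono[OF that(1), of a x] \<phi>_mono[OF that(1), of x b] \<phi>_ends[OF that(1)] that(2) by auto
  have \<phi>_S: "\<phi> t x \<in> points \<Gamma>" if "t \<in> {0..1}" "x \<in> points \<Gamma>" for t x
  proof (cases "\<Gamma> = Circle a b")
    case False
    then have "points \<Gamma> = {a..b}" using dom by auto
    then show ?thesis using \<phi>_in that by simp
  qed simp
  define h where "h t x = v t x *\<^sub>R Th t (\<phi> t x)" for t x
  define h' where "h' t x = v1 t x *\<^sub>R Th t (\<phi> t x) + (v t x * (c t * v t x / n t (\<phi> t x))) *\<^sub>R dTh t (\<phi> t x)" for t x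
  have \<phi>_der_S: "(\<phi> t has_vector_derivative c t * v t x / n t (\<phi> t x)) (at x within points \<Gamma>)" if "t \<in> {0..1}" "x \<in> points \<Gamma>" for t x
    using has_vector_derivative_at_within[OF \<phi>_der[OF that(1), of x, unfolded has_real_derivative_iff_has_vector_derivative]]
    unfolding cl_id[OF that(2)] cl_id[OF \<phi>_S[OF that]] .
  have Th\<phi>_der: "((\<lambda>x. Th t (\<phi> t x)) has_vector_derivative (c t * v t x / n t (\<phi> t x)) *\<^sub>R dTh t (\<phi> t x)) (at x within points \<Gamma>)"
    if "t \<in> {0..1}" "x \<in> points \<Gamma>" for t x
  proof -
    have "(Th t has_vector_derivative dTh t (\<phi> t x)) (at (\<phi> t x) within \<phi> t ` points \<Gamma>)"
      by (rule has_vector_derivative_within_subset[OF Th[OF that(1) \<phi>_S[OF that]]]) (use \<phi>_S that in auto)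
    from vector_diff_chain_within[OF \<phi>_der_S[OF that] this] show ?thesis by (simp add: o_def)
  qed
  have h_der: "(h t has_vector_derivative h' t x) (at x within points \<Gamma>)" if "t \<in> {0..1}" "x \<in> points \<Gamma>" for t x
    using has_vector_derivative_scaleR[OF v[OF that, folded has_real_derivative_iff_has_vector_derivative] Th\<phi>_der[OF that]]
    unfolding h_def[abs_def] h'_def by (simp add: add.commute)
  have h_cont': "continuous_on (points \<Gamma>) (h t)" if "t \<in> {0..1}" for t
    using h_der[OF that] by (auto simp: continuous_on_eq_continuous_within intro: has_vector_derivative_continuous)
  define g where "g t x = p t + antiderivative a (\<lambda>x. h t (cl x)) x" for t x
  have g_der: "(g t has_vector_derivative h t x) (at x within points \<Gamma>)" if "t \<in> {0..1}" "x \<in> points \<Gamma>" for t x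
  proof -
    have "((\<lambda>x. antiderivative a (\<lambda>x. h t (cl x)) x) has_vector_derivative h t (cl x)) (at x within points \<Gamma>)"
      by (rule has_vector_derivative_at_within[OF has_vector_derivative_antiderivative[OF ext[OF h_cont'[OF that(1)]]]])
    from has_vector_derivative_add[OF has_vector_derivative_const this, of "p t"]
    show ?thesis unfolding g_def[abs_def] using cl_id[OF that(2)] by simp
  qed
  have g_per: "map_on \<Gamma> (g t)" if t: "t \<in> {0..1}" for t
  proof (cases "\<Gamma> = Circle a b")
    case True
    have U: "points \<Gamma> = UNIV" using True by simp
    have clx: "cl x = x" for x using True by (simp add: cl_def)
    have shift: "antiderivative a F (x + (b - a)) = antiderivative a F x + antiderivative a F b"
      if F: "continuous_on UNIV F" "map_on \<Gamma> F" for F :: "real \<Rightarrow> 'b::euclidean_space" and x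
    proof -
      have D: "(antiderivative a F has_vector_derivative F x) (at x)" for x by (rule has_vector_derivative_antiderivative[OF F(1)])
      have zero: "((\<lambda>x. antiderivative a F (x + (b - a)) - antiderivative a F x) has_vector_derivative 0) (at x within UNIV)" if "x \<in> UNIV" for x
      proof -
        have "((\<lambda>x. x + (b - a)) has_vector_derivative 1) (at x)" by (auto intro!: derivative_eq_intros)
        from vector_diff_chain_at[OF this D] have "((\<lambda>x. antiderivative a F (x + (b - a))) has_vector_derivative F x) (at x)"
          using F(2) True by (simp add: o_def)
        from has_vector_derivative_diff[OF this D] show ?thesis by simp
      qed
      obtain k where k: "\<And>x. x \<in> UNIV \<Longrightarrow> antiderivative a F (x + (b - a)) - antiderivative a F x = k"
        using has_vector_derivative_zero_constant[OF convex_UNIV zero] by blast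
      from k[of a] k[of x] show ?thesis using ab by (simp add: algebra_simps)
    qed
    have \<phi>_shift: "\<phi> t (x + (b - a)) = \<phi> t x + (b - a)" for x
    proof (rule S_inj[OF t])
      have "S t (\<phi> t x + (b - a)) = S t (\<phi> t x) + S t b"
        unfolding S_def by (rule shift) (use ext[OF n_cont'[OF t]] n_per[OF t] clx in simp_all)
      moreover have "A t (x + (b - a)) = A t x + A t b"
        unfolding A_def by (rule shift) (use ext[OF v_cont'[OF t]] v_per[OF t] clx in simp_all)
      moreover have "c t * A t b = S t b" using Ab[OF t] by (simp add: c_def)
      ultimately show "S t (\<phi> t (x + (b - a))) = S t (\<phi> t x + (b - a))"
        unfolding \<phi>[OF t] by (simp add: distrib_left)
    qed
    have Thp: "Th t (y + (b - a)) = Th t y" "v t (y + (b - a)) = v t y" for y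
      using Th_per(1)[OF t] v_per[OF t] True by simp_all
    have h_per: "map_on \<Gamma> (\<lambda>x. h t (cl x))"
      unfolding True by (simp add: h_def clx \<phi>_shift Thp)
    \<comment> \<open>\<open>G (\<phi> x)\<close> has the derivative \<open>c h\<close>, so the centroid of \<open>Th t\<close> is \<open>c\<close> times the integral of the velocity\<close>
    let ?G = "antiderivative a (\<lambda>x. n t x *\<^sub>R Th t x)"
    have nT: "continuous_on UNIV (\<lambda>x. n t x *\<^sub>R Th t x)"
      using n_cont'[OF t] Th_cont'[OF t] unfolding U by (rule continuous_on_scaleR)
    have "((\<lambda>x. ?G (\<phi> t x)) has_vector_derivative c t *\<^sub>R h t x) (at x)" for x
    proof -
      have "(\<phi> t has_vector_derivative c t * v t x / n t (\<phi> t x)) (at x)"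
        using \<phi>_der_S[OF t, of x] unfolding U by simp
      from vector_diff_chain_at[OF this has_vector_derivative_antiderivative[OF nT]]
      show ?thesis using n_pos[OF t, of "\<phi> t x"] U by (simp add: o_def h_def)
    qed
    then have "((\<lambda>x. c t *\<^sub>R h t x) has_integral ?G (\<phi> t b) - ?G (\<phi> t a)) {a..b}"
      using ab by (intro fundamental_theorem_of_calculus) (simp_all add: has_vector_derivative_at_within)
    moreover have "?G b = 0" using closing[OF t True] ab by (simp add: antiderivative_eq_integral n_def)
    ultimately have "((\<lambda>x. c t *\<^sub>R h t x) has_integral 0) {a..b}" by (simp add: \<phi>_ends[OF t])
    from has_integral_cmul[OF this, of "inverse (c t)"] have "((\<lambda>x. h t x) has_integral 0) {a..b}"
      using c_pos[OF t] by simp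
    then have "antiderivative a (\<lambda>x. h t (cl x)) b = 0"
      using ab by (simp add: antiderivative_eq_integral clx integral_unique)
    then have "g t (x + (b - a)) = g t x" for x
      using shift[OF ext[OF h_cont'[OF t]] h_per, of x] by (simp add: g_def)
    then show ?thesis using True by simp
  qed (use dom in auto)
  have vd1: "vderiv \<Gamma> (g t) x = h t x" if "t \<in> {0..1}" "x \<in> points \<Gamma>" for t x
    by (rule vderiv_eq[OF that(2) g_der[OF that]])
  have vd2: "vderiv \<Gamma> (vderiv \<Gamma> (g t)) x = h' t x" if "t \<in> {0..1}" "x \<in> points \<Gamma>" for t x
    by (rule vderiv_eq[OF that(2)], rule has_vector_derivative_transform[OF that(2) _ h_der[OF that]])
      (rule vd1[OF that(1)])
  have curv: "curvature \<Gamma> (g t) x = c t" if t: "t \<in> {0..1}" and x: "x \<in> points \<Gamma>" for t x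
  proof -
    have "tantrix \<Gamma> (g t) y = Th t (\<phi> t y)" if "y \<in> points \<Gamma>" for y
      using v_pos[OF t that] unit[OF t \<phi>_S[OF t that]] by (simp add: tantrix_def vd1[OF t that] h_def)
    then have "vderiv \<Gamma> (tantrix \<Gamma> (g t)) x = (c t * v t x / n t (\<phi> t x)) *\<^sub>R dTh t (\<phi> t x)"
      by (intro vderiv_eq[OF x] has_vector_derivative_transform[OF x _ Th\<phi>_der[OF t x]])
    moreover have "norm ((c t * v t x / n t (\<phi> t x)) *\<^sub>R dTh t (\<phi> t x)) = c t * v t x"
      using c_pos[OF t] v_pos[OF t x] n_pos[OF t \<phi>_S[OF t x]] by (simp add: n_def[symmetric])
    moreover have "norm (h t x) = v t x"
      using v_pos[OF t x] unit[OF t \<phi>_S[OF t x]] by (simp add: h_def)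
    ultimately show ?thesis using v_pos[OF t x] by (simp add: curvature_def vd1[OF t x])
  qed
  \<comment> \<open>the derivative of \<open>\<phi>\<close> is an expression in \<open>\<phi>\<close>, so its regularity grows step by step\<close>
  have smooth: "cdiff (Suc K) (points \<Gamma>) (g t)"
    if t: "t \<in> {0..1}" and T: "cdiff K (points \<Gamma>) (Th t)" and V: "cdiff K (points \<Gamma>) (v t)" for t K
  proof -
    have "j \<le> K \<Longrightarrow> cdiff j (points \<Gamma>) (\<phi> t)" for j
    proof (induction j)
      case 0
      show ?case using \<phi>_der_S[OF t]
        by (auto simp: continuous_on_eq_continuous_within intro: has_vector_derivative_continuous)
    next
      case (Suc j)
      then have IH: "cdiff j (points \<Gamma>) (\<phi> t)" by simp
      have "cdiff j (points \<Gamma>) (vderiv \<Gamma> (Th t))" by (rule cdiff_vderiv(2)[OF cdiff_mono[OF T Suc.prems]])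
      then have "cdiff j (points \<Gamma>) (dTh t)"
        by (rule iffD1[OF cdiff_cong, rotated]) (rule vderiv_eq[OF _ Th[OF t]])
      then have "cdiff j (points \<Gamma>) (n t)" unfolding n_def[abs_def] by (rule cdiff_norm) (use unit[OF t] in blast)
      then have "cdiff j (points \<Gamma>) (\<lambda>x. n t (\<phi> t x))"
        by (rule cdiff_compose[OF _ IH]) (use \<phi>_S[OF t] in auto)
      then have "cdiff j (points \<Gamma>) (\<lambda>x. c t * v t x / n t (\<phi> t x))"
        using cdiff_mono[OF V, of j] Suc.prems
        by (intro cdiff_divide cdiff_mult cdiff_const) (use n_pos[OF t \<phi>_S[OF t]] in force)+
      then show ?case by (rule cdiff_real_Suc[rotated]) (rule \<phi>_der_S[OF t])
    qed
    then have "cdiff K (points \<Gamma>) (\<phi> t)" by simp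
    then have "cdiff K (points \<Gamma>) (\<lambda>x. Th t (\<phi> t x))"
      by (rule cdiff_compose[OF T]) (use \<phi>_S[OF t] in auto)
    then have "cdiff K (points \<Gamma>) (h t)" unfolding h_def[abs_def] by (intro cdiff_scaleR V)
    then show ?thesis by (rule cdiff_real_Suc[rotated]) (rule g_der[OF t])
  qed
  \<comment> \<open>\<open>\<phi>\<close> is controlled through \<open>S\<close>, which grows at least at the rate \<open>m\<close>\<close>
  let ?Q = "{0..1::real} \<times> {a..b}"
  have clamp: "continuous_on ({0..1} \<times> UNIV) (\<lambda>(t, x). F t (max a (min b x)))"
    if "continuous_on ?Q (\<lambda>(t, x). F t x)" for F :: "real \<Rightarrow> real \<Rightarrow> 'b::euclidean_space"
  proof -
    have "continuous_on ({0..1::real} \<times> UNIV) (\<lambda>z. (fst z, max a (min b (snd z))))" by (intro continuous_intros)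
    moreover have "(\<lambda>z. (fst z, max a (min b (snd z)))) ` ({0..1::real} \<times> UNIV) \<subseteq> ?Q" using ab by auto
    ultimately show ?thesis using continuous_on_compose2[OF that] by (fastforce simp: case_prod_unfold)
  qed
  have int_cont: "continuous_on ?Q (\<lambda>z. integral {a..snd z} (F (fst z)))"
    if F: "continuous_on ?Q (\<lambda>(t, x). F t x)" for F :: "real \<Rightarrow> real \<Rightarrow> 'b::euclidean_space"
  proof -
    have c: "continuous_on ?Q (\<lambda>z. antiderivative a (\<lambda>x. F (fst z) (max a (min b x))) (snd z))"
      using continuous_on_subset[OF continuous_on_antiderivative[OF clamp[OF F], of a], of ?Q] by (force simp: case_prod_unfold)
    have eq: "antiderivative a (\<lambda>x. F t (max a (min b x))) x = integral {a..x} (F t)" if "x \<in> {a..b}" for t x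
      using that by (auto simp: antiderivative_eq_integral intro!: integral_cong)
    from c show ?thesis by (rule iffD1[OF continuous_on_cong, rotated 2]) (auto simp: eq)
  qed
  have Sc: "continuous_on ?Q (\<lambda>z. S (fst z) (snd z))"
    using int_cont[OF n_cont] by (rule iffD1[OF continuous_on_cong, rotated 2]) (auto simp: S_int)
  have Ac: "continuous_on ?Q (\<lambda>z. A (fst z) (snd z))"
    using int_cont[OF v_cont] by (rule iffD1[OF continuous_on_cong, rotated 2]) (auto simp: A_int)
  have atb: "continuous_on {0..1} (\<lambda>t. F t b)" if "continuous_on ?Q (\<lambda>z. F (fst z) (snd z))" for F :: "real \<Rightarrow> real \<Rightarrow> real"
    using continuous_on_compose2[OF that, of "{0..1}" "\<lambda>t. (t, b)"] ab by (force intro: continuous_intros)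
  have cc: "continuous_on {0..1} c"
    unfolding c_def by (intro continuous_on_divide atb Sc Ac ballI) (use Ab in force)
  have ccQ: "continuous_on ?Q (\<lambda>z. c (fst z))"
    by (rule continuous_on_compose2[OF cc]) (auto intro: continuous_intros)
  have \<phi>c: "continuous_on ?Q (\<lambda>z. \<phi> (fst z) (snd z))"
    unfolding continuous_on_def
  proof
    fix z0 assume z0: "z0 \<in> ?Q"
    let ?y = "\<phi> (fst z0) (snd z0)"
    have y: "?y \<in> {a..b}" using \<phi>_in z0 by auto
    have "continuous_on ?Q (\<lambda>z. S (fst z) ?y)"
      using continuous_on_compose2[OF Sc, of ?Q "\<lambda>z. (fst z, ?y)"] y by (force intro: continuous_intros)
    then have "continuous_on ?Q (\<lambda>z. \<bar>c (fst z) * A (fst z) (snd z) - S (fst z) ?y\<bar> / m)"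
      using m(1) by (intro continuous_on_divide continuous_on_rabs continuous_on_diff continuous_on_mult ccQ Ac continuous_on_const) auto
    then have "((\<lambda>z. \<bar>c (fst z) * A (fst z) (snd z) - S (fst z) ?y\<bar> / m) \<longlongrightarrow>
        \<bar>c (fst z0) * A (fst z0) (snd z0) - S (fst z0) ?y\<bar> / m) (at z0 within ?Q)"
      using z0 unfolding continuous_on_def by blast
    moreover have "\<bar>c (fst z0) * A (fst z0) (snd z0) - S (fst z0) ?y\<bar> / m = 0"
      using \<phi>[of "fst z0" "snd z0"] z0 by auto
    ultimately have lim: "((\<lambda>z. \<bar>c (fst z) * A (fst z) (snd z) - S (fst z) ?y\<bar> / m) \<longlongrightarrow> 0) (at z0 within ?Q)" by simp
    have "eventually (\<lambda>z. norm (\<phi> (fst z) (snd z) - ?y) \<le> \<bar>c (fst z) * A (fst z) (snd z) - S (fst z) ?y\<bar> / m) (at z0 within ?Q)"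
    proof -
      have "norm (\<phi> (fst z) (snd z) - ?y) \<le> \<bar>c (fst z) * A (fst z) (snd z) - S (fst z) ?y\<bar> / m" if "z \<in> ?Q" for z
      proof -
        have t: "fst z \<in> {0..1}" using that by auto
        show ?thesis using S_grow[OF t, of "\<phi> (fst z) (snd z)" ?y] m(1)
          by (simp add: \<phi>[OF t] pos_le_divide_eq mult.commute)
      qed
      then show ?thesis by (auto simp: eventually_at_filter)
    qed
    from Lim_null_comparison[OF this lim] show "((\<lambda>z. \<phi> (fst z) (snd z)) \<longlongrightarrow> ?y) (at z0 within ?Q)"
      by (simp add: LIM_zero_iff)
  qed
  have on\<phi>: "continuous_on ?Q (\<lambda>z. F (fst z) (\<phi> (fst z) (snd z)))"
    if "continuous_on ?Q (\<lambda>(t, x). F t x)" for F :: "real \<Rightarrow> real \<Rightarrow> 'b::topological_space"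
  proof -
    have "(\<lambda>z. (fst z, \<phi> (fst z) (snd z))) ` ?Q \<subseteq> ?Q" using \<phi>_in by auto
    from continuous_on_compose2[OF that continuous_on_Pair[OF continuous_on_fst[OF continuous_on_id] \<phi>c] this]
    show ?thesis by (simp add: case_prod_unfold)
  qed
  have vc: "continuous_on ?Q (\<lambda>z. v (fst z) (snd z))" "continuous_on ?Q (\<lambda>z. v1 (fst z) (snd z))"
    using v_cont v1_cont by (simp_all add: case_prod_unfold)
  have hc: "continuous_on ?Q (\<lambda>z. h (fst z) (snd z))"
    unfolding h_def by (intro continuous_on_scaleR vc on\<phi>[OF Th_cont])
  have h'c: "continuous_on ?Q (\<lambda>z. h' (fst z) (snd z))"
    unfolding h'_def
    by (intro continuous_on_add continuous_on_scaleR continuous_on_mult continuous_on_divide ccQ vc on\<phi>[OF Th_cont]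
        on\<phi>[OF dTh_cont] on\<phi>[OF n_cont] ballI) (use n_pos \<phi>_S IS in force)
  have gc: "continuous_on ?Q (\<lambda>z. g (fst z) (snd z))"
  proof -
    have c: "continuous_on ?Q (\<lambda>z. p (fst z) + integral {a..snd z} (h (fst z)))"
      using hc by (intro continuous_on_add int_cont continuous_on_compose2[OF p]) (auto simp: case_prod_unfold intro: continuous_intros)
    have eq: "g t x = p t + integral {a..x} (h t)" if "x \<in> {a..b}" for t x
      unfolding g_def using that by (auto simp: antiderivative_eq_integral clI intro!: integral_cong)
    from c show ?thesis by (rule iffD1[OF continuous_on_cong, rotated 2]) (auto simp: eq)
  qed
  show thesis
  proof (rule that[of g \<phi> c])
    show "g t a = p t" for t by (simp add: g_def)
    show "continuous_on ?Q (\<lambda>(t, x). nth_vderiv \<Gamma> j (g t) x)" if "j \<le> 2" for j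
    proof -
      have "j = 0 \<or> j = 1 \<or> j = 2" using that by auto
      then consider "j = 0" | "j = Suc 0" | "j = Suc (Suc 0)" by auto
      then show ?thesis
      proof cases
        case 1
        then show ?thesis using gc by (simp add: case_prod_unfold)
      next
        case 2
        show ?thesis using hc
          by (rule iffD1[OF continuous_on_cong, rotated 2]) (auto simp: 2 nth_vderiv_Suc vd1 IS)
      next
        case 3
        show ?thesis using h'c
          by (rule iffD1[OF continuous_on_cong, rotated 2]) (auto simp: 3 nth_vderiv_Suc vd2 IS)
      qed
    qed
    show "integral {a..\<phi> t x} (\<lambda>x. norm (dTh t x)) = c t * integral {a..x} (v t)" if "t \<in> {0..1}" "x \<in> {a..b}" for t x
      using \<phi>[OF that(1), of x] S_int[OF \<phi>_in[OF that], of t] A_int[OF that(2), of t] by (simp add: n_def[abs_def])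
  qed (use g_per g_der[unfolded h_def] \<phi>_in \<phi>_ends curv smooth in blast)+
qed

end

section \<open>The homotopy of curves of constant curvature\<close>

lemma has_vector_derivative_norm:
  fixes f :: "real \<Rightarrow> 'b::real_inner"
  assumes "(f has_vector_derivative v) (at x within S)" "f x \<noteq> 0"
  shows "((\<lambda>x. norm (f x)) has_vector_derivative v \<bullet> sgn (f x)) (at x within S)"
  using has_vector_derivative_chain[OF assms(1) has_derivative_norm[OF assms(2)]] .

lemma norm_scaled_sgn_diff:
  fixes p q :: "'a::real_inner"
  assumes "q \<noteq> 0" shows "norm (p - norm p *\<^sub>R sgn q) \<le> 2 * norm (p - q)"
proof -
  have "p - norm p *\<^sub>R sgn q = (p - q) + (norm q - norm p) *\<^sub>R sgn q"
  proof -
    have "norm q *\<^sub>R sgn q = q" using assms by (simp add: sgn_div_norm)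
    then show ?thesis by (simp add: scaleR_diff_left)
  qed
  also have "norm \<dots> \<le> norm (p - q) + \<bar>norm q - norm p\<bar> * norm (sgn q)"
    by (rule order_trans[OF norm_triangle_ineq]) simp
  also have "norm (sgn q) = 1" using assms by (simp add: norm_sgn)
  also have "\<bar>norm q - norm p\<bar> \<le> norm (p - q)" using norm_triangle_ineq3[of q p] by (simp add: norm_minus_commute)
  finally show ?thesis by simp
qed

lemma integral_lower_growth:
  fixes w :: "real \<Rightarrow> real"
  assumes w: "continuous_on {a..b} w" "\<And>x. x \<in> {a..b} \<Longrightarrow> \<mu> \<le> w x" and "x \<in> {a..b}" "y \<in> {a..b}"
  shows "\<mu> * \<bar>y - x\<bar> \<le> \<bar>integral {a..y} w - integral {a..x} w\<bar>"
proof -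
  have *: "\<mu> * (y - x) \<le> integral {a..y} w - integral {a..x} w" if "a \<le> x" "x \<le> y" "y \<le> b" for x y
  proof -
    have int: "w integrable_on {p..q}" if "a \<le> p" "q \<le> b" for p q
      by (rule integrable_continuous_real, rule continuous_on_subset[OF w(1)]) (use that in auto)
    have "integral {x..y} (\<lambda>_. \<mu>) \<le> integral {x..y} w"
      by (rule integral_le[OF _ int]) (use w(2) that in \<open>auto intro: integrable_continuous_real\<close>)
    moreover have "integral {a..x} w + integral {x..y} w = integral {a..y} w"
      by (rule Henstock_Kurzweil_Integration.integral_combine[OF that(1,2) int]) (use that in auto)
    ultimately show ?thesis using that by (simp add: mult.commute)
  qed
  show ?thesis
    using *[of x y] *[of y x] assms(3,4) by (cases "x \<le> y") (auto simp: abs_if)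
qed

context curve_dom
begin

text \<open>  The speed \<open>v\<close> of the new curves is that of the smoothed velocities \<open>u\<close>. The velocity \<open>v (Th \<circ> \<phi>)\<close> is close to \<open>u\<close>
  because \<open>Th\<close> is close to the tantrix of \<open>u + W\<close> and because \<open>\<phi>\<close> is close to the identity: by the estimate of the length of
  \<open>Th\<close>, both \<open>\<phi> x\<close> and \<open>x\<close> cut off nearly the same length of the curve. At the end times \<open>\<phi>\<close> is the identity and
  the construction returns the curve \<open>f t\<close>; outside the domain its values may differ from
  those of \<open>f t\<close>, hence the definition by cases of the final family.\<close>

lemma constant_curvature_homotopy:
  fixes f :: "real \<Rightarrow> real \<Rightarrow> real ^ 'n"
  assumes n: "3 \<le> CARD('n)" and hom: "curve_homotopy \<Gamma> k 2 f"
    and nv: "\<forall>t\<in>{0..1}. nonvanishing_curvature \<Gamma> (f t)"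
    and cc: "constant_curvature \<Gamma> (f 0)" "constant_curvature \<Gamma> (f 1)" and \<epsilon>: "\<epsilon> > 0"
  shows "\<exists>g :: real \<Rightarrow> real \<Rightarrow> real ^ 'n.
    curve_homotopy \<Gamma> k 2 g \<and> (\<forall>t\<in>{0..1}. constant_curvature \<Gamma> (g t))
    \<and> (\<forall>x\<in>points \<Gamma>. g 0 x = f 0 x) \<and> (\<forall>x\<in>points \<Gamma>. g 1 x = f 1 x)
    \<and> (\<forall>t\<in>{0..1}. Ck_norm \<Gamma> 1 (\<lambda>x. g t x - f t x) \<le> \<epsilon>)"
proof -
  have k2: "2 \<le> k" using hom by (simp add: curve_homotopy_def)
  have L: "0 < b - a" using ab by simp
  have IS: "x \<in> points \<Gamma>" if "x \<in> {a..b}" for x using that Icc_subset by blast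
  have ends01: "t \<in> {0..1}" if "t \<in> {0, 1}" for t :: real using that by auto
  have fI: "f t \<in> Imm \<Gamma> k" if "t \<in> {0..1}" for t using hom that by (simp add: curve_homotopy_def)
  have f: "map_on \<Gamma> (f t)" "cdiff k (points \<Gamma>) (f t)" "\<And>x. x \<in> points \<Gamma> \<Longrightarrow> vderiv \<Gamma> (f t) x \<noteq> 0" if "t \<in> {0..1}" for t
    using fI[OF that] k2 by (auto simp: Imm_def Ck_iff_cdiff)
  define F0 where "F0 t = vderiv \<Gamma> (f t)" for t
  define F1 where "F1 t = vderiv \<Gamma> (F0 t)" for t
  have cd: "cdiff (Suc (Suc 0)) (points \<Gamma>) (f t)" if "t \<in> {0..1}" for t
    by (rule cdiff_mono[OF f(2)[OF that]]) (use k2 in simp)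
  have der0: "(f t has_vector_derivative F0 t x) (at x within points \<Gamma>)" if "t \<in> {0..1}" "x \<in> points \<Gamma>" for t x
    unfolding F0_def by (rule cdiff_vderiv(1)[OF cd[OF that(1)] that(2)])
  have der1: "(F0 t has_vector_derivative F1 t x) (at x within points \<Gamma>)" if "t \<in> {0..1}" "x \<in> points \<Gamma>" for t x
    unfolding F1_def F0_def by (rule cdiff_vderiv(1)[OF cdiff_vderiv(2)[OF cd[OF that(1)]] that(2)])
  have Fper: "map_on \<Gamma> (F0 t)" "map_on \<Gamma> (F1 t)" if "t \<in> {0..1}" for t
    unfolding F1_def F0_def by (intro map_on_vderiv f(1)[OF that])+
  have c0: "continuous_on ({0..1} \<times> points \<Gamma>) (\<lambda>(t, x). F0 t x)"
    using homotopy_jointly_continuous[OF hom, of "Suc 0"] by (simp add: nth_vderiv_Suc F0_def)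
  have c1: "continuous_on ({0..1} \<times> points \<Gamma>) (\<lambda>(t, x). F1 t x)"
    using homotopy_jointly_continuous[OF hom, of "Suc (Suc 0)"] by (simp add: nth_vderiv_Suc F0_def F1_def)
  have F0_nz: "F0 t x \<noteq> 0" if "t \<in> {0..1}" "x \<in> points \<Gamma>" for t x
    using f(3)[OF that] by (simp add: F0_def)
  have kapF: "curvature \<Gamma> (f t) x = jet_curvature (F0 t x) (F1 t x)" if "t \<in> {0..1}" "x \<in> points \<Gamma>" for t x
  proof -
    have "tantrix \<Gamma> (f t) = (\<lambda>x. sgn (F0 t x))" by (simp add: tantrix_def F0_def sgn_div_norm fun_eq_iff)
    moreover have "vderiv \<Gamma> (\<lambda>x. sgn (F0 t x)) x = sgn_derivative (F0 t x) (F1 t x)"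
      by (rule vderiv_eq[OF that(2) has_vector_derivative_sgn[OF der1[OF that] F0_nz[OF that]]])
    ultimately show ?thesis by (simp add: curvature_def jet_curvature_def F0_def)
  qed
  have tauF: "sgn_derivative (F0 t x) (F1 t x) \<noteq> 0" if "t \<in> {0..1}" "x \<in> points \<Gamma>" for t x
    using nv that kapF[OF that] by (auto simp: nonvanishing_curvature_def jet_curvature_def)
  let ?Q = "{0..1::real} \<times> {a..b}"
  have Q: "compact ?Q" "?Q \<noteq> {}" using ab by (auto intro: compact_Times)
  have QS: "?Q \<subseteq> {0..1} \<times> points \<Gamma>" using Icc_subset by auto
  have c0Q: "continuous_on ?Q (\<lambda>z. F0 (fst z) (snd z))" and c1Q: "continuous_on ?Q (\<lambda>z. F1 (fst z) (snd z))"
    using continuous_on_subset[OF c0 QS] continuous_on_subset[OF c1 QS] by (simp_all add: case_prod_unfold)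
  \<comment> \<open>velocities and accelerations near those of the homotopy still have positive curvature\<close>
  define \<Omega> where "\<Omega> = {z :: (real ^ 'n) \<times> (real ^ 'n). fst z \<noteq> 0 \<and> sgn_derivative (fst z) (snd z) \<noteq> 0}"
  have \<Omega>: "open \<Omega>"
  proof -
    have o: "open {z :: (real ^ 'n) \<times> (real ^ 'n). fst z \<noteq> 0}" by (intro open_Collect_neq continuous_intros)
    have "cdiff 0 {z :: (real ^ 'n) \<times> (real ^ 'n). fst z \<noteq> 0} (\<lambda>z. sgn_derivative (fst z) (snd z))"
      by (intro cdiff_sgn_derivative cdiff_fst cdiff_snd cdiff_ident) auto
    then have "open ({z :: (real ^ 'n) \<times> (real ^ 'n). fst z \<noteq> 0} \<inter> (\<lambda>z. sgn_derivative (fst z) (snd z)) -` (- {0}))"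
      by (intro continuous_open_preimage o) (auto simp: open_Compl)
    moreover have "{z :: (real ^ 'n) \<times> (real ^ 'n). fst z \<noteq> 0} \<inter> (\<lambda>z. sgn_derivative (fst z) (snd z)) -` (- {0}) = \<Omega>" by (auto simp: \<Omega>_def)
    ultimately show ?thesis by simp
  qed
  define J where "J = (\<lambda>z. (F0 (fst z) (snd z), F1 (fst z) (snd z))) ` ?Q"
  have cJ: "compact J" unfolding J_def by (intro compact_continuous_image continuous_on_Pair c0Q c1Q Q(1))
  have "J \<subseteq> \<Omega>" using F0_nz tauF IS by (auto simp: J_def \<Omega>_def)
  then obtain \<eta> where \<eta>: "\<eta> > 0" "(\<Union>x\<in>J. ball x \<eta>) \<subseteq> \<Omega>"
    using compact_subset_open_imp_ball_epsilon_subset[OF cJ \<Omega>] by blast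
  define N where "N = {x + y |x y. x \<in> J \<and> y \<in> cball 0 (\<eta> / 2)}"
  have cN: "compact N" unfolding N_def by (rule compact_sums[OF cJ compact_cball])
  have N\<Omega>: "N \<subseteq> \<Omega>"
  proof
    fix z assume "z \<in> N"
    then obtain x y where "x \<in> J" "norm y \<le> \<eta> / 2" "z = x + y" by (auto simp: N_def)
    then have "z \<in> ball x \<eta>" using \<eta>(1) by (simp add: dist_norm)
    then show "z \<in> \<Omega>" using \<eta>(2) \<open>x \<in> J\<close> by blast
  qed
  have N_near: "(p, q) \<in> N" if "t \<in> {0..1}" "x \<in> {a..b}" "norm (p - F0 t x) \<le> \<eta> / 4" "norm (q - F1 t x) \<le> \<eta> / 4" for p q t x
  proof -
    have "(F0 t x, F1 t x) \<in> J" unfolding J_def using that(1,2) by (intro image_eqI[where x="(t, x)"]) auto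
    moreover have "norm (p - F0 t x, q - F1 t x) \<le> \<eta> / 2" using norm_Pair_le[of "p - F0 t x" "q - F1 t x"] that(3,4) by simp
    ultimately show ?thesis unfolding N_def
      by (intro CollectI exI[of _ "(F0 t x, F1 t x)"] exI[of _ "(p - F0 t x, q - F1 t x)"]) simp
  qed
  have "(F0 0 a, F1 0 a) \<in> N" using N_near[of 0 a "F0 0 a" "F1 0 a"] ab \<eta>(1) by simp
  then have N0: "N \<noteq> {}" by blast
  have "cdiff 0 N (\<lambda>z. jet_curvature (fst z) (snd z))"
    by (intro cdiff_jet_curvature cdiff_fst cdiff_snd cdiff_ident) (use N\<Omega> in \<open>auto simp: \<Omega>_def\<close>)
  then have "continuous_on N (\<lambda>z. jet_curvature (fst z) (snd z))" by simp
  from continuous_attains_inf[OF cN N0 this] obtain z1 where z1: "z1 \<in> N" "\<And>z. z \<in> N \<Longrightarrow> jet_curvature (fst z1) (snd z1) \<le> jet_curvature (fst z) (snd z)" by blast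
  define cm where "cm = jet_curvature (fst z1) (snd z1)"
  have cm: "0 < cm" using z1(1) N\<Omega> by (auto simp: cm_def jet_curvature_def \<Omega>_def)
  have "continuous_on N (\<lambda>z. norm (fst z))" by (intro continuous_intros)
  from continuous_attains_inf[OF cN N0 this] obtain z2 where z2: "z2 \<in> N" "\<And>z. z \<in> N \<Longrightarrow> norm (fst z2) \<le> norm (fst z)" by blast
  define um where "um = norm (fst z2)"
  have um: "0 < um" using z2(1) N\<Omega> by (auto simp: um_def \<Omega>_def)
  have near: "p \<noteq> 0" "sgn_derivative p q \<noteq> 0" "cm \<le> jet_curvature p q" "um \<le> norm p"
    if "t \<in> {0..1}" "x \<in> {a..b}" "norm (p - F0 t x) \<le> \<eta> / 4" "norm (q - F1 t x) \<le> \<eta> / 4" for p q t x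
    using N_near[OF that] N\<Omega> z1(2)[of "(p, q)"] z2(2)[of "(p, q)"] by (auto simp: \<Omega>_def cm_def um_def)
  \<comment> \<open>\<open>\<epsilon>2\<close> bounds the error of the velocity: integrated over the domain it is at most \<open>\<epsilon> / 2\<close>, as is \<open>\<epsilon>2\<close> itself\<close>
  define \<epsilon>2 where "\<epsilon>2 = \<epsilon> / (2 * (b - a + 1))"
  have \<epsilon>2: "0 < \<epsilon>2" "\<epsilon>2 * (b - a + 1) = \<epsilon> / 2"
  proof -
    show "0 < \<epsilon>2" using \<epsilon> L by (simp add: \<epsilon>2_def)
    have *: "\<epsilon> / (2 * d) * d = \<epsilon> / 2" if "d \<noteq> 0" for d using that by simp
    show "\<epsilon>2 * (b - a + 1) = \<epsilon> / 2" unfolding \<epsilon>2_def by (rule *) (use L in simp)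
  qed
  obtain B where B: "0 \<le> B" "\<And>t x. t \<in> {0..1} \<Longrightarrow> x \<in> {a..b} \<Longrightarrow> norm (F0 t x) \<le> B"
  proof -
    have "bounded ((\<lambda>z. F0 (fst z) (snd z)) ` ?Q)" by (intro compact_imp_bounded compact_continuous_image c0Q Q(1))
    then obtain B where B: "\<And>w. w \<in> (\<lambda>z. F0 (fst z) (snd z)) ` ?Q \<Longrightarrow> norm w \<le> B" unfolding bounded_iff by blast
    have "norm (F0 t x) \<le> max 0 B" if "t \<in> {0..1}" "x \<in> {a..b}" for t x
    proof -
      have "norm (F0 t x) \<le> B" by (rule B, rule image_eqI[where x = "(t, x)"]) (use that in auto)
      then show ?thesis by simp
    qed
    then show thesis using that[of "max 0 B"] by simp
  qed
  obtain \<beta> where \<beta>: "\<beta> > 0" "\<And>t x y. t \<in> {0..1} \<Longrightarrow> x \<in> {a..b} \<Longrightarrow> y \<in> {a..b} \<Longrightarrow> \<bar>y - x\<bar> < \<beta> \<Longrightarrow> norm (F0 t y - F0 t x) \<le> \<epsilon>2 / 8"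
  proof -
    have "uniformly_continuous_on ?Q (\<lambda>z. F0 (fst z) (snd z))" by (rule compact_uniformly_continuous[OF c0Q Q(1)])
    then obtain \<beta> where \<beta>: "\<beta> > 0" "\<And>z w. z \<in> ?Q \<Longrightarrow> w \<in> ?Q \<Longrightarrow> dist w z < \<beta> \<Longrightarrow> dist (F0 (fst w) (snd w)) (F0 (fst z) (snd z)) < \<epsilon>2 / 8"
      unfolding uniformly_continuous_on_def using \<epsilon>2(1) by (metis divide_pos_pos zero_less_numeral)
    show thesis
    proof (rule that[OF \<beta>(1)])
      fix t x y assume "t \<in> {0..1::real}" "x \<in> {a..b}" "y \<in> {a..b}" "\<bar>y - x\<bar> < \<beta>"
      then show "norm (F0 t y - F0 t x) \<le> \<epsilon>2 / 8"
        using \<beta>(2)[of "(t, x)" "(t, y)"] by (simp add: dist_Pair_Pair dist_norm)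
    qed
  qed
  define \<delta> where "\<delta> = min (\<eta> / 8) (min 1 (\<epsilon>2 / 40))"
  define r0 where "r0 = min (\<eta> / 8) (min (\<epsilon>2 / 16) (um * \<beta> / (8 * (b - a))))"
  define e where "e = min (\<epsilon>2 / (8 * (B + 1))) (cm * um * \<beta> / 8)"
  have \<delta>: "0 < \<delta>" "\<delta> \<le> \<eta> / 8" "\<delta> \<le> 1" "\<delta> \<le> \<epsilon>2 / 40" using \<eta>(1) \<epsilon>2(1) by (simp_all add: \<delta>_def)
  have r0_le: "0 < r0" "r0 \<le> \<eta> / 8" "r0 \<le> \<epsilon>2 / 16" "r0 * (b - a) \<le> um * \<beta> / 8"
  proof -
    show "0 < r0" using \<eta>(1) \<epsilon>2(1) um \<beta>(1) L by (simp add: r0_def)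
    show "r0 \<le> \<eta> / 8" unfolding r0_def by (rule min.cobounded1)
    show "r0 \<le> \<epsilon>2 / 16" unfolding r0_def by (rule min.coboundedI2[OF min.cobounded1])
    have "r0 \<le> um * \<beta> / (8 * (b - a))" by (simp add: r0_def)
    then show "r0 * (b - a) \<le> um * \<beta> / 8" using L by (simp add: field_simps)
  qed
  have e: "0 < e" "e * (B + 1) \<le> \<epsilon>2 / 8" "e \<le> cm * (um * \<beta> / 8)"
  proof -
    show "0 < e" using \<epsilon>2(1) B(1) cm um \<beta>(1) by (simp add: e_def)
    have "e \<le> \<epsilon>2 / (8 * (B + 1))" by (simp add: e_def)
    then show "e * (B + 1) \<le> \<epsilon>2 / 8" using B(1) by (simp add: field_simps)
    have "e \<le> cm * um * \<beta> / 8" unfolding e_def by (rule min.cobounded2)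
    then show "e \<le> cm * (um * \<beta> / 8)" by (simp add: mult.assoc)
  qed
  obtain u u1 u2 :: "real \<Rightarrow> real \<Rightarrow> real ^ 'n" where
    u_der: "\<And>t x. t \<in> {0..1} \<Longrightarrow> (u t has_vector_derivative u1 t x) (at x)"
    and u1_der: "\<And>t x. t \<in> {0<..<1} \<Longrightarrow> (u1 t has_vector_derivative u2 t x) (at x)"
    and u1_smooth: "\<And>t. t \<in> {0<..<1} \<Longrightarrow> cdiff k UNIV (u1 t)"
    and u_cont: "continuous_on ({0..1} \<times> UNIV) (\<lambda>(t, x). u t x)"
    and u1_cont: "continuous_on ({0..1} \<times> UNIV) (\<lambda>(t, x). u1 t x)"
    and u2_cont: "continuous_on ({0<..<1} \<times> UNIV) (\<lambda>(t, x). u2 t x)"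
    and u_per: "\<And>t. t \<in> {0..1} \<Longrightarrow> map_on \<Gamma> (u t)"
    and u1_per: "\<And>t. t \<in> {0..1} \<Longrightarrow> map_on \<Gamma> (u1 t)"
    and u2_per: "\<And>t. t \<in> {0<..<1} \<Longrightarrow> map_on \<Gamma> (u2 t)"
    and u_mean: "\<And>t. t \<in> {0..1} \<Longrightarrow> \<Gamma> = Circle a b \<Longrightarrow> integral {a..b} (u t) = 0"
    and u_ends: "\<And>t x. t \<in> {0, 1} \<Longrightarrow> x \<in> points \<Gamma> \<Longrightarrow> u t x = F0 t x \<and> u1 t x = F1 t x"
    and u_near: "\<And>t x. t \<in> {0..1} \<Longrightarrow> x \<in> {a..b} \<Longrightarrow> norm (u t x - F0 t x) \<le> \<delta> \<and> norm (u1 t x - F1 t x) \<le> \<delta>"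
  proof -
    show thesis by (rule smoothing[where K = k, OF der1 c0 c1 Fper f(1) der0 \<delta>(1)]) (assumption | fact that)+
  qed
  have u_near4: "norm (u t x + w - F0 t x) \<le> \<eta> / 4" "norm (u1 t x - F1 t x) \<le> \<eta> / 4"
    if "t \<in> {0..1}" "x \<in> {a..b}" "norm w \<le> r0" for t x w
  proof -
    have "u t x + w - F0 t x = (u t x - F0 t x) + w" by simp
    then have "norm (u t x + w - F0 t x) \<le> norm (u t x - F0 t x) + norm w" by (simp only: norm_triangle_ineq)
    then show "norm (u t x + w - F0 t x) \<le> \<eta> / 4" using u_near[OF that(1,2)] that(3) \<delta>(2) r0_le(2) by linarith
    show "norm (u1 t x - F1 t x) \<le> \<eta> / 4" using u_near[OF that(1,2)] \<delta>(1,2) by linarith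
  qed
  have nondeg: "u t x + w \<noteq> 0 \<and> sgn_derivative (u t x + w) (u1 t x) \<noteq> 0" if "t \<in> {0..1}" "x \<in> {a..b}" "norm w \<le> r0" for t x w
    using near(1,2)[OF that(1,2) u_near4[OF that]] by blast
  have u_jet_curvature: "cm \<le> jet_curvature (u t x) (u1 t x)" and u_um: "um \<le> norm (u t x)" if "t \<in> {0..1}" "x \<in> {a..b}" for t x
    using near(3,4)[OF that u_near4[OF that, of 0]] r0_le(1) by simp_all
  have jet_curvature_ends: "\<exists>c. \<forall>x\<in>{a..b}. jet_curvature (u t x) (u1 t x) = c" if t: "t \<in> {0, 1}" for t
  proof -
    have "constant_curvature \<Gamma> (f t)" using t cc by auto
    then obtain c where "\<forall>x\<in>points \<Gamma>. curvature \<Gamma> (f t) x = c" by (auto simp: constant_curvature_def)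
    then have "\<forall>x\<in>{a..b}. jet_curvature (u t x) (u1 t x) = c" using kapF[OF ends01[OF t]] u_ends[OF t] IS by simp
    then show ?thesis by blast
  qed
  interpret corrugation_data \<Gamma> a b u u1 u2 r0 cm k
    by (intro corrugation_data.intro corrugation_data_axioms.intro curve_dom_axioms)
      (fact n u_der u1_der u1_smooth u_cont u1_cont u2_cont u_per u1_per u2_per u_mean r0_le(1) nondeg cm u_jet_curvature jet_curvature_ends)+
  have target_curvature_ge: "cm \<le> target_curvature t" if "t \<in> {0..1}" for t by (rule target_curvature_ge[OF that])
  obtain Th dTh :: "real \<Rightarrow> real \<Rightarrow> real ^ 'n" and W :: "real \<Rightarrow> real ^ 'n" where
    Th_der: "\<And>t x. t \<in> {0..1} \<Longrightarrow> x \<in> points \<Gamma> \<Longrightarrow> (Th t has_vector_derivative dTh t x) (at x within points \<Gamma>)"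
    and Th_unit: "\<And>t x. t \<in> {0..1} \<Longrightarrow> x \<in> points \<Gamma> \<Longrightarrow> norm (Th t x) = 1 \<and> dTh t x \<noteq> 0"
    and Th_cont: "continuous_on ({0..1} \<times> {a..b}) (\<lambda>(t, x). Th t x)"
    and dTh_cont: "continuous_on ({0..1} \<times> {a..b}) (\<lambda>(t, x). dTh t x)"
    and Th_per: "\<And>t. t \<in> {0..1} \<Longrightarrow> map_on \<Gamma> (Th t)" and dTh_per: "\<And>t. t \<in> {0..1} \<Longrightarrow> map_on \<Gamma> (dTh t)"
    and Th_smooth: "\<And>t. t \<in> {0<..<1} \<Longrightarrow> cdiff k (points \<Gamma>) (Th t)"
    and Th_ends: "\<And>t x. t \<in> {0, 1} \<Longrightarrow> x \<in> points \<Gamma> \<Longrightarrow> Th t x = sgn (u t x) \<and> dTh t x = sgn_derivative (u t x) (u1 t x)"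
    and Th_closed: "\<And>t. t \<in> {0..1} \<Longrightarrow> \<Gamma> = Circle a b \<Longrightarrow> integral {a..b} (\<lambda>x. norm (dTh t x) *\<^sub>R Th t x) = 0"
    and Th_near: "\<And>t x. t \<in> {0..1} \<Longrightarrow> x \<in> {a..b} \<Longrightarrow> norm (Th t x - sgn (u t x + W t)) \<le> e"
    and Th_length: "\<And>t y. t \<in> {0..1} \<Longrightarrow> y \<in> {a..b} \<Longrightarrow>
      \<bar>integral {a..y} (\<lambda>x. norm (dTh t x)) - target_curvature t * integral {a..y} (\<lambda>x. norm (u t x + W t))\<bar> \<le> e"
    and W: "\<And>t. t \<in> {0..1} \<Longrightarrow> norm (W t) \<le> r0"
  proof -
    show thesis by (rule spherical_family[OF e(1)]) (fact that)
  qed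
  have u_nz: "u t x \<noteq> 0" if "t \<in> {0..1}" "x \<in> points \<Gamma>" for t x
    using ball_points[OF u_per(1)[OF that(1)], of "\<lambda>p. p \<noteq> 0"] nondeg[OF that(1), of _ 0] r0_le(1) that(2) by auto
  have uS: "continuous_on ({0..1} \<times> A) (\<lambda>z. u (fst z) (snd z))" "continuous_on ({0..1} \<times> A) (\<lambda>z. u1 (fst z) (snd z))" for A
    by (rule continuous_on_joint[OF u_cont] continuous_on_joint[OF u1_cont]; auto intro!: continuous_intros)+
  have uI: "continuous_on A (u t)" "continuous_on A (u1 t)" if "t \<in> {0..1}" for t A
    using continuous_on_slice[OF u_cont that] continuous_on_slice[OF u1_cont that] continuous_on_subset by blast+
  have dTh_cont': "continuous_on (points \<Gamma>) (dTh t)" if t: "t \<in> {0..1}" for t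
  proof (cases "t \<in> {0<..<1}")
    case True
    have "cdiff (Suc 0) (points \<Gamma>) (Th t)" by (rule cdiff_mono[OF Th_smooth[OF True]]) (use k2 in simp)
    from cdiff_vderiv(2)[OF this] have "continuous_on (points \<Gamma>) (vderiv \<Gamma> (Th t))" by simp
    then show ?thesis by (rule iffD1[OF continuous_on_cong[OF refl], rotated]) (rule vderiv_eq[OF _ Th_der[OF t]])
  next
    case False
    then have t': "t \<in> {0, 1}" using t by auto
    have "cdiff 0 (points \<Gamma>) (\<lambda>x. sgn_derivative (u t x) (u1 t x))"
      by (rule cdiff_sgn_derivative) (use uI[OF t] u_nz[OF t] in auto)
    then have "continuous_on (points \<Gamma>) (\<lambda>x. sgn_derivative (u t x) (u1 t x))" by simp
    then show ?thesis by (rule iffD1[OF continuous_on_cong[OF refl], rotated]) (use Th_ends[OF t'] in simp)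
  qed
  define v where "v t x = norm (u t x)" for t x
  define v1 where "v1 t x = u1 t x \<bullet> sgn (u t x)" for t x
  have v_der: "(v t has_vector_derivative v1 t x) (at x within points \<Gamma>)" if "t \<in> {0..1}" "x \<in> points \<Gamma>" for t x
    unfolding v_def[abs_def] v1_def
    by (rule has_vector_derivative_norm[OF has_vector_derivative_at_within[OF u_der[OF that(1)]] u_nz[OF that]])
  have v_pos: "0 < v t x" if "t \<in> {0..1}" "x \<in> points \<Gamma>" for t x using u_nz[OF that] by (simp add: v_def)
  have v_cont: "continuous_on ({0..1} \<times> {a..b}) (\<lambda>(t, x). v t x)"
    unfolding v_def case_prod_unfold by (intro continuous_on_norm uS)
  have "cdiff 0 ({0..1} \<times> {a..b}) (\<lambda>z. sgn (u (fst z) (snd z)))"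
    by (rule cdiff_sgn) (use uS u_nz IS in auto)
  then have v1_cont: "continuous_on ({0..1} \<times> {a..b}) (\<lambda>(t, x). v1 t x)"
    unfolding v1_def case_prod_unfold by (intro continuous_on_inner uS) simp
  have v_per: "map_on \<Gamma> (v t)" if "t \<in> {0..1}" for t
    unfolding v_def[abs_def] by (rule map_on_comp[OF u_per(1)[OF that]])
  have "continuous_on ({0..1} \<times> points \<Gamma>) (\<lambda>(t, x). f t x)" using homotopy_jointly_continuous[OF hom, of 0] by simp
  then have p_cont: "continuous_on {0..1} (\<lambda>t. f t a)"
    by (rule continuous_on_joint) (use IS ab in \<open>auto intro: continuous_intros\<close>)
  obtain g :: "real \<Rightarrow> real \<Rightarrow> real ^ 'n" and \<phi> :: "real \<Rightarrow> real \<Rightarrow> real" and c :: "real \<Rightarrow> real" where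
    g_a: "\<And>t. t \<in> {0..1} \<Longrightarrow> g t a = f t a" and g_per: "\<And>t. t \<in> {0..1} \<Longrightarrow> map_on \<Gamma> (g t)"
    and g_der: "\<And>t x. t \<in> {0..1} \<Longrightarrow> x \<in> points \<Gamma> \<Longrightarrow> (g t has_vector_derivative v t x *\<^sub>R Th t (\<phi> t x)) (at x within points \<Gamma>)"
    and \<phi>_in: "\<And>t x. t \<in> {0..1} \<Longrightarrow> x \<in> {a..b} \<Longrightarrow> \<phi> t x \<in> {a..b}" and \<phi>_b: "\<And>t. t \<in> {0..1} \<Longrightarrow> \<phi> t b = b"
    and \<phi>_length: "\<And>t x. t \<in> {0..1} \<Longrightarrow> x \<in> {a..b} \<Longrightarrow>
      integral {a..\<phi> t x} (\<lambda>x. norm (dTh t x)) = c t * integral {a..x} (v t)"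
    and g_curv: "\<And>t x. t \<in> {0..1} \<Longrightarrow> x \<in> points \<Gamma> \<Longrightarrow> curvature \<Gamma> (g t) x = c t"
    and g_smooth: "\<And>t K. t \<in> {0..1} \<Longrightarrow> cdiff K (points \<Gamma>) (Th t) \<Longrightarrow> cdiff K (points \<Gamma>) (v t) \<Longrightarrow> cdiff (Suc K) (points \<Gamma>) (g t)"
    and g_cont: "\<And>j. j \<le> 2 \<Longrightarrow> continuous_on ({0..1} \<times> {a..b}) (\<lambda>(t, x). nth_vderiv \<Gamma> j (g t) x)"
  proof -
    show thesis
      by (rule constant_speed_reparametrization[OF Th_der Th_unit Th_cont dTh_cont dTh_cont' Th_per dTh_per
          v_der v_pos v_cont v1_cont v_per Th_closed p_cont]) (assumption | fact that)+
  qed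
  have vI: "continuous_on {a..b} (v t)" if "t \<in> {0..1}" for t by (rule continuous_on_slice[OF v_cont that])
  have v_growth: "um * \<bar>y - x\<bar> \<le> \<bar>integral {a..y} (v t) - integral {a..x} (v t)\<bar>"
    if "t \<in> {0..1}" "x \<in> {a..b}" "y \<in> {a..b}" for t x y
    by (rule integral_lower_growth[OF vI[OF that(1)] _ that(2,3)]) (use u_um[OF that(1)] in \<open>simp add: v_def\<close>)
  have v_int_mono: "0 \<le> integral {a..x} (v t)" "integral {a..x} (v t) \<le> integral {a..b} (v t)" if "t \<in> {0..1}" "x \<in> {a..b}" for t x
  proof -
    have int: "v t integrable_on {a..y}" if "y \<le> b" for y
      by (rule integrable_continuous_real, rule continuous_on_subset[OF vI[OF \<open>t \<in> {0..1}\<close>]]) (use that in auto)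
    show "0 \<le> integral {a..x} (v t)" by (rule integral_nonneg[OF int]) (use that(2) in \<open>auto simp: v_def\<close>)
    show "integral {a..x} (v t) \<le> integral {a..b} (v t)"
      by (rule integral_subset_le) (use that(2) int in \<open>auto simp: v_def\<close>)
  qed
  have v_int_b: "0 < integral {a..b} (v t)" if "t \<in> {0..1}" for t
  proof -
    have "0 < um * \<bar>b - a\<bar>" using um L by simp
    then show ?thesis using v_growth[OF that, of a b] v_int_mono(1)[OF that, of b] ab by auto
  qed
  \<comment> \<open>at the end times \<open>Th t\<close> is the tantrix of \<open>f t\<close>, whose length is already a constant times the length of \<open>f t\<close>\<close>
  have g_ends: "g t x = f t x" if t: "t \<in> {0, 1}" and x: "x \<in> points \<Gamma>" for t x
  proof -
    note t1 = ends01[OF t]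
    have nv: "norm (dTh t y) = target_curvature t * v t y" if "y \<in> {a..b}" for y
      using Th_ends[OF t IS[OF that]] norm_sgn_derivative[OF u_nz[OF t1 IS[OF that]], of "u1 t y"] target_curvature_ends[OF t that]
      by (simp add: v_def mult.commute)
    have len: "integral {a..y} (\<lambda>x. norm (dTh t x)) = target_curvature t * integral {a..y} (v t)" if "y \<in> {a..b}" for y
    proof -
      have "integral {a..y} (\<lambda>x. norm (dTh t x)) = integral {a..y} (\<lambda>x. target_curvature t * v t x)"
        by (rule integral_cong) (use that nv in auto)
      then show ?thesis by simp
    qed
    have "target_curvature t * integral {a..b} (v t) = c t * integral {a..b} (v t)"
      using \<phi>_length[OF t1, of b] len[of b] \<phi>_b[OF t1] ab by simp
    then have c: "c t = target_curvature t" using v_int_b[OF t1] by simp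
    have \<phi>_id: "\<phi> t y = y" if y: "y \<in> {a..b}" for y
    proof -
      have "target_curvature t * integral {a..\<phi> t y} (v t) = target_curvature t * integral {a..y} (v t)"
        using \<phi>_length[OF t1 y] len[OF \<phi>_in[OF t1 y]] c by simp
      then have "integral {a..\<phi> t y} (v t) = integral {a..y} (v t)" using target_curvature_pos[OF t1] by simp
      then show ?thesis using v_growth[OF t1 y \<phi>_in[OF t1 y]] um by (simp add: mult_le_0_iff)
    qed
    have "((\<lambda>y. g t y - f t y) has_vector_derivative 0) (at y within {a..b})" if y: "y \<in> {a..b}" for y
    proof -
      have "v t y *\<^sub>R Th t (\<phi> t y) = F0 t y"
        using Th_ends[OF t IS[OF y]] \<phi>_id[OF y] u_ends[OF t IS[OF y]] u_nz[OF t1 IS[OF y]] by (simp add: v_def sgn_div_norm)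
      then have "(g t has_vector_derivative F0 t y) (at y within points \<Gamma>)" using g_der[OF t1 IS[OF y]] by simp
      from has_vector_derivative_diff[OF this der0[OF t1 IS[OF y]]] show ?thesis
        using has_vector_derivative_within_subset[OF _ Icc_subset] by simp
    qed
    then obtain d where d: "\<And>y. y \<in> {a..b} \<Longrightarrow> g t y - f t y = d"
      using has_vector_derivative_zero_constant[of "{a..b}" "\<lambda>y. g t y - f t y"] by auto
    then have "g t y = f t y" if "y \<in> {a..b}" for y using d[OF that] d[of a] g_a[OF t1] ab by simp
    from this[OF reduce_in[OF x]] show ?thesis
      unfolding reduce_eq[OF g_per[OF t1]] reduce_eq[OF f(1)[OF t1]] .
  qed
  \<comment> \<open>the lengths \<open>I\<close> of the curve up to \<open>\<phi> t x\<close> and up to \<open>x\<close> are compared through the length \<open>S\<close> of \<open>Th t\<close>\<close>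
  have \<phi>_near: "\<bar>\<phi> t x - x\<bar> < \<beta>" if t: "t \<in> {0..1}" and x: "x \<in> {a..b}" for t x
  proof -
    define I where "I y = integral {a..y} (v t)" for y
    define S where "S y = integral {a..y} (\<lambda>x. norm (dTh t x))" for y
    define R where "R = r0 * (b - a)"
    have cp: "0 < target_curvature t" by (rule target_curvature_pos[OF t])
    have SI: "\<bar>S y - target_curvature t * I y\<bar> \<le> e + target_curvature t * R" if y: "y \<in> {a..b}" for y
    proof -
      have i1: "(\<lambda>x. norm (u t x + W t)) integrable_on {a..y}" and i2: "v t integrable_on {a..y}"
        unfolding v_def by (intro integrable_continuous_real continuous_on_norm continuous_on_add uI[OF t] continuous_on_const)+
      have "norm (integral {a..y} (\<lambda>x. norm (u t x + W t) - v t x)) \<le> integral {a..y} (\<lambda>x. r0)"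
      proof (rule integral_norm_bound_integral[OF integrable_diff[OF i1 i2]])
        fix x
        have "\<bar>norm (u t x + W t) - norm (u t x)\<bar> \<le> norm (W t)" using norm_triangle_ineq3[of "u t x + W t" "u t x"] by simp
        then show "norm (norm (u t x + W t) - v t x) \<le> r0" using W[OF t] by (simp add: v_def)
      qed (intro integrable_continuous_real continuous_on_const)
      also have "integral {a..y} (\<lambda>x. r0) \<le> R" using y r0_le(1) by (simp add: R_def mult.commute mult_left_mono)
      finally have "\<bar>integral {a..y} (\<lambda>x. norm (u t x + W t)) - I y\<bar> \<le> R"
        by (simp add: integral_diff[OF i1 i2] I_def)
      then have "target_curvature t * \<bar>integral {a..y} (\<lambda>x. norm (u t x + W t)) - I y\<bar> \<le> target_curvature t * R" using cp by (intro mult_left_mono) auto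
      then have "\<bar>target_curvature t * integral {a..y} (\<lambda>x. norm (u t x + W t)) - target_curvature t * I y\<bar> \<le> target_curvature t * R"
        using cp by (simp add: abs_mult right_diff_distrib[symmetric])
      then show ?thesis using Th_length[OF t y] unfolding S_def by linarith
    qed
    have Sphi: "S (\<phi> t y) = c t * I y" if "y \<in> {a..b}" for y using \<phi>_length[OF t that] by (simp add: S_def I_def)
    have bI: "b \<in> {a..b}" using ab by simp
    have Ib: "0 < I b" using v_int_b[OF t] by (simp add: I_def)
    have cb: "\<bar>c t - target_curvature t\<bar> * I b \<le> e + target_curvature t * R"
      using SI[OF bI] Sphi[OF bI] \<phi>_b[OF t] Ib by (simp add: abs_mult left_diff_distrib[symmetric] abs_of_pos)
    have "\<bar>c t - target_curvature t\<bar> * I x \<le> \<bar>c t - target_curvature t\<bar> * I b"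
      using v_int_mono(2)[OF t x] by (intro mult_left_mono) (auto simp: I_def)
    then have 1: "\<bar>c t * I x - target_curvature t * I x\<bar> \<le> e + target_curvature t * R"
      using cb v_int_mono(1)[OF t x] by (simp add: left_diff_distrib[symmetric] abs_mult I_def)
    have 2: "\<bar>c t * I x - target_curvature t * I (\<phi> t x)\<bar> \<le> e + target_curvature t * R"
      using SI[OF \<phi>_in[OF t x]] Sphi[OF x] by simp
    have "\<bar>y - x\<bar> \<le> 2 * A" if "\<bar>p - x\<bar> \<le> A" "\<bar>p - y\<bar> \<le> A" for p x y A :: real using that by linarith
    from this[OF 1 2] have "\<bar>target_curvature t * I (\<phi> t x) - target_curvature t * I x\<bar> \<le> 2 * (e + target_curvature t * R)" .
    then have "target_curvature t * \<bar>I (\<phi> t x) - I x\<bar> \<le> 2 * (e + target_curvature t * R)" using cp by (simp add: abs_mult right_diff_distrib[symmetric])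
    also have "\<dots> \<le> target_curvature t * (um * \<beta> / 2)"
    proof -
      have "e \<le> target_curvature t * (um * \<beta> / 8)"
      proof -
        have "cm * (um * \<beta> / 8) \<le> target_curvature t * (um * \<beta> / 8)"
          by (rule mult_right_mono[OF target_curvature_ge[OF t]]) (use um \<beta>(1) in simp)
        then show ?thesis using e(3) by linarith
      qed
      moreover have "target_curvature t * R \<le> target_curvature t * (um * \<beta> / 8)" using r0_le(4) cp by (intro mult_left_mono) (auto simp: R_def)
      ultimately show ?thesis by simp
    qed
    finally have "\<bar>I (\<phi> t x) - I x\<bar> \<le> um * \<beta> / 2" using cp by (simp only: mult_le_cancel_left_pos)
    moreover have "um * \<bar>\<phi> t x - x\<bar> \<le> \<bar>I (\<phi> t x) - I x\<bar>" unfolding I_def by (rule v_growth[OF t x \<phi>_in[OF t x]])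
    ultimately have "um * \<bar>\<phi> t x - x\<bar> \<le> um * (\<beta> / 2)" by simp
    then have "\<bar>\<phi> t x - x\<bar> \<le> \<beta> / 2" using um by (simp only: mult_le_cancel_left_pos)
    then show ?thesis using \<beta>(1) by linarith
  qed
  have tri3: "norm (p - q + r) \<le> norm p + norm q + norm r" and tri4: "norm (p + q + r - s) \<le> norm p + norm q + norm r + norm s"
    for p q r s :: "real ^ 'n" by norm+
  have close: "norm (v t x *\<^sub>R Th t (\<phi> t x) - F0 t x) \<le> \<epsilon>2" if t: "t \<in> {0..1}" and x: "x \<in> {a..b}" for t x
  proof -
    let ?y = "\<phi> t x"
    let ?q = "u t ?y + W t"
    note y = \<phi>_in[OF t x]
    have q0: "?q \<noteq> 0" using nondeg[OF t y W[OF t]] by blast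
    have ux: "norm (u t x - F0 t x) \<le> \<delta>" and uy: "norm (u t ?y - F0 t ?y) \<le> \<delta>" using u_near[OF t x] u_near[OF t y] by auto
    have "norm (u t x) \<le> norm (F0 t x) + norm (u t x - F0 t x)" by (rule norm_triangle_sub)
    then have vB: "v t x \<le> B + 1" using B(2)[OF t x] ux \<delta>(3) by (simp add: v_def)
    have "norm (F0 t ?y - F0 t x) \<le> \<epsilon>2 / 8" by (rule \<beta>(2)[OF t x y \<phi>_near[OF t x]])
    moreover have "u t x - ?q = (u t x - F0 t x) + (F0 t x - F0 t ?y) + (F0 t ?y - u t ?y) - W t" by simp
    then have "norm (u t x - ?q) \<le> norm (u t x - F0 t x) + norm (F0 t x - F0 t ?y) + norm (F0 t ?y - u t ?y) + norm (W t)"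
      by (simp only: tri4)
    ultimately have d: "norm (u t x - ?q) \<le> 2 * \<delta> + \<epsilon>2 / 8 + r0"
      using ux uy W[OF t] by (simp add: norm_minus_commute)
    have "v t x *\<^sub>R Th t ?y - F0 t x = v t x *\<^sub>R (Th t ?y - sgn ?q) - (u t x - norm (u t x) *\<^sub>R sgn ?q) + (u t x - F0 t x)"
      by (simp add: v_def algebra_simps)
    then have "norm (v t x *\<^sub>R Th t ?y - F0 t x) \<le> norm (v t x *\<^sub>R (Th t ?y - sgn ?q)) + norm (u t x - norm (u t x) *\<^sub>R sgn ?q) + norm (u t x - F0 t x)"
      by (simp only: tri3)
    moreover have "norm (v t x *\<^sub>R (Th t ?y - sgn ?q)) \<le> (B + 1) * e"
      using mult_mono[OF vB Th_near[OF t y]] B(1) v_pos[OF t IS[OF x]] by simp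
    moreover have "norm (u t x - norm (u t x) *\<^sub>R sgn ?q) \<le> 2 * norm (u t x - ?q)" by (rule norm_scaled_sgn_diff[OF q0])
    ultimately have "norm (v t x *\<^sub>R Th t ?y - F0 t x) \<le> (B + 1) * e + 2 * (2 * \<delta> + \<epsilon>2 / 8 + r0) + \<delta>" using d ux by argo
    also have "\<dots> \<le> \<epsilon>2"
    proof -
      have "(B + 1) * e \<le> \<epsilon>2 / 8" using e(2) by (simp add: mult.commute)
      then show ?thesis using \<delta>(4) r0_le(3) \<epsilon>2(1) by simp
    qed
    finally show ?thesis .
  qed
  have close0: "norm (g t x - f t x) \<le> \<epsilon> / 2" if t: "t \<in> {0..1}" and x: "x \<in> {a..b}" for t x
  proof -
    have sub: "{a..x} \<subseteq> points \<Gamma>" using x IS by auto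
    have "((\<lambda>y. v t y *\<^sub>R Th t (\<phi> t y) - F0 t y) has_integral (g t x - f t x) - (g t a - f t a)) {a..x}"
    proof (rule fundamental_theorem_of_calculus)
      fix y assume "y \<in> {a..x}"
      then have "y \<in> points \<Gamma>" using sub by blast
      from has_vector_derivative_diff[OF g_der[OF t this] der0[OF t this]]
      show "((\<lambda>x. g t x - f t x) has_vector_derivative v t y *\<^sub>R Th t (\<phi> t y) - F0 t y) (at y within {a..x})"
        by (rule has_vector_derivative_within_subset[OF _ sub])
    qed (use x in simp)
    then have "norm ((g t x - f t x) - (g t a - f t a)) \<le> \<epsilon>2 * measure lborel {a..x}"
      by (rule has_integral_bound_real[OF less_imp_le[OF \<epsilon>2(1)] finite.emptyI]) (use close[OF t] x in auto)
    also have "\<dots> \<le> \<epsilon>2 * (b - a + 1)" using x \<epsilon>2(1) by (intro mult_left_mono) auto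
    finally show ?thesis using g_a[OF t] \<epsilon>2(2) by simp
  qed
  have \<epsilon>2_le: "\<epsilon>2 \<le> \<epsilon> / 2"
  proof -
    have "\<epsilon>2 * 1 \<le> \<epsilon>2 * (b - a + 1)" using \<epsilon>2(1) L by (intro mult_left_mono) auto
    then show ?thesis using \<epsilon>2(2) by simp
  qed
  define G where "G t = (if t \<in> {0, 1} then f t else g t)" for t
  have Gg: "G t x = g t x" if "t \<in> {0..1}" "x \<in> points \<Gamma>" for t x using g_ends[of t x] that by (auto simp: G_def)
  have Gn: "nth_vderiv \<Gamma> j (G t) x = nth_vderiv \<Gamma> j (g t) x" if "t \<in> {0..1}" "x \<in> points \<Gamma>" for j t x
    by (rule nth_vderiv_cong[OF Gg[OF that(1)] that(2)])
  have gv: "vderiv \<Gamma> (g t) x = v t x *\<^sub>R Th t (\<phi> t x)" if "t \<in> {0..1}" "x \<in> points \<Gamma>" for t x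
    by (rule vderiv_eq[OF that(2) g_der[OF that]])
  have GI: "G t \<in> Imm \<Gamma> k" if t: "t \<in> {0..1}" for t
  proof (cases "t \<in> {0, 1}")
    case True
    then show ?thesis using fI[OF t] by (simp add: G_def)
  next
    case False
    then have t': "t \<in> {0<..<1}" using t by auto
    have "cdiff (Suc k) UNIV (u t)"
      by (rule cdiff_real_Suc[OF _ u1_smooth[OF t']]) (use u_der[OF t] in simp)
    from cdiff_subset[OF cdiff_SucD[OF this], of "points \<Gamma>"] have "cdiff k (points \<Gamma>) (v t)"
      unfolding v_def[abs_def] by (intro cdiff_norm) (use u_nz[OF t] in auto)
    from cdiff_SucD[OF g_smooth[OF t Th_smooth[OF t'] this]] have gk: "cdiff k (points \<Gamma>) (g t)" .
    have nz: "vderiv \<Gamma> (g t) x \<noteq> 0" if "x \<in> points \<Gamma>" for x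
    proof -
      have "norm (v t x *\<^sub>R Th t (\<phi> t x)) \<noteq> 0"
      proof -
        have "Th t (\<phi> t x) \<noteq> 0 \<or> \<not> \<phi> t x \<in> points \<Gamma>" using Th_unit[OF t, of "\<phi> t x"] by auto
        moreover have "\<phi> t x \<in> points \<Gamma>" using \<phi>_in[OF t, of x] that dom by auto
        ultimately show ?thesis using v_pos[OF t that] by simp
      qed
      then show ?thesis using gv[OF t that] by simp
    qed
    have "locally_injective \<Gamma> (g t)"
      by (rule immersion_locally_injective[OF cdiff_mono[OF gk] nz]) (use k2 in auto)
    then show ?thesis using gk g_per[OF t] nz False by (simp add: G_def Imm_def Ck_iff_cdiff)
  qed
  have hG: "curve_homotopy \<Gamma> k 2 G"
  proof (rule homotopy_from_jointly_continuous[OF GI k2])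
    fix j :: nat assume "j \<le> 2"
    from g_cont[OF this] show "continuous_on ({0..1} \<times> {a..b}) (\<lambda>(t, x). nth_vderiv \<Gamma> j (G t) x)"
      by (rule iffD1[OF continuous_on_cong, rotated 2]) (auto simp: Gn IS)
  qed
  have "constant_curvature \<Gamma> (G t)" if "t \<in> {0..1}" for t
    using cc g_curv[OF that] by (auto simp: G_def constant_curvature_def)
  moreover have "Ck_norm \<Gamma> 1 (\<lambda>x. G t x - f t x) \<le> \<epsilon>" if t: "t \<in> {0..1}" for t
  proof -
    have Gt: "map_on \<Gamma> (G t)" "cdiff k (points \<Gamma>) (G t)" using GI[OF t] by (auto simp: Imm_def Ck_iff_cdiff)
    have bound: "norm (nth_vderiv \<Gamma> j (\<lambda>x. G t x - f t x) x) \<le> \<epsilon> / 2" if j: "j \<le> 1" and x: "x \<in> points \<Gamma>" for j x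
    proof -
      have m: "map_on \<Gamma> (nth_vderiv \<Gamma> j (\<lambda>x. G t x - f t x))"
        by (rule map_on_nth_vderiv[OF map_on_comp2[OF Gt(1) f(1)[OF t], of "\<lambda>p q. p - q"]])
      have "norm (nth_vderiv \<Gamma> j (\<lambda>x. G t x - f t x) x) \<le> \<epsilon> / 2" if xI: "x \<in> {a..b}" for x
      proof -
        have "nth_vderiv \<Gamma> j (\<lambda>x. G t x - f t x) x = nth_vderiv \<Gamma> j (g t) x - nth_vderiv \<Gamma> j (f t) x"
          unfolding Gn[OF t IS[OF xI], symmetric]
          by (rule nth_vderiv_diff[OF cdiff_mono[OF Gt(2)] cdiff_mono[OF f(2)[OF t]] IS[OF xI]]) (use j k2 in auto)
        moreover have "norm (nth_vderiv \<Gamma> j (g t) x - nth_vderiv \<Gamma> j (f t) x) \<le> \<epsilon> / 2"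
        proof (cases "j = 0")
          case False
          then have "j = Suc 0" using j by simp
          then show ?thesis using close[OF t xI] \<epsilon>2_le gv[OF t IS[OF xI]] by (simp add: nth_vderiv_Suc F0_def[symmetric])
        qed (use close0[OF t xI] in simp)
        ultimately show ?thesis by simp
      qed
      then show ?thesis using ball_points[OF m, of "\<lambda>w. norm w \<le> \<epsilon> / 2"] x by blast
    qed
    show ?thesis using Ck_norm_le[of 1 "\<lambda>x. G t x - f t x" "\<epsilon> / 2"] bound by simp
  qed
  ultimately show ?thesis using hG by (intro exI[of _ G]) (auto simp: G_def)
qed

end

theorem theorem1p1:
  fixes \<Gamma> :: curve_domain and a b \<epsilon> :: real and k :: nat
    and f :: "real \<Rightarrow> real \<Rightarrow> real ^ 'n"
  assumes "a < b" and "\<Gamma> = Interval a b \<or> \<Gamma> = Circle a b"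
    and "2 \<le> k" and "3 \<le> CARD('n)"
    and "curve_homotopy \<Gamma> k 2 f"
    and "\<forall>t\<in>{0..1}. nonvanishing_curvature \<Gamma> (f t)"
    and "constant_curvature \<Gamma> (f 0)" and "constant_curvature \<Gamma> (f 1)"
    and "\<epsilon> > 0"
  shows "\<exists>g :: real \<Rightarrow> real \<Rightarrow> real ^ 'n.
    curve_homotopy \<Gamma> k 2 g
    \<and> (\<forall>t\<in>{0..1}. constant_curvature \<Gamma> (g t))
    \<and> (\<forall>x\<in>points \<Gamma>. g 0 x = f 0 x) \<and> (\<forall>x\<in>points \<Gamma>. g 1 x = f 1 x)
    \<and> (\<forall>t\<in>{0..1}. Ck_norm \<Gamma> 1 (\<lambda>x. g t x - f t x) \<le> \<epsilon>)"
proof -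
  interpret curve_dom \<Gamma> a b by unfold_locales (use assms in auto)
  show ?thesis by (rule constant_curvature_homotopy) (use assms in auto)
qed

end
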